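(* Let $\mathcal{C}$ be a class of languages. (1) Assume that whenever $L\subseteq\Sigma^*$ is in $\mathcal{C}$ and $L_0$ is a finite language over some finite alphabet $\Sigma_0$ with $\Sigma\cap\Sigma_0=\varnothing$, the concatenation $LL_0$ is in $\mathcal{C}$. Then the class of $\mathcal{C}$-Cayley polynomial-time computable groups is closed under taking a finite extension (if $H$ is a finite index subgroup of $G$ and $H$ is in the class, then $G$ is in the class). (2) Assume that whenever $L_1\subseteq\Sigma_1^*$ and $L_2\subseteq\Sigma_2^*$ are in $\mathcal{C}$ with $\Sigma_1\cap\Sigma_2=\varnothing$, the concatenation $L_1L_2$ is in $\mathcal{C}$. Then the class of $\mathcal{C}$-Cayley polynomial-time computable groups is closed under taking the direct product of two groups. (3) Assume that (a) if a nonempty language $L$ with $\epsilon\notin L$ is in $\mathcal{C}$, then for every $w\in L$ the language $(L\setminus\{w\})\cup\{\epsilon\}$ is in $\mathcal{C}$; and (b) if $L_1\subseteq\Sigma_1^*$ and $L_2\subseteq\Sigma_2^*$ are languages in $\mathcal{C}$ with $\epsilon\in L_1$, $\epsilon\in L_2$ and $\Sigma_1\cap\Sigma_2=\varnothing$, then the language $(L_1'L_2')^*\cup(L_1'L_2')^*L_1'\cup(L_2'L_1')^*\cup(L_2'L_1')^*L_2'\cup\{\epsilon\}$ is in $\mathcal{C}$, where $L_i'=L_i\setminus\{\epsilon\}$. Then the class of $\mathcal{C}$-Cayley polynomial-time computable groups is closed under taking the free product of two groups. Under the same respective assumptions in (1), (2), (3), the same closure holds for the class of $\mathcal{C}$-Cayley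 polynomial-time computable groups with quasigeodesic normal forms.
   Context: $\epsilon$ denotes the empty string. A function $f:\Sigma^*\to\Sigma^*$ is polynomial-time computable if it is computed by a deterministic one-tape Turing machine in time $O(p(n))$, where $p$ is a polynomial and $n$ is the length of the input. Let $G$ be a finitely generated group, $S=\{s_1,\dots,s_n\}\subseteq G$ a finite set of semigroup generators (every $g\in G$ is a product of elements of $S$), and $\mathcal{C}$ a nonempty class of languages. $G$ is $\mathcal{C}$-Cayley polynomial-time computable if there exist a language $L\subseteq\Sigma^*$ in $\mathcal{C}$ over a finite alphabet $\Sigma$, a bijection $\psi:L\to G$ and polynomial-time computable functions $f_i:\Sigma^*\to\Sigma^*$, $i=1,\dots,n$, with $f_i(L)\subseteq L$ and $\psi(f_i(w))=\psi(w)s_i$ for all $w\in L$; such $\psi$ is a $\mathcal{C}$-Cayley polynomial-time computable representation. This does not depend on the choice of $S$. Let $A$ be a finite generating set of $G$ and let $d_A(g)$ be the length of a shortest word over $A\cup A^{-1}$ representing $g$. A bijection $\psi:L\to G$ has quasigeodesic normal form if there is a constant $C$ such that $|w|\leqslant C(d_A(\psi(w))+1)$ for all $w\in L$. $G$ is $\mathcal{C}$-Cayley polynomial-time computable with quasigeodesic normal form if it admits a $\mathcal{C}$-Cayley polynomial-time computable representation which has quasigeodesic normal form. Standing assumption: $\mathcal{C}$ is closed under a change of symbols in the alphabet: if $\xi:\Sigma\to\Sigma'$ is a bijection between finite alphabets and $L\subseteq\Sigma^*$ is in $\mathcal{C}$, then the image of $L$ under the homomorphism induced by $\xi$ is in $\mathcal{C}$.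 *)

theory Defs
  imports "HOL-Algebra.Generated_Groups" "HOL-Computational_Algebra.Polynomial"
begin
text \<open>
  Symbols are natural numbers. An alphabet is a finite set of symbols, words over \<open>\<Sigma>\<close> are the
  elements of \<open>lists \<Sigma>\<close>. Every finite alphabet is in bijection with a set of natural numbers, and
  classes of languages are required to be invariant under such bijections.
\<close>

type_synonym word = "nat list"

definition conc :: "word set \<Rightarrow> word set \<Rightarrow> word set" where
  "conc A B = {u @ v | u v. u \<in> A \<and> v \<in> B}"

definition kstar :: "word set \<Rightarrow> word set" where
  "kstar A = {concat ws | ws. set ws \<subseteq> A}"

definition language_class :: "word set set \<Rightarrow> bool" where
  "language_class \<C> \<longleftrightarrow>
     \<C> \<noteq> {} \<and>
     (\<forall>L\<in>\<C>. \<exists>\<Sigma>. finite \<Sigma> \<and> L \<subseteq> lists \<Sigma>) \<and>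
     (\<forall>\<Sigma> \<Sigma>' \<xi> L. finite \<Sigma> \<and> finite \<Sigma>' \<and> bij_betw \<xi> \<Sigma> \<Sigma>' \<and> L \<subseteq> lists \<Sigma> \<and> L \<in> \<C>
        \<longrightarrow> map \<xi> ` L \<in> \<C>)"

definition alternating :: "word set \<Rightarrow> word set \<Rightarrow> word set" where
  "alternating L1 L2 =
     (let M1 = L1 - {[]}; M2 = L2 - {[]} in
        kstar (conc M1 M2) \<union> conc (kstar (conc M1 M2)) M1 \<union>
        kstar (conc M2 M1) \<union> conc (kstar (conc M2 M1)) M2 \<union> {[]})"

datatype move = Move_Left | Stay | Move_Right

text \<open>
  Deterministic machines with one two-way infinite tape; \<open>None\<close> is the blank.
\<close>

record tm =
  tm_states :: "nat set"
  tm_symbols :: "nat set"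
  tm_start :: nat
  tm_halt :: nat
  tm_trans :: "nat \<Rightarrow> nat option \<Rightarrow> nat \<times> nat option \<times> move"

definition wf_tm :: "nat set \<Rightarrow> tm \<Rightarrow> bool" where
  "wf_tm \<Sigma> M \<longleftrightarrow>
     finite (tm_states M) \<and> finite (tm_symbols M) \<and> \<Sigma> \<subseteq> tm_symbols M \<and>
     tm_start M \<in> tm_states M \<and> tm_halt M \<in> tm_states M \<and>
     (\<forall>q\<in>tm_states M. \<forall>a\<in>insert None (Some ` tm_symbols M).
        tm_trans M q a \<in> tm_states M \<times> insert None (Some ` tm_symbols M) \<times> UNIV)"

text \<open>
  A configuration is a state together with the tape contents in coordinates relative to the head:
  the head always scans cell 0, and a head movement translates the tape the other way.
\<close>

type_synonym tape = "int \<Rightarrow> nat option"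
type_synonym config = "nat \<times> tape"

fun move_head :: "move \<Rightarrow> tape \<Rightarrow> tape" where
  "move_head Move_Left T = (\<lambda>i. T (i - 1))"
| "move_head Stay T = T"
| "move_head Move_Right T = (\<lambda>i. T (i + 1))"

fun tm_step :: "tm \<Rightarrow> config \<Rightarrow> config" where
  "tm_step M (q, T) =
     (if q = tm_halt M then (q, T)
      else case tm_trans M q (T 0) of (q', a, d) \<Rightarrow> (q', move_head d (T(0 := a))))"

definition word_tape :: "word \<Rightarrow> tape" where
  "word_tape w = (\<lambda>i. if 0 \<le> i \<and> i < int (length w) then Some (w ! nat i) else None)"

text \<open>
  Input and output convention: exactly the word is on the tape, with the head on its first symbol.
  The constant in the time bound \<open>O(p(n))\<close> is absorbed by the polynomial.
\<close>

definition polytime :: "nat set \<Rightarrow> (word \<Rightarrow> word) \<Rightarrow> bool" where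
  "polytime \<Sigma> f \<longleftrightarrow>
     f \<in> lists \<Sigma> \<rightarrow> lists \<Sigma> \<and>
     (\<exists>M (p :: nat poly). wf_tm \<Sigma> M \<and>
        (\<forall>w\<in>lists \<Sigma>. \<exists>t \<le> poly p (length w).
           (tm_step M ^^ t) (tm_start M, word_tape w) = (tm_halt M, word_tape (f w))))"

definition gprod :: "('g, 'm) monoid_scheme \<Rightarrow> 'g list \<Rightarrow> 'g" where
  "gprod G gs = foldr (\<lambda>x y. x \<otimes>\<^bsub>G\<^esub> y) gs \<one>\<^bsub>G\<^esub>"

definition semigroup_generators :: "('g, 'm) monoid_scheme \<Rightarrow> 'g set \<Rightarrow> bool" where
  "semigroup_generators G S \<longleftrightarrow>
     S \<subseteq> carrier G \<and> (\<forall>g\<in>carrier G. \<exists>ss. ss \<noteq> [] \<and> set ss \<subseteq> S \<and> g = gprod G ss)"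

definition cayley_rep ::
  "word set set \<Rightarrow> ('g, 'm) monoid_scheme \<Rightarrow> 'g set \<Rightarrow> word set \<Rightarrow> (word \<Rightarrow> 'g) \<Rightarrow> bool" where
  "cayley_rep \<C> G S L \<psi> \<longleftrightarrow>
     L \<in> \<C> \<and> bij_betw \<psi> L (carrier G) \<and>
     (\<exists>\<Sigma>. finite \<Sigma> \<and> L \<subseteq> lists \<Sigma> \<and>
        (\<exists>f. \<forall>s\<in>S. polytime \<Sigma> (f s) \<and> f s \<in> L \<rightarrow> L \<and>
           (\<forall>w\<in>L. \<psi> (f s w) = \<psi> w \<otimes>\<^bsub>G\<^esub> s)))"

definition cayley_polytime :: "word set set \<Rightarrow> ('g, 'm) monoid_scheme \<Rightarrow> bool" where
  "cayley_polytime \<C> G \<longleftrightarrow>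
     group G \<and> (\<exists>S. finite S \<and> semigroup_generators G S \<and> (\<exists>L \<psi>. cayley_rep \<C> G S L \<psi>))"

definition word_length :: "('g, 'm) monoid_scheme \<Rightarrow> 'g set \<Rightarrow> 'g \<Rightarrow> nat" where
  "word_length G A g =
     (LEAST n. \<exists>as. set as \<subseteq> A \<union> m_inv G ` A \<and> length as = n \<and> gprod G as = g)"

definition quasigeodesic :: "('g, 'm) monoid_scheme \<Rightarrow> word set \<Rightarrow> (word \<Rightarrow> 'g) \<Rightarrow> bool" where
  "quasigeodesic G L \<psi> \<longleftrightarrow>
     (\<exists>A. finite A \<and> A \<subseteq> carrier G \<and> generate G A = carrier G \<and>
        (\<exists>C :: real. \<forall>w\<in>L. real (length w) \<le> C * (real (word_length G A (\<psi> w)) + 1)))"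

definition cayley_polytime_qg :: "word set set \<Rightarrow> ('g, 'm) monoid_scheme \<Rightarrow> bool" where
  "cayley_polytime_qg \<C> G \<longleftrightarrow>
     group G \<and> (\<exists>S. finite S \<and> semigroup_generators G S \<and>
       (\<exists>L \<psi>. cayley_rep \<C> G S L \<psi> \<and> quasigeodesic G L \<psi>))"

text \<open>
  The free product of \<open>G\<close> and \<open>H\<close> is the monoid of words over the disjoint union of the two
  carriers modulo the congruence that multiplies adjacent letters from the same factor and deletes
  identity letters.
\<close>

inductive fp_equiv ::
  "('a, 'm) monoid_scheme \<Rightarrow> ('b, 'n) monoid_scheme \<Rightarrow> ('a + 'b) list \<Rightarrow> ('a + 'b) list \<Rightarrow> bool"
  for G H where
  refl: "w \<in> lists (carrier G <+> carrier H) \<Longrightarrow> fp_equiv G H w w"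
| sym: "fp_equiv G H u v \<Longrightarrow> fp_equiv G H v u"
| trans: "fp_equiv G H u v \<Longrightarrow> fp_equiv G H v w \<Longrightarrow> fp_equiv G H u w"
| append: "fp_equiv G H u v \<Longrightarrow> fp_equiv G H u' v' \<Longrightarrow> fp_equiv G H (u @ u') (v @ v')"
| one_left: "fp_equiv G H [Inl \<one>\<^bsub>G\<^esub>] []"
| one_right: "fp_equiv G H [Inr \<one>\<^bsub>H\<^esub>] []"
| mult_left: "a \<in> carrier G \<Longrightarrow> b \<in> carrier G \<Longrightarrow>
    fp_equiv G H [Inl a, Inl b] [Inl (a \<otimes>\<^bsub>G\<^esub> b)]"
| mult_right: "a \<in> carrier H \<Longrightarrow> b \<in> carrier H \<Longrightarrow>
    fp_equiv G H [Inr a, Inr b] [Inr (a \<otimes>\<^bsub>H\<^esub> b)]"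

definition fp_rel ::
  "('a, 'm) monoid_scheme \<Rightarrow> ('b, 'n) monoid_scheme \<Rightarrow> (('a + 'b) list \<times> ('a + 'b) list) set" where
  "fp_rel G H = {(u, v). fp_equiv G H u v}"

definition free_product ::
  "('a, 'm) monoid_scheme \<Rightarrow> ('b, 'n) monoid_scheme \<Rightarrow> ('a + 'b) list set monoid" where
  "free_product G H =
     \<lparr>carrier = lists (carrier G <+> carrier H) // fp_rel G H,
      monoid.mult = (\<lambda>X Y. \<Union>x\<in>X. \<Union>y\<in>Y. fp_rel G H `` {x @ y}),
      one = fp_rel G H `` {[]}\<rparr>"

lemma fp_equiv_words:
  assumes "group G" "group H" "fp_equiv G H u v"
  shows "u \<in> lists (carrier G <+> carrier H) \<and> v \<in> lists (carrier G <+> carrier H)"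
proof -
  interpret G: group G by fact
  interpret H: group H by fact
  show ?thesis using assms(3) by induction auto
qed

lemma equiv_fp_rel:
  assumes "group G" "group H"
  shows "equiv (lists (carrier G <+> carrier H)) (fp_rel G H)"
proof (rule equivI)
  show "fp_rel G H \<subseteq> lists (carrier G <+> carrier H) \<times> lists (carrier G <+> carrier H)"
    using fp_equiv_words[OF assms] by (auto simp: fp_rel_def)
  show "refl_on (lists (carrier G <+> carrier H)) (fp_rel G H)"
    unfolding refl_on_def fp_rel_def using fp_equiv.refl by blast
  show "sym_on UNIV (fp_rel G H)"
    unfolding sym_on_def fp_rel_def using fp_equiv.sym by blast
  show "trans_on UNIV (fp_rel G H)"
    unfolding trans_on_def fp_rel_def using fp_equiv.trans by blast
qed

lemma free_product_mult:
  assumes "group G" "group H"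
    and "u \<in> lists (carrier G <+> carrier H)" "v \<in> lists (carrier G <+> carrier H)"
  shows "(fp_rel G H `` {u}) \<otimes>\<^bsub>free_product G H\<^esub> (fp_rel G H `` {v}) = fp_rel G H `` {u @ v}"
proof -
  have "congruent2 (fp_rel G H) (fp_rel G H) (\<lambda>x y. fp_rel G H `` {x @ y})"
    by (intro congruent2I' equiv_class_eq[OF equiv_fp_rel[OF assms(1,2)]])
       (auto simp: fp_rel_def intro: fp_equiv.append)
  from UN_equiv_class2[OF equiv_fp_rel equiv_fp_rel this] assms
  show ?thesis by (simp add: free_product_def)
qed

lemma fp_left_inverse:
  assumes "group G" "group H" "u \<in> lists (carrier G <+> carrier H)"
  shows "\<exists>v \<in> lists (carrier G <+> carrier H). fp_equiv G H (v @ u) []"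
  using assms(3)
proof (induction u)
  case Nil
  then show ?case using fp_equiv.refl[of "[]" G H] by force
next
  case (Cons x u)
  interpret G: group G by fact
  interpret H: group H by fact
  obtain v where v: "v \<in> lists (carrier G <+> carrier H)" "fp_equiv G H (v @ u) []"
    using Cons by auto
  obtain y where y: "y \<in> carrier G <+> carrier H" "fp_equiv G H [y, x] []"
  proof (cases x)
    case (Inl a)
    then have a: "a \<in> carrier G" using Cons by auto
    then have "fp_equiv G H [Inl (inv\<^bsub>G\<^esub> a), x] []"
      using fp_equiv.mult_left[of "inv\<^bsub>G\<^esub> a" G a H] fp_equiv.one_left fp_equiv.trans Inl
      by fastforce
    with a show ?thesis using that[of "Inl (inv\<^bsub>G\<^esub> a)"] by auto
  next
    case (Inr a)
    then have a: "a \<in> carrier H" using Cons by auto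
    then have "fp_equiv G H [Inr (inv\<^bsub>H\<^esub> a), x] []"
      using fp_equiv.mult_right[of "inv\<^bsub>H\<^esub> a" H a G] fp_equiv.one_right fp_equiv.trans Inr
      by fastforce
    with a show ?thesis using that[of "Inr (inv\<^bsub>H\<^esub> a)"] by auto
  qed
  have uw: "fp_equiv G H u u" and vw: "fp_equiv G H v v" using Cons v fp_equiv.refl by auto
  have "fp_equiv G H (v @ [y, x] @ u) (v @ [] @ u)"
    by (intro fp_equiv.append uw vw y)
  then have "fp_equiv G H ((v @ [y]) @ x # u) []"
    using v(2) fp_equiv.trans by fastforce
  then show ?case using v y by (intro bexI[of _ "v @ [y]"]) auto
qed

lemma group_free_product:
  assumes "group G" "group H"
  shows "group (free_product G H)"
proof -
  let ?W = "lists (carrier G <+> carrier H)" and ?P = "free_product G H"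
  note mult = free_product_mult[OF assms]
  have clsI: "fp_rel G H `` {w} \<in> carrier ?P" if "w \<in> ?W" for w
    using that by (simp add: free_product_def quotientI)
  have clsE: "\<exists>w. w \<in> ?W \<and> X = fp_rel G H `` {w}" if "X \<in> carrier ?P" for X
  proof -
    from that have "X \<in> ?W // fp_rel G H" by (simp add: free_product_def)
    then show ?thesis by (rule quotientE) blast
  qed
  have one: "\<one>\<^bsub>?P\<^esub> = fp_rel G H `` {[]}" by (simp add: free_product_def)
  have append: "u @ v \<in> ?W" if "u \<in> ?W" "v \<in> ?W" for u v
    using that by (simp only: append_in_lists_conv simp_thms)
  have Nil: "[] \<in> ?W" by (rule lists.Nil)
  show ?thesis
  proof (rule groupI)
    show "\<one>\<^bsub>?P\<^esub> \<in> carrier ?P" unfolding one by (rule clsI[OF Nil])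
  next
    fix X Y assume "X \<in> carrier ?P" "Y \<in> carrier ?P"
    then obtain u v where u: "u \<in> ?W" "X = fp_rel G H `` {u}"
      and v: "v \<in> ?W" "Y = fp_rel G H `` {v}"
      using clsE by blast
    show "X \<otimes>\<^bsub>?P\<^esub> Y \<in> carrier ?P"
      unfolding u(2) v(2) mult[OF u(1) v(1)] by (intro clsI append u(1) v(1))
  next
    fix X Y Z assume "X \<in> carrier ?P" "Y \<in> carrier ?P" "Z \<in> carrier ?P"
    then obtain u v w where u: "u \<in> ?W" "X = fp_rel G H `` {u}"
      and v: "v \<in> ?W" "Y = fp_rel G H `` {v}" and w: "w \<in> ?W" "Z = fp_rel G H `` {w}"
      using clsE by metis
    show "X \<otimes>\<^bsub>?P\<^esub> Y \<otimes>\<^bsub>?P\<^esub> Z = X \<otimes>\<^bsub>?P\<^esub> (Y \<otimes>\<^bsub>?P\<^esub> Z)"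
      unfolding u(2) v(2) w(2) mult[OF u(1) v(1)] mult[OF v(1) w(1)]
        mult[OF append[OF u(1) v(1)] w(1)] mult[OF u(1) append[OF v(1) w(1)]] append_assoc ..
  next
    fix X assume "X \<in> carrier ?P"
    then obtain u where u: "u \<in> ?W" "X = fp_rel G H `` {u}" using clsE by blast
    show "\<one>\<^bsub>?P\<^esub> \<otimes>\<^bsub>?P\<^esub> X = X"
      unfolding one u(2) mult[OF Nil u(1)] append_Nil ..
    obtain v where v: "v \<in> ?W" "fp_equiv G H (v @ u) []"
      using fp_left_inverse[OF assms u(1)] by blast
    have "fp_rel G H `` {v @ u} = fp_rel G H `` {[]}"
      using v(2) by (intro equiv_class_eq[OF equiv_fp_rel[OF assms]]) (simp add: fp_rel_def)
    then show "\<exists>Y\<in>carrier ?P. Y \<otimes>\<^bsub>?P\<^esub> X = \<one>\<^bsub>?P\<^esub>"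
      unfolding one u(2) using mult[OF v(1) u(1)] clsI[OF v(1)] by metis
  qed
qed

end

theory Submission
  imports Defs "HOL-Library.Countable"
begin

text \<open>
  In a direct product or a finite extension a normal form is the concatenation of a normal form of
  each factor, respectively of a normal form of the subgroup and a letter for the coset; in a free
  product it is an alternating concatenation of nontrivial normal forms. In all cases the alphabets
  are disjoint, and right multiplication by a generator applies a polynomial-time function to the
  maximal prefix or suffix over one of the alphabets (possibly an empty suffix in a free product)
  and leaves the rest of the word alone, up to the letter for the coset.

  The computational core is that this preserves polynomial time on a single tape, although the rest
  of the word is in the way of the machine for the given function. For this, words are rewritten in
  passes of finite state transductions, which a one-tape machine performs by treating the tape as a
  queue, and one step of the given machine becomes one pass over its configuration.

  Van der Waerden's action on reduced words gives uniqueness of normal forms in free products.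
\<close>

section \<open>Runs of one-tape machines\<close>

text \<open>The definition of polynomial time prescribes exact tapes: input and output stand alone,
  with the head on the first symbol. In a transduction, which may write more than it reads,
  inserting a cell costs nothing. In a finite extension, multiplying by one element multiplies the
  subgroup part by a correction that depends on the coset. The corrections are arbitrary elements of
  the subgroup, so right multiplication is demanded for all elements and not for generators only. In
  a free product a cancelled block must leave no trace and a new block must arise from nothing, so
  the empty word has to represent the identity in both factors. Exchanging some word for the empty
  one puts the latter into the language; a left translation, which commutes with all right
  multiplications, then corrects its value.\<close>

declare move_head.simps(1,3) [simp del]

type_synonym 'q trans = "'q \<Rightarrow> nat option \<Rightarrow> 'q \<times> nat option \<times> move"

text \<open>There is no halting test: a halting state will be one whose transitions change nothing.
  States may have any type, so that machines can be built from datatypes.\<close>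

definition step :: "'q trans \<Rightarrow> 'q \<times> tape \<Rightarrow> 'q \<times> tape" where
  "step \<delta> c = (case \<delta> (fst c) (snd c 0) of (q, a, d) \<Rightarrow> (q, move_head d ((snd c)(0 := a))))"

definition reaches :: "'q trans \<Rightarrow> nat \<Rightarrow> 'q \<times> tape \<Rightarrow> 'q \<times> tape \<Rightarrow> bool" where
  "reaches \<delta> n c c' \<longleftrightarrow> (\<exists>t\<le>n. (step \<delta> ^^ t) c = c')"

lemma reaches_refl: "reaches \<delta> n c c"
  unfolding reaches_def by (rule exI[of _ 0]) simp

lemma reaches_step: "reaches \<delta> n (step \<delta> c) c' \<Longrightarrow> reaches \<delta> (Suc n) c c'"
  unfolding reaches_def by (metis Suc_le_mono comp_apply funpow_Suc_right)

lemma reaches_trans: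
  assumes "reaches \<delta> m a b" "reaches \<delta> n b c" shows "reaches \<delta> (m + n) a c"
proof -
  from assms obtain s t where "s \<le> m" "(step \<delta> ^^ s) a = b" "t \<le> n" "(step \<delta> ^^ t) b = c"
    unfolding reaches_def by blast
  then show ?thesis unfolding reaches_def
    by (intro exI[of _ "t + s"]) (simp add: funpow_add)
qed

lemma reaches_mono: "reaches \<delta> m a b \<Longrightarrow> m \<le> n \<Longrightarrow> reaches \<delta> n a b"
  unfolding reaches_def using le_trans by blast

section \<open>Tapes as pairs of finite half-tapes\<close>

definition blank_nth :: "nat option list \<Rightarrow> nat \<Rightarrow> nat option" where
  "blank_nth xs i = (if i < length xs then xs ! i else None)"

text \<open>
  \<open>r\<close> is read from cell 0 to the right, \<open>l\<close> from cell -1 to the left.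
\<close>

definition tape_of :: "nat option list \<Rightarrow> nat option list \<Rightarrow> tape" where
  "tape_of l r = (\<lambda>i. if 0 \<le> i then blank_nth r (nat i) else blank_nth l (nat (- i - 1)))"

lemma blank_nth_Nil [simp]: "blank_nth [] i = None"
  by (simp add: blank_nth_def)

lemma blank_nth_0 [simp]: "blank_nth (x # xs) 0 = x"
  by (simp add: blank_nth_def)

lemma blank_nth_Suc [simp]: "blank_nth (x # xs) (Suc i) = blank_nth xs i"
  by (simp add: blank_nth_def)

lemma blank_nth_pad: "blank_nth (xs @ [None]) i = blank_nth xs i"
  by (auto simp: blank_nth_def nth_append)

lemma word_tape_eq: "word_tape w = tape_of [] (map Some w)"
  by (auto simp: word_tape_def tape_of_def blank_nth_def fun_eq_iff nat_less_iff)

lemma tape_of_pad_right: "tape_of l (r @ [None]) = tape_of l r"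
  by (simp add: tape_of_def blank_nth_pad fun_eq_iff)

lemma tape_of_pad_left: "tape_of (l @ [None]) r = tape_of l r"
  by (simp add: tape_of_def blank_nth_pad fun_eq_iff)

text \<open>Half-tapes are determined only up to trailing blanks, so the cell beyond the end of a
  list can be exposed as \<open>None\<close>.\<close>

lemma tape_of_Nil_right: "tape_of l [] = tape_of l [None]"
  using tape_of_pad_right[of l "[]"] by simp

lemma tape_of_Nil_left: "tape_of [] r = tape_of [None] r"
  using tape_of_pad_left[of "[]" r] by simp

lemma tape_of_0 [simp]: "tape_of l (x # r) 0 = x"
  by (simp add: tape_of_def)

lemma tape_of_upd [simp]: "(tape_of l (x # r))(0 := a) = tape_of l (a # r)"
  by (auto simp: tape_of_def fun_eq_iff blank_nth_def nth_Cons')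

lemma move_right_tape_of [simp]: "move_head Move_Right (tape_of l (x # r)) = tape_of (x # l) r"
proof
  fix i :: int
  consider "0 \<le> i" | "i = -1" | "i < -1" by linarith
  then show "move_head Move_Right (tape_of l (x # r)) i = tape_of (x # l) r i"
  proof cases
    case 1 then show ?thesis by (simp add: tape_of_def nat_add_distrib move_head.simps)
  next
    case 3
    then have "nat (- i - 1) = Suc (nat (- 2 - i))" by simp
    with 3 show ?thesis by (simp add: tape_of_def move_head.simps)
  qed (simp add: tape_of_def move_head.simps)
qed

lemma move_left_tape_of [simp]: "move_head Move_Left (tape_of (x # l) r) = tape_of l (x # r)"
proof
  fix i :: int
  consider "0 < i" | "i = 0" | "i < 0" by linarith
  then show "move_head Move_Left (tape_of (x # l) r) i = tape_of l (x # r) i"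
  proof cases
    case 1
    then have "nat i = Suc (nat (i - 1))" by simp
    with 1 show ?thesis by (simp add: tape_of_def move_head.simps)
  next
    case 3
    then have "nat (- (i - 1) - 1) = Suc (nat (- i - 1))" by simp
    with 3 show ?thesis by (simp add: tape_of_def move_head.simps)
  qed (simp add: tape_of_def move_head.simps)
qed

lemma move_left_tape_of_Nil [simp]: "move_head Move_Left (tape_of [] r) = tape_of [] (None # r)"
  by (subst tape_of_Nil_left) (rule move_left_tape_of)

lemma reaches_sweep_right:
  assumes "\<And>a. \<delta> q (Some a) = (q, Some a, Move_Right)"
  shows "reaches \<delta> (length w) (q, tape_of l (map Some w)) (q, tape_of (map Some (rev w) @ l) [])"
proof (induction w arbitrary: l)
  case (Cons a w)
  show ?case
    using Cons[of "Some a # l"] by (auto intro!: reaches_step simp: step_def assms)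
qed (simp add: reaches_refl)

text \<open>One step turns around at the blank behind \<open>w\<close>, \<open>length w\<close>
  steps lead back to the blank in front of it, and one step leaves that blank.\<close>

lemma reaches_return:
  assumes "\<delta> q None = (p, None, Move_Left)" "\<And>a. \<delta> p (Some a) = (p, Some a, Move_Left)"
    and "\<delta> p None = (p', None, Move_Right)"
  shows "reaches \<delta> (length w + 2) (q, tape_of (map Some (rev w)) []) (p', word_tape w)"
proof -
  have sweep: "reaches \<delta> (length xs + 1) (p, move_head Move_Left (tape_of (map Some xs) r))
      (p', tape_of [] (map Some (rev xs) @ r))" for xs r
  proof (induction xs arbitrary: r)
    case Nil
    show ?case
      by (auto intro!: reaches_step reaches_refl simp: step_def assms tape_of_Nil_left[symmetric])
  next
    case (Cons a xs)
    show ?case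
      using reaches_step[of \<delta> "length xs + 1" "(p, tape_of (map Some xs) (Some a # r))"] Cons[of "Some a # r"]
      by (simp add: step_def assms)
  qed
  have "reaches \<delta> (length w + 2) (q, tape_of (map Some (rev w)) [])
     (p', tape_of [] (map Some w @ [None]))"
    using sweep[of "rev w" "[None]"]
      reaches_step[of \<delta> "length w + 1" "(q, tape_of (map Some (rev w)) [None])"]
    by (subst tape_of_Nil_right) (simp add: step_def assms)
  then show ?thesis by (simp add: tape_of_pad_right word_tape_eq)
qed

section \<open>Machines and polynomial-time functions\<close>

lemma poly_nat_mono: "m \<le> n \<Longrightarrow> poly p m \<le> poly p n" for p :: "nat poly"
  by (induction p) (auto intro: add_mono mult_mono)

definition machine :: "nat set \<Rightarrow> 'q set \<Rightarrow> nat set \<Rightarrow> 'q trans \<Rightarrow> 'q \<Rightarrow> 'q \<Rightarrow> bool" where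
  "machine \<Sigma> Q \<Gamma> \<delta> s h \<longleftrightarrow>
     finite Q \<and> finite \<Gamma> \<and> \<Sigma> \<subseteq> \<Gamma> \<and> s \<in> Q \<and> h \<in> Q \<and> (\<forall>a. \<delta> h a = (h, a, Stay)) \<and>
     (\<forall>q\<in>Q. \<forall>a\<in>insert None (Some ` \<Gamma>). \<delta> q a \<in> Q \<times> insert None (Some ` \<Gamma>) \<times> UNIV)"

text \<open>The states are numbered by \<open>to_nat\<close>, so any countable type will do. The
  halting test of \<open>tm_step\<close> agrees with the idle transitions at
  \<open>h\<close>.\<close>

lemma polytimeI:
  fixes \<delta> :: "'q::countable trans"
  assumes M: "machine \<Sigma> Q \<Gamma> \<delta> s h" and f: "f \<in> lists \<Sigma> \<rightarrow> lists \<Sigma>"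
    and run: "\<And>w. w \<in> lists \<Sigma> \<Longrightarrow> reaches \<delta> (poly p (length w)) (s, word_tape w) (h, word_tape (f w))"
  shows "polytime \<Sigma> f"
proof -
  define T where "T = \<lparr>tm_states = to_nat ` Q, tm_symbols = \<Gamma>, tm_start = to_nat s,
     tm_halt = to_nat h, tm_trans = (\<lambda>q a. case \<delta> (from_nat q) a of (q', b, d) \<Rightarrow> (to_nat q', b, d))\<rparr>"
  have wf: "wf_tm \<Sigma> T"
  proof -
    have "(case \<delta> q a of (q', b, d) \<Rightarrow> (to_nat q', b, d)) \<in> to_nat ` Q \<times> insert None (Some ` \<Gamma>) \<times> UNIV"
      if "q \<in> Q" "a \<in> insert None (Some ` \<Gamma>)" for q a
    proof -
      have "\<delta> q a \<in> Q \<times> insert None (Some ` \<Gamma>) \<times> UNIV"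
        using M that unfolding machine_def by blast
      then show ?thesis by (auto split: prod.splits)
    qed
    then show ?thesis using M unfolding wf_tm_def machine_def T_def by simp
  qed
  have st: "tm_step T (to_nat q, X) = map_prod to_nat id (step \<delta> (q, X))" for q X
  proof (cases "q = h")
    case True
    then show ?thesis using M by (simp add: T_def step_def machine_def)
  next
    case False
    then show ?thesis by (simp add: T_def step_def split: prod.splits)
  qed
  have "(tm_step T ^^ t) (to_nat (fst c), snd c) = map_prod to_nat id ((step \<delta> ^^ t) c)" for t c
  proof (induction t arbitrary: c)
    case 0
    show ?case by (cases c) simp
  next
    case (Suc t)
    show ?case
      using Suc[of "step \<delta> c"] st[of "fst c" "snd c"]
      by (simp add: funpow_Suc_right del: funpow.simps tm_step.simps) (simp add: map_prod_def case_prod_beta)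
  qed
  from this[of _ "(s, word_tape w)" for w] run
  have "\<forall>w\<in>lists \<Sigma>. \<exists>t\<le>poly p (length w). (tm_step T ^^ t) (tm_start T, word_tape w) = (tm_halt T, word_tape (f w))"
    unfolding reaches_def T_def by fastforce
  with wf f show ?thesis unfolding polytime_def by blast
qed

text \<open>\<open>wf_tm\<close> says nothing about states and symbols foreign to the machine.
  Redirecting all such transitions to the halting state makes closure hold without side conditions,
  except at the halting state itself, which copies any symbol.\<close>

lemma polytimeE:
  assumes "polytime \<Sigma> f"
  obtains Q \<Gamma> and \<delta> :: "nat trans" and s h p where "machine \<Sigma> Q \<Gamma> \<delta> s h"
    "\<And>q a. \<delta> q a \<in> Q \<times> insert None (Some ` \<Gamma>) \<times> UNIV \<or> q = h" "f \<in> lists \<Sigma> \<rightarrow> lists \<Sigma>"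
    "\<And>w. w \<in> lists \<Sigma> \<Longrightarrow> reaches \<delta> (poly p (length w)) (s, word_tape w) (h, word_tape (f w))"
proof -
  from assms obtain M p where wf: "wf_tm \<Sigma> M" and f: "f \<in> lists \<Sigma> \<rightarrow> lists \<Sigma>"
    and run: "\<And>w. w \<in> lists \<Sigma> \<Longrightarrow> \<exists>t\<le>poly p (length w).
       (tm_step M ^^ t) (tm_start M, word_tape w) = (tm_halt M, word_tape (f w))"
    unfolding polytime_def by blast
  define A where "A = insert None (Some ` tm_symbols M)"
  define \<delta> where "\<delta> = (\<lambda>q a. if q = tm_halt M then (q, a, Stay)
     else if q \<in> tm_states M \<and> a \<in> A then tm_trans M q a else (tm_halt M, None, Stay))"
  \<comment> \<open>These configurations are never left, and on them the modified transitions agree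
    with the given ones.\<close>
  define ok where "ok = (\<lambda>c :: config. fst c \<in> tm_states M \<and> range (snd c) \<subseteq> A)"
  have trans: "tm_trans M q a \<in> tm_states M \<times> A \<times> UNIV" if "q \<in> tm_states M" "a \<in> A" for q a
    using wf that unfolding wf_tm_def A_def by blast
  have mv: "range (move_head d T) \<subseteq> range T" for d T
    by (cases d) (auto simp: move_head.simps)
  have 1: "tm_step M c = step \<delta> c \<and> ok (step \<delta> c)" if "ok c" for c
  proof -
    obtain q T where c: "c = (q, T)" by fastforce
    with that have q: "q \<in> tm_states M" and T: "range T \<subseteq> A" by (auto simp: ok_def)
    have T0: "T 0 \<in> A" using T by blast
    obtain q' a d where t: "tm_trans M q (T 0) = (q', a, d)" by (metis prod.exhaust)
    have qa: "q' \<in> tm_states M" "a \<in> A" using trans[OF q T0] by (auto simp: t)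
    have "range (T(0 := a)) \<subseteq> A" using T qa by auto
    then have "range (move_head d (T(0 := a))) \<subseteq> A" using mv by blast
    then show ?thesis using q T T0 qa by (auto simp: c ok_def \<delta>_def step_def t)
  qed
  have 2: "(tm_step M ^^ t) c = (step \<delta> ^^ t) c" if "ok c" for t c
    using that by (induction t arbitrary: c) (simp_all add: 1 funpow_Suc_right del: funpow.simps(2))
  have "machine \<Sigma> (tm_states M) (tm_symbols M) \<delta> (tm_start M) (tm_halt M)"
    using wf trans unfolding machine_def wf_tm_def \<delta>_def by (auto simp: A_def[symmetric])
  moreover have "\<delta> q a \<in> tm_states M \<times> insert None (Some ` tm_symbols M) \<times> UNIV \<or> q = tm_halt M" for q a
    using wf trans unfolding wf_tm_def \<delta>_def A_def[symmetric] by (auto simp: A_def)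
  moreover have "reaches \<delta> (poly p (length w)) (tm_start M, word_tape w) (tm_halt M, word_tape (f w))"
    if "w \<in> lists \<Sigma>" for w
  proof -
    have "ok (tm_start M, word_tape w)"
      using wf that unfolding ok_def wf_tm_def A_def word_tape_def
      by (auto simp: in_lists_conv_set) (metis (no_types) image_eqI nat_less_iff nth_mem subsetD)
    with 2 run[OF that] show ?thesis unfolding reaches_def by metis
  qed
  ultimately show ?thesis using that f by blast
qed

section \<open>Composition and branching\<close>

fun zstep :: "'q trans \<Rightarrow> 'q \<times> nat option list \<times> nat option list \<Rightarrow> 'q \<times> nat option list \<times> nat option list" where
  "zstep \<delta> (q, l, r) = (case \<delta> q (blank_nth r 0) of (q', a, d) \<Rightarrow>
     (case d of Move_Right \<Rightarrow> (q', a # l, tl r) | Stay \<Rightarrow> (q', l, a # tl r)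
      | Move_Left \<Rightarrow> (q', tl l, blank_nth l 0 # a # tl r)))"

lemma step_zstep: "step \<delta> (q, tape_of l r) = (case zstep \<delta> (q, l, r) of (q', l', r') \<Rightarrow> (q', tape_of l' r'))"
proof -
  have 1: "step \<delta> (q, tape_of l (c # r)) = (case zstep \<delta> (q, l, c # r) of (q', l', r') \<Rightarrow> (q', tape_of l' r'))" for c r
    by (cases l) (auto simp: step_def split: prod.splits move.splits)
  show ?thesis
  proof (cases r)
    case Nil
    then show ?thesis using 1[of None "[]"] by (simp add: tape_of_Nil_right[symmetric])
  qed (simp only: 1)
qed

lemma steps_zstep:
  fixes \<delta> :: "'q trans"
  shows "(step \<delta> ^^ t) (q, tape_of l r) = (case (zstep \<delta> ^^ t) (q, l, r) of (q', l', r') \<Rightarrow> (q', tape_of l' r'))"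
proof (induction t arbitrary: q l r)
  case (Suc t)
  obtain q' l' r' where "zstep \<delta> (q, l, r) = (q', l', r')" by (metis prod.exhaust)
  with Suc[of q' l' r'] show ?case
    by (simp add: funpow_Suc_right step_zstep del: funpow.simps zstep.simps)
qed simp

text \<open>Two and not one: a left move with both half-tapes empty records the scanned cell and
  exposes a new one.\<close>

lemma zstep_length:
  "length (fst (snd (zstep \<delta> c))) + length (snd (snd (zstep \<delta> c))) \<le> length (fst (snd c)) + length (snd (snd c)) + 2"
  by (cases c rule: prod_cases3) (auto split: prod.splits move.splits)

lemma zsteps_length:
  "length (fst (snd ((zstep \<delta> ^^ t) c))) + length (snd (snd ((zstep \<delta> ^^ t) c)))
     \<le> length (fst (snd c)) + length (snd (snd c)) + 2 * t"
proof (induction t)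
  case (Suc t)
  then show ?case using zstep_length[of \<delta> "(zstep \<delta> ^^ t) c"] by simp
qed simp

text \<open>The half-tapes may contain blanks, but only outside \<open>w\<close>, so deleting all
  blanks recovers \<open>w\<close>.\<close>

lemma tape_of_eq_word_tapeD:
  assumes "tape_of l r = word_tape w"
  shows "map the (filter (\<lambda>x. x \<noteq> None) (rev l @ r)) = w" "length w \<le> length r"
proof -
  have r: "blank_nth r i = blank_nth (map Some w) i" for i
    using fun_cong[OF assms, of "int i"] by (simp add: word_tape_eq tape_of_def)
  have "blank_nth l i = None" for i
    using fun_cong[OF assms, of "- int i - 1"] by (simp add: word_tape_eq tape_of_def)
  then have l: "x = None" if "x \<in> set l" for x
    using that by (metis blank_nth_def in_set_conv_nth)
  show len: "length w \<le> length r"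
  proof (rule ccontr)
    assume "\<not> length w \<le> length r"
    then show False using r[of "length r"] by (simp add: blank_nth_def)
  qed
  have "take (length w) r = map Some w"
  proof (rule nth_equalityI)
    fix i assume "i < length (take (length w) r)"
    then show "take (length w) r ! i = map Some w ! i" using r[of i] len by (simp add: blank_nth_def)
  qed (use len in simp)
  moreover have "x = None" if "x \<in> set (drop (length w) r)" for x
  proof -
    from that obtain i where "i < length r - length w" "x = r ! (length w + i)"
      by (auto simp: in_set_conv_nth)
    then show ?thesis using r[of "length w + i"] by (simp add: blank_nth_def less_diff_conv add.commute split: if_splits)
  qed
  ultimately have "filter (\<lambda>x. x \<noteq> None) r = map Some w"
    by (subst append_take_drop_id[of "length w" r, symmetric], subst filter_append)
       (simp add: filter_empty_conv o_def)
  moreover have "filter (\<lambda>x. x \<noteq> None) (rev l) = []" using l by (auto simp: filter_empty_conv)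
  ultimately show "map the (filter (\<lambda>x. x \<noteq> None) (rev l @ r)) = w" by (simp add: o_def)
qed

text \<open>Composition substitutes the length of an intermediate result into the next time bound,
  so this length must be bounded in terms of the running time.\<close>

lemma reaches_word_length:
  assumes "reaches \<delta> n (s, word_tape w) (h, word_tape v)"
  shows "length v \<le> length w + 2 * n"
proof -
  from assms obtain t where t: "t \<le> n" "(step \<delta> ^^ t) (s, word_tape w) = (h, word_tape v)"
    unfolding reaches_def by blast
  obtain q l r where z: "(zstep \<delta> ^^ t) (s, [], map Some w) = (q, l, r)" by (metis prod.exhaust)
  with t have "tape_of l r = word_tape v" by (simp add: word_tape_eq[of w] steps_zstep)
  from tape_of_eq_word_tapeD(2)[OF this] zsteps_length[where \<delta> = \<delta> and t = t and c = "(s, [], map Some w)"] t(1)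
  show ?thesis by (simp add: z)
qed

text \<open>\<open>\<iota>\<close> embeds the states of a machine into those of a larger one, which
  goes on in state \<open>x\<close> where the smaller one halts; the additional step is this
  transition.\<close>

lemma reaches_embed:
  assumes absorb: "\<And>a. \<delta> h a = (h, a, Stay)"
    and emb: "\<And>q a. q \<noteq> h \<Longrightarrow> \<Delta> (\<iota> q) a = map_prod \<iota> id (\<delta> q a)"
    and exit: "\<And>a. \<Delta> (\<iota> h) a = (x, a, Stay)"
    and "reaches \<delta> n (q, T) (h, T')"
  shows "reaches \<Delta> (Suc n) (\<iota> q, T) (x, T')"
proof -
  have out: "reaches \<Delta> (Suc t) (\<iota> h, T) (x, T)" for t T
    by (rule reaches_step) (simp add: step_def exit reaches_refl)
  from assms(4) obtain t where t: "t \<le> n" "(step \<delta> ^^ t) (q, T) = (h, T')"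
    unfolding reaches_def by blast
  have "reaches \<Delta> (Suc t) (\<iota> q, T) (x, T')" using t(2)
  proof (induction t arbitrary: q T)
    case 0
    then show ?case using out by simp
  next
    case (Suc t)
    show ?case
    proof (cases "q = h")
      \<comment> \<open>The small machine has halted early and only idles; the large one leaves at
        once, so the idle steps are skipped.\<close>
      case True
      have "step \<delta> (h, T) = (h, T)" by (simp add: step_def absorb)
      with True have "(step \<delta> ^^ t) (h, T) = (h, T')"
        using Suc.prems by (simp add: funpow_Suc_right del: funpow.simps)
      with Suc.IH True show ?thesis by (meson le_SucI order_refl reaches_mono)
    next
      case False
      obtain q' a d where d: "\<delta> q (T 0) = (q', a, d)" by (metis prod.exhaust)
      have "step \<delta> (q, T) = (q', move_head d (T(0 := a)))"
        "step \<Delta> (\<iota> q, T) = (\<iota> q', move_head d (T(0 := a)))"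
        by (simp_all add: step_def d emb[OF False])
      then show ?thesis
        using Suc.IH[of q' "move_head d (T(0 := a))"] Suc.prems
          reaches_step[of \<Delta> "Suc t" "(\<iota> q, T)"]
        by (simp add: funpow_Suc_right del: funpow.simps)
    qed
  qed
  then show ?thesis using t(1) by (simp add: reaches_mono)
qed

datatype 'q branch_state = Pre nat | Fwd 'q | Bck 'q | Run 'q nat | Done

instance branch_state :: (countable) countable
  by countable_datatype

text \<open>
  After computing \<open>g w\<close> the head sweeps over the result, running the automaton \<open>d\<close>, and returns
  to start the machine for \<open>f q\<close>, where \<open>q\<close> is the state reached by the automaton.
\<close>

lemma polytime_branch:
  fixes d :: "'q::countable \<Rightarrow> nat \<Rightarrow> 'q"
  assumes Q: "finite Q" "q0 \<in> Q" "\<And>q a. q \<in> Q \<Longrightarrow> a \<in> \<Sigma> \<Longrightarrow> d q a \<in> Q"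
    and g: "polytime \<Sigma> g" and f: "\<And>q. q \<in> Q \<Longrightarrow> polytime \<Sigma> (f q)"
  shows "polytime \<Sigma> (\<lambda>w. f (foldl d q0 (g w)) (g w))"
proof -
  obtain S0 \<Gamma>0 and \<delta>0 :: "nat trans" and s0 h0 p0 where M0: "machine \<Sigma> S0 \<Gamma>0 \<delta>0 s0 h0" and g': "g \<in> lists \<Sigma> \<rightarrow> lists \<Sigma>"
    and closed0: "\<And>r a. \<delta>0 r a \<in> S0 \<times> insert None (Some ` \<Gamma>0) \<times> UNIV \<or> r = h0"
    and run0: "\<And>w. w \<in> lists \<Sigma> \<Longrightarrow> reaches \<delta>0 (poly p0 (length w)) (s0, word_tape w) (h0, word_tape (g w))"
    using polytimeE[OF g] by metis
  have "\<forall>q. \<exists>S \<Gamma> (\<delta> :: nat trans) s h p. q \<in> Q \<longrightarrow> machine \<Sigma> S \<Gamma> \<delta> s h \<and>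
      (\<forall>r a. \<delta> r a \<in> S \<times> insert None (Some ` \<Gamma>) \<times> UNIV \<or> r = h) \<and>
      (\<forall>w\<in>lists \<Sigma>. reaches \<delta> (poly p (length w)) (s, word_tape w) (h, word_tape (f q w)))"
    using polytimeE[OF f] by metis
  then obtain S \<Gamma> and \<delta> :: "'q \<Rightarrow> nat trans" and s h p where M: "\<And>q. q \<in> Q \<Longrightarrow> machine \<Sigma> (S q) (\<Gamma> q) (\<delta> q) (s q) (h q)"
    and closed: "\<And>q r a. q \<in> Q \<Longrightarrow> \<delta> q r a \<in> S q \<times> insert None (Some ` \<Gamma> q) \<times> UNIV \<or> r = h q"
    and run: "\<And>q w. q \<in> Q \<Longrightarrow> w \<in> lists \<Sigma> \<Longrightarrow>
      reaches (\<delta> q) (poly (p q) (length w)) (s q, word_tape w) (h q, word_tape (f q w))"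
    by metis
  \<comment> \<open>The tape alphabet may exceed \<open>\<Sigma>\<close>. Nothing is known about
    \<open>d\<close> outside \<open>\<Sigma>\<close>, so \<open>Fwd\<close> keeps its state
    there.\<close>
  define \<Delta> where "\<Delta> = (\<lambda>st a. case st of
      Pre r \<Rightarrow> if r = h0 then (Fwd q0, a, Stay) else map_prod Pre id (\<delta>0 r a)
    | Fwd q \<Rightarrow> (case a of None \<Rightarrow> (Bck q, None, Move_Left)
        | Some x \<Rightarrow> (Fwd (if x \<in> \<Sigma> then d q x else q), a, Move_Right))
    | Bck q \<Rightarrow> (case a of None \<Rightarrow> (Run q (s q), None, Move_Right) | Some x \<Rightarrow> (Bck q, a, Move_Left))
    | Run q r \<Rightarrow> if r = h q then (Done, a, Stay) else map_prod (Run q) id (\<delta> q r a)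
    | Done \<Rightarrow> (Done, a, Stay))"
  define S' where "S' = Pre ` S0 \<union> Fwd ` Q \<union> Bck ` Q \<union> (\<Union>q\<in>Q. Run q ` S q) \<union> {Done}"
  define \<Gamma>' where "\<Gamma>' = \<Gamma>0 \<union> (\<Union>q\<in>Q. \<Gamma> q)"
  have closed': "\<Delta> st a \<in> S' \<times> insert None (Some ` \<Gamma>') \<times> UNIV"
    if st: "st \<in> S'" and a: "a \<in> insert None (Some ` \<Gamma>')" for st a
  proof (cases st)
    case (Pre r)
    obtain x b m where "\<delta>0 r a = (x, b, m)" by (metis prod.exhaust)
    then show ?thesis using closed0[of r a] Q a
      by (auto simp: \<Delta>_def Pre S'_def \<Gamma>'_def)
  next
    case (Run q r)
    then have q: "q \<in> Q" using st by (auto simp: S'_def)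
    obtain x b m where "\<delta> q r a = (x, b, m)" by (metis prod.exhaust)
    then show ?thesis using closed[OF q, of r a] q a
      by (auto simp: \<Delta>_def Run S'_def \<Gamma>'_def)
  next
    case (Fwd q)
    then show ?thesis using st a Q by (auto simp: \<Delta>_def S'_def)
  next
    case (Bck q)
    then have q: "q \<in> Q" using st by (auto simp: S'_def)
    then have "s q \<in> S q" using M[of q] by (simp add: machine_def)
    then have "Run q (s q) \<in> S'" "Bck q \<in> S'" using q by (auto simp: S'_def)
    then show ?thesis using a by (auto simp: \<Delta>_def Bck)
  next
    case Done
    then show ?thesis using a by (simp add: \<Delta>_def S'_def)
  qed
  have mach: "machine \<Sigma> S' \<Gamma>' \<Delta> (Pre s0) Done"
    unfolding machine_def
  proof (intro conjI ballI allI closed')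
    show "finite S'" "finite \<Gamma>'" "\<Sigma> \<subseteq> \<Gamma>'" "Pre s0 \<in> S'" "Done \<in> S'"
      using Q(1) M0 M unfolding S'_def \<Gamma>'_def machine_def by auto
  qed (simp_all add: \<Delta>_def)
  \<comment> \<open>The result of \<open>g\<close> has length at most
    \<open>n + 2 * poly p0 n\<close>. The branch depends on the input, hence the sum over all
    branches; the remaining terms pay for the sweeps over that result and for the transitions
    between the phases.\<close>
  define P where "P = p0 + (\<Sum>q\<in>Q. pcompose (p q) ([:0, 1:] + [:2:] * p0)) + [:2:] * [:0, 1:] + [:4:] * p0 + [:4:]"
  show ?thesis
  proof (rule polytimeI[OF mach])
    show "(\<lambda>w. f (foldl d q0 (g w)) (g w)) \<in> lists \<Sigma> \<rightarrow> lists \<Sigma>"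
    proof
      fix w assume "w \<in> lists \<Sigma>"
      then have gw: "g w \<in> lists \<Sigma>" using g' by blast
      have "foldl d q v \<in> Q" if "q \<in> Q" "v \<in> lists \<Sigma>" for q v
        using that by (induction v arbitrary: q) (auto intro: Q)
      with gw Q have "foldl d q0 (g w) \<in> Q" by blast
      from f[OF this] gw show "f (foldl d q0 (g w)) (g w) \<in> lists \<Sigma>"
        unfolding polytime_def by blast
    qed
  next
    fix w assume w: "w \<in> lists \<Sigma>"
    define v where "v = g w"
    define n where "n = length w"
    have v: "v \<in> lists \<Sigma>" using g' w by (auto simp: v_def)
    have lv: "length v \<le> n + 2 * poly p0 n"
      using reaches_word_length[OF run0[OF w]] by (simp add: v_def n_def)
    define q where "q = foldl d q0 v"
    have dQ: "foldl d q u \<in> Q" if "q \<in> Q" "u \<in> lists \<Sigma>" for q u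
      using that by (induction u arbitrary: q) (auto intro: Q)
    have q: "q \<in> Q" unfolding q_def by (rule dQ[OF Q(2) v])
    have r1: "reaches \<Delta> (Suc (poly p0 n)) (Pre s0, word_tape w) (Fwd q0, word_tape v)"
      unfolding v_def n_def
      by (rule reaches_embed[where \<delta> = \<delta>0 and h = h0, OF _ _ _ run0[OF w]])
        (use M0 in \<open>auto simp: \<Delta>_def machine_def\<close>)
    have fwd: "reaches \<Delta> (length u) (Fwd q, tape_of l (map Some u)) (Fwd (foldl d q u), tape_of (map Some (rev u) @ l) [])"
      if "u \<in> lists \<Sigma>" for u q l
      using that
    proof (induction u arbitrary: q l)
      case (Cons a u)
      show ?case
        using reaches_step[of \<Delta> "length u" "(Fwd q, tape_of l (Some a # map Some u))"]
          Cons.IH[of "d q a" "Some a # l"] Cons.hyps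
        by (simp add: step_def \<Delta>_def)
    qed (simp add: reaches_refl)
    have r2: "reaches \<Delta> (length v) (Fwd q0, word_tape v) (Fwd q, tape_of (map Some (rev v)) [])"
      using fwd[OF v, of q0 "[]"] by (simp add: word_tape_eq q_def)
    have r3: "reaches \<Delta> (length v + 2) (Fwd q, tape_of (map Some (rev v)) []) (Run q (s q), word_tape v)"
      by (rule reaches_return[of _ _ "Bck q"]) (simp_all add: \<Delta>_def)
    have r4: "reaches \<Delta> (Suc (poly (p q) (length v))) (Run q (s q), word_tape v) (Done, word_tape (f q v))"
      by (rule reaches_embed[where \<delta> = "\<delta> q" and h = "h q" and \<iota> = "Run q", OF _ _ _ run[OF q v]])
        (use M[OF q] in \<open>auto simp: \<Delta>_def machine_def\<close>)
    have "poly (p q) (length v) \<le> poly (p q) (n + 2 * poly p0 n)" by (rule poly_nat_mono[OF lv])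
    also have "\<dots> \<le> (\<Sum>q\<in>Q. poly (p q) (n + 2 * poly p0 n))"
      using Q(1) q by (intro member_le_sum) auto
    finally have "Suc (poly p0 n) + (length v + ((length v + 2) + Suc (poly (p q) (length v)))) \<le> poly P n"
      using lv by (simp add: P_def poly_sum poly_pcompose)
    from reaches_mono[OF reaches_trans[OF r1 reaches_trans[OF r2 reaches_trans[OF r3 r4]]] this]
    show "reaches \<Delta> (poly P (length w)) (Pre s0, word_tape w) (Done, word_tape (f (foldl d q0 (g w)) (g w)))"
      by (simp add: n_def v_def q_def)
  qed
qed

section \<open>Elementary closure properties\<close>

lemma polytime_comp:
  assumes "polytime \<Sigma> g" "polytime \<Sigma> f"
  shows "polytime \<Sigma> (\<lambda>w. f (g w))"
  using polytime_branch[of "{()}" "()" \<Sigma> "\<lambda>_ _. ()" g "\<lambda>_. f"] assms by simp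

lemma polytime_finite: "polytime \<Sigma> f \<Longrightarrow> finite \<Sigma>"
  unfolding polytime_def wf_tm_def by (auto intro: finite_subset)

lemma polytime_into: "polytime \<Sigma> f \<Longrightarrow> w \<in> lists \<Sigma> \<Longrightarrow> f w \<in> lists \<Sigma>"
  unfolding polytime_def by blast

lemma polytime_restrict:
  assumes "polytime \<Sigma> f" "\<Sigma>' \<subseteq> \<Sigma>" "f \<in> lists \<Sigma>' \<rightarrow> lists \<Sigma>'"
  shows "polytime \<Sigma>' f"
proof -
  have "lists \<Sigma>' \<subseteq> lists \<Sigma>" using assms(2) by (rule lists_mono)
  moreover have "wf_tm \<Sigma> M \<Longrightarrow> wf_tm \<Sigma>' M" for M using assms(2) by (auto simp: wf_tm_def)
  ultimately show ?thesis using assms unfolding polytime_def by (meson subsetD)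
qed

lemma polytime_id: "finite \<Sigma> \<Longrightarrow> polytime \<Sigma> (\<lambda>w. w)"
  by (rule polytimeI[of \<Sigma> "{()}" \<Sigma> "\<lambda>q a. (q, a, Stay)" "()" "()" _ 0])
    (auto simp: machine_def reaches_refl)

text \<open>A machine may treat finitely many inputs specially. Since \<open>f\<close> is indexed by
  the exceptional input, only each single \<open>f u\<close> has to be polynomial time.\<close>

lemma polytime_cases:
  assumes fin: "finite \<Sigma>" and A: "finite A"
    and f: "\<And>u. polytime \<Sigma> (f u)" and g: "polytime \<Sigma> g"
  shows "polytime \<Sigma> (\<lambda>w. if w \<in> A then f w w else g w)"
proof -
  obtain m where m: "\<And>u. u \<in> A \<Longrightarrow> length u \<le> m"
    using A by (meson finite_imageI finite_nat_set_iff_bounded_le imageI)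
  \<comment> \<open>The automaton remembers the first \<open>Suc m\<close> letters. A word longer
    than \<open>m\<close> thus leads to a state of length \<open>Suc m\<close>, which cannot be in
    \<open>A\<close>.\<close>
  define d where "d = (\<lambda>u a :: nat. if length u \<le> m then u @ [a] else u)"
  have d: "foldl d u w = take (max (Suc m) (length u)) (u @ w)" if "length u \<le> Suc m" for u w
    using that by (induction w arbitrary: u) (auto simp: d_def max_def Suc_diff_le)
  have "polytime \<Sigma> (\<lambda>w. (if foldl d [] w \<in> A then f (foldl d [] w) else g) w)"
    by (rule polytime_branch[where Q = "{u. set u \<subseteq> \<Sigma> \<and> length u \<le> Suc m}"])
      (use f g in \<open>auto intro: finite_lists_length_le[OF fin] polytime_id[OF fin] simp: d_def\<close>)
  moreover have "(if foldl d [] w \<in> A then f (foldl d [] w) else g) w = (if w \<in> A then f w w else g w)" for w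
  proof (cases "length w \<le> m")
    case False
    then have "w \<notin> A" "take (Suc m) w \<notin> A" using m[of w] m[of "take (Suc m) w"] by auto
    then show ?thesis by (simp add: d)
  qed (simp add: d)
  ultimately show ?thesis by simp
qed

section \<open>Word rewriting in passes\<close>

datatype 'p queue_state = Start | Rd 'p | Ap 'p "nat list" | Ret 'p

instance queue_state :: (countable) countable
  by countable_datatype

text \<open>
  A program rewrites the whole word in passes, each pass being a finite state transduction. On one
  tape the word is treated as a queue: symbols are erased at the front and the output is appended
  at the back, so that, in coordinates relative to the head, the configuration between two queue
  operations is again a word with the head on its first symbol.
\<close>

locale program =
  fixes P :: "'p::countable set" and \<Gamma> :: "nat set" and \<delta> :: "'p \<Rightarrow> nat \<Rightarrow> 'p \<times> nat list"
    and \<epsilon> :: "'p \<Rightarrow> 'p \<times> nat list" and q0 h :: 'p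
  assumes finite_states: "finite P" and finite_symbols: "finite \<Gamma>"
    and start: "q0 \<in> P" "q0 \<noteq> h" and halt: "h \<in> P"
    and delta: "\<And>q a. q \<in> P \<Longrightarrow> q \<noteq> h \<Longrightarrow> a \<in> \<Gamma> \<Longrightarrow> \<delta> q a \<in> (P - {h}) \<times> lists \<Gamma>"
    and epsilon: "\<And>q. q \<in> P \<Longrightarrow> q \<noteq> h \<Longrightarrow> \<epsilon> q \<in> P \<times> lists \<Gamma>"
begin

fun trans :: "'p \<Rightarrow> nat list \<Rightarrow> 'p \<times> nat list" where
  "trans q [] = (q, [])"
| "trans q (a # w) = (case \<delta> q a of (q1, u) \<Rightarrow> map_prod id ((@) u) (trans q1 w))"

text \<open>At the end of the word \<open>\<epsilon>\<close> appends the final output and selects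
  the first state of the next pass. The halting state can be entered only there, never in the middle
  of a word.\<close>

definition pass :: "'p \<times> nat list \<Rightarrow> 'p \<times> nat list" where
  "pass c = (case trans (fst c) (snd c) of (q, u) \<Rightarrow> map_prod id ((@) u) (\<epsilon> q))"

text \<open>Besides the number of passes, a bound \<open>m\<close> on the words entering them is
  recorded, because the price of a pass depends on the length of its word.\<close>

inductive passes :: "nat \<Rightarrow> nat \<Rightarrow> 'p \<times> nat list \<Rightarrow> 'p \<times> nat list \<Rightarrow> bool" for m where
  passes_refl: "passes m 0 c c"
| passes_step: "fst c \<noteq> h \<Longrightarrow> length (snd c) \<le> m \<Longrightarrow> passes m n (pass c) c' \<Longrightarrow> passes m (Suc n) c c'"

lemma passes_trans: "passes m i a b \<Longrightarrow> passes m j b c \<Longrightarrow> passes m (i + j) a c"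
  by (induction rule: passes.induct) (auto intro: passes_step)

lemma trans_closed: "q \<in> P - {h} \<Longrightarrow> w \<in> lists \<Gamma> \<Longrightarrow> trans q w \<in> (P - {h}) \<times> lists \<Gamma>"
proof (induction w arbitrary: q)
  case (Cons a w)
  obtain q1 u where d: "\<delta> q a = (q1, u)" by fastforce
  with delta[of q a] Cons.prems have "q1 \<in> P - {h}" "u \<in> lists \<Gamma>" by auto
  moreover from this have "trans q1 w \<in> (P - {h}) \<times> lists \<Gamma>" using Cons by auto
  ultimately show ?case by (auto simp: d)
qed auto

lemma pass_closed: "q \<in> P - {h} \<Longrightarrow> w \<in> lists \<Gamma> \<Longrightarrow> pass (q, w) \<in> P \<times> lists \<Gamma>"
  using trans_closed[of q w] epsilon by (force simp: pass_def split: prod.splits)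

section \<open>The queue machine of a program\<close>

definition endm :: nat where "endm = (SOME e. e \<notin> \<Gamma>)"

lemma endm: "endm \<notin> \<Gamma>"
  unfolding endm_def using ex_new_if_finite[OF infinite_UNIV_nat finite_symbols] by (rule someI_ex)

text \<open>\<open>endm\<close> separates the unread part from the output appended behind it, so
  popping it ends the pass. It is appended again for the next pass, but not on halting, where
  exactly the output must remain.\<close>

definition tmt :: "'p queue_state trans" where
  "tmt st a = (case st of
     Start \<Rightarrow> (Ap q0 [endm], a, Stay)
   | Rd q \<Rightarrow> (if q = h then (Rd h, a, Stay) else case a of None \<Rightarrow> (Rd h, None, Stay)
       | Some x \<Rightarrow> if x = endm then (case \<epsilon> q of (q', u) \<Rightarrow> (Ap q' (if q' = h then u else u @ [endm]), None, Move_Right))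
           else (case \<delta> q x of (q', u) \<Rightarrow> (Ap q' u, None, Move_Right)))
   | Ap q u \<Rightarrow> (case a of Some x \<Rightarrow> (Ap q u, a, Move_Right)
       | None \<Rightarrow> (case u of [] \<Rightarrow> (Ret q, None, Move_Left) | x # u' \<Rightarrow> (Ap q u', Some x, Move_Right)))
   | Ret q \<Rightarrow> (case a of Some x \<Rightarrow> (Ret q, a, Move_Left) | None \<Rightarrow> (Rd q, None, Move_Right)))"

definition outs :: "nat list set" where
  "outs = insert [] ((\<lambda>(q, a). snd (\<delta> q a)) ` ((P - {h}) \<times> \<Gamma>) \<union> (\<lambda>q. snd (\<epsilon> q)) ` (P - {h}))"

definition maxout :: nat where "maxout = Max (length ` outs)"

lemma maxout: "u \<in> outs \<Longrightarrow> length u \<le> maxout"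
proof -
  have "finite outs" unfolding outs_def using finite_states finite_symbols by simp
  then show "u \<in> outs \<Longrightarrow> length u \<le> maxout" unfolding maxout_def by simp
qed

lemma maxout_delta: "q \<in> P - {h} \<Longrightarrow> a \<in> \<Gamma> \<Longrightarrow> length (snd (\<delta> q a)) \<le> maxout"
  by (rule maxout) (force simp: outs_def)

lemma maxout_epsilon: "q \<in> P - {h} \<Longrightarrow> length (snd (\<epsilon> q)) \<le> maxout"
  by (rule maxout) (force simp: outs_def)

text \<open>\<open>Suc\<close> leaves room for the marker behind a longest output.\<close>

definition tm_set :: "'p queue_state set" where
  "tm_set = {Start} \<union> Rd ` P \<union> Ret ` P
     \<union> {Ap q u | q u. q \<in> P \<and> set u \<subseteq> insert endm \<Gamma> \<and> length u \<le> Suc maxout}"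

lemma machine: "\<Sigma> \<subseteq> \<Gamma> \<Longrightarrow> machine \<Sigma> tm_set (insert endm \<Gamma>) tmt Start (Rd h)"
  unfolding machine_def
proof (intro conjI ballI allI)
  show "finite tm_set"
    unfolding tm_set_def using finite_states finite_symbols by (auto intro!: finite_lists_length_le finite_image_set2)
next
  fix st a assume st: "st \<in> tm_set" and a: "a \<in> insert None (Some ` insert endm \<Gamma>)"
  show "tmt st a \<in> tm_set \<times> insert None (Some ` insert endm \<Gamma>) \<times> UNIV"
  proof (cases st)
    case Start
    have "Ap q0 [endm] \<in> tm_set" unfolding tm_set_def using start by auto
    then show ?thesis using a by (simp add: tmt_def Start)
  next
    case (Rd q)
    then have q: "q \<in> P" using st by (auto simp: tm_set_def)
    show ?thesis
    proof (cases "q = h \<or> a = None")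
      case True
      then show ?thesis using a halt by (auto simp: tmt_def tm_set_def Rd)
    next
      case False
      then obtain x where x: "a = Some x" and qh: "q \<noteq> h" by auto
      show ?thesis
      proof (cases "x = endm")
        case True
        obtain q' u where e: "\<epsilon> q = (q', u)" by fastforce
        have "length u \<le> maxout" using maxout_epsilon[of q] q qh by (simp add: e)
        moreover have "q' \<in> P" "u \<in> lists \<Gamma>" using epsilon[OF q qh] by (auto simp: e)
        ultimately have "Ap q' (if q' = h then u else u @ [endm]) \<in> tm_set"
          unfolding tm_set_def by (auto simp: in_lists_conv_set)
        then show ?thesis using qh True by (simp add: tmt_def Rd x e)
      next
        case False
        obtain q' u where d: "\<delta> q x = (q', u)" by fastforce
        have xg: "x \<in> \<Gamma>" using a x False by auto
        then have "length u \<le> maxout" using maxout_delta[of q x] q qh by (simp add: d)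
        moreover have "q' \<in> P" "u \<in> lists \<Gamma>" using delta[OF q qh xg] by (auto simp: d)
        ultimately have "Ap q' u \<in> tm_set"
          unfolding tm_set_def by (auto simp: in_lists_conv_set)
        then show ?thesis using qh False by (simp add: tmt_def Rd x d)
      qed
    qed
  next
    case (Ap q u)
    then show ?thesis using st a
      by (cases u) (auto simp: tmt_def tm_set_def split: option.splits)
  next
    case (Ret q)
    then show ?thesis using st a by (auto simp: tmt_def tm_set_def split: option.splits)
  qed
qed (use start halt in \<open>auto simp: tm_set_def finite_symbols tmt_def\<close>)

text \<open>One sweep out, writing \<open>u\<close> at its end, and one sweep back with two turning
  steps.\<close>

lemma reaches_append:
  "reaches tmt (2 * (length w + length u) + 2) (Ap q u, word_tape w) (Rd q, word_tape (w @ u))"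
proof -
  have 1: "reaches tmt (length w) (Ap q u, word_tape w) (Ap q u, tape_of (map Some (rev w)) [])"
    using reaches_sweep_right[of tmt "Ap q u" w "[]"] by (simp add: tmt_def word_tape_eq)
  have 2: "reaches tmt (length u) (Ap q u, tape_of (map Some (rev v)) []) (Ap q [], tape_of (map Some (rev (v @ u))) [])" for v
  proof (induction u arbitrary: v)
    case (Cons x u)
    have "step tmt (Ap q (x # u), tape_of (map Some (rev v)) []) = (Ap q u, tape_of (map Some (rev (v @ [x]))) [])"
      by (subst tape_of_Nil_right) (simp add: step_def tmt_def)
    with Cons[of "v @ [x]"] reaches_step[of tmt "length u" "(Ap q (x # u), tape_of (map Some (rev v)) [])"]
    show ?case by simp
  qed (simp add: reaches_refl)
  have 3: "reaches tmt (length (w @ u) + 2) (Ap q [], tape_of (map Some (rev (w @ u))) []) (Rd q, word_tape (w @ u))"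
    by (rule reaches_return[of _ _ "Ret q"]) (simp_all add: tmt_def)
  show ?thesis
    using reaches_trans[OF 1 reaches_trans[OF 2 3]] by (rule reaches_mono) simp
qed

lemma reaches_pop:
  assumes "\<And>q' u. tmt (Rd q) (Some a) = (Ap q' u, None, Move_Right) \<Longrightarrow> q' = q1 \<and> u = x"
    and "\<exists>q' u. tmt (Rd q) (Some a) = (Ap q' u, None, Move_Right)"
  shows "reaches tmt (2 * (length w + length x) + 3) (Rd q, word_tape (a # w)) (Rd q1, word_tape (w @ x))"
proof -
  \<comment> \<open>The erased cell is a trailing blank of the left half-tape and disappears, so the
    shortened word is again a \<open>word_tape\<close>.\<close>
  have "step tmt (Rd q, word_tape (a # w)) = (Ap q1 x, word_tape w)"
    using assms by (auto simp: step_def word_tape_eq tape_of_Nil_left[symmetric])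
  with reaches_append[of w x q1] reaches_step[of tmt "2 * (length w + length x) + 2" "(Rd q, word_tape (a # w))"]
  show ?thesis by (simp add: numeral_3_eq_3)
qed

text \<open>\<open>v\<close> is what stands behind the part still to be read, that is, the marker
  and the output so far. The queue never exceeds
  \<open>length w + length v + maxout * length w\<close>, and a letter costs two sweeps over
  it.\<close>

lemma reaches_trans_word:
  assumes "q \<in> P - {h}" "w \<in> lists \<Gamma>"
  shows "reaches tmt (length w * (2 * (length w + length v + maxout * length w + maxout) + 3))
     (Rd q, word_tape (w @ v)) (Rd (fst (trans q w)), word_tape (v @ snd (trans q w)))"
  using assms
proof (induction w arbitrary: q v)
  case (Cons a w)
  obtain q1 x where d: "\<delta> q a = (q1, x)" by fastforce
  have q1: "q1 \<in> P - {h}" and lx: "length x \<le> maxout" 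
    using delta[of q a] maxout_delta[of q a] Cons.prems by (auto simp: d)
  have ae: "a \<noteq> endm" using Cons.prems endm by auto
  have 1: "reaches tmt (2 * (length (w @ v) + length x) + 3) (Rd q, word_tape (a # w @ v)) (Rd q1, word_tape ((w @ v) @ x))"
    by (rule reaches_pop) (use Cons.prems ae in \<open>auto simp: tmt_def d\<close>)
  have 2: "reaches tmt (length w * (2 * (length w + length (v @ x) + maxout * length w + maxout) + 3))
      (Rd q1, word_tape (w @ v @ x)) (Rd (fst (trans q1 w)), word_tape ((v @ x) @ snd (trans q1 w)))"
    using Cons.prems by (intro Cons.IH q1) auto
  \<comment> \<open>A uniform price per letter: reading one may lengthen \<open>v\<close> by
    \<open>maxout\<close>, which the decrease of \<open>maxout * length w\<close>
    compensates.\<close>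
  define X where "X = 2 * (length (a # w) + length v + maxout * length (a # w) + maxout) + 3"
  have "length w * (2 * (length w + length (v @ x) + maxout * length w + maxout) + 3) \<le> length w * X"
    using lx unfolding X_def by (intro mult_le_mono) auto
  moreover have "2 * (length (w @ v) + length x) + 3 \<le> X" using lx by (simp add: X_def)
  ultimately have "2 * (length (w @ v) + length x) + 3
      + length w * (2 * (length w + length (v @ x) + maxout * length w + maxout) + 3) \<le> X + length w * X"
    by linarith
  also have "X + length w * X = length (a # w) * X" by simp
  finally have le: "2 * (length (w @ v) + length x) + 3
      + length w * (2 * (length w + length (v @ x) + maxout * length w + maxout) + 3) \<le> length (a # w) * X" .
  show ?case
    using reaches_mono[OF reaches_trans[OF 1, unfolded append_assoc, OF 2] le]
    unfolding X_def append_Cons by (simp only: trans.simps d) (simp add: case_prod_beta)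
qed (simp add: reaches_refl)

text \<open>\<open>Suc n\<close> pops, one for each letter and one for the marker, at a common price
  that covers the longest queue.\<close>

definition cost :: "nat poly" where
  "cost = [:1, 1:] * ([:2:] * [:2 * maxout + 3, maxout + 1:] + [:3:])"

lemma poly_cost: "poly cost n = Suc n * (2 * (n + maxout * n + 2 * maxout + 3) + 3)"
  by (simp add: cost_def algebra_simps)

definition emark :: "'p \<Rightarrow> nat list" where "emark q = (if q = h then [] else [endm])"

lemma reaches_pass:
  assumes q: "q \<in> P - {h}" and w: "w \<in> lists \<Gamma>"
  shows "reaches tmt (poly cost (length w)) (Rd q, word_tape (w @ emark q))
     (Rd (fst (pass (q, w))), word_tape (snd (pass (q, w)) @ emark (fst (pass (q, w)))))"
proof -
  obtain q1 u where t: "trans q w = (q1, u)" by fastforce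
  then have q1: "q1 \<in> P - {h}" using trans_closed[OF assms] by auto
  obtain q2 x where e: "\<epsilon> q1 = (q2, x)" by fastforce
  have lx: "length x \<le> maxout" using maxout_epsilon[OF q1] by (simp add: e)
  have lu: "length (snd (trans q w)) \<le> maxout * length w" if "q \<in> P - {h}" "w \<in> lists \<Gamma>" for q w
    using that
  proof (induction w arbitrary: q)
    case (Cons a w)
    obtain q1 x where d: "\<delta> q a = (q1, x)" by fastforce
    have "q1 \<in> P - {h}" and lx: "length x \<le> maxout" 
      using delta[of q a] maxout_delta[of q a] Cons.prems by (auto simp: d)
    then have "length (snd (trans q1 w)) \<le> maxout * length w" using Cons by auto
    with lx show ?case by (simp add: d)
  qed simp
  have 1: "reaches tmt (length w * (2 * (length w + length [endm] + maxout * length w + maxout) + 3))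
     (Rd q, word_tape (w @ [endm])) (Rd q1, word_tape (endm # u))"
    using reaches_trans_word[OF assms, of "[endm]"] by (simp add: t)
  have 2: "reaches tmt (2 * (length u + length (x @ emark q2)) + 3) (Rd q1, word_tape (endm # u))
      (Rd q2, word_tape (u @ (x @ emark q2)))"
    by (rule reaches_pop) (use q1 in \<open>auto simp: tmt_def e emark_def\<close>)
  have le: "length w * (2 * (length w + length [endm] + maxout * length w + maxout) + 3)
      + (2 * (length u + length (x @ emark q2)) + 3) \<le> poly cost (length w)"
  proof -
    define X where "X = 2 * (length w + maxout * length w + 2 * maxout + 3) + 3"
    have "length w * (2 * (length w + length [endm] + maxout * length w + maxout) + 3) \<le> length w * X"
      unfolding X_def by (intro mult_le_mono) auto
    moreover have "2 * (length u + length (x @ emark q2)) + 3 \<le> X"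
      using lu[OF assms] lx by (simp add: t emark_def X_def)
    moreover have "poly cost (length w) = X + length w * X" by (simp add: poly_cost X_def)
    ultimately show ?thesis by linarith
  qed
  show ?thesis
    using reaches_mono[OF reaches_trans[OF 1 2] le] q
    by (simp add: pass_def t e emark_def)
qed

lemma reaches_passes:
  assumes "passes m n c c'" "fst c \<in> P" "snd c \<in> lists \<Gamma>"
  shows "reaches tmt (n * poly cost m) (Rd (fst c), word_tape (snd c @ emark (fst c)))
     (Rd (fst c'), word_tape (snd c' @ emark (fst c')))"
  using assms
proof (induction rule: passes.induct)
  case (passes_refl c)
  show ?case by (simp add: reaches_refl)
next
  case (passes_step c n c')
  have c: "pass c \<in> P \<times> lists \<Gamma>" using pass_closed[of "fst c" "snd c"] passes_step by simp
  have "reaches tmt (poly cost (length (snd c))) (Rd (fst c), word_tape (snd c @ emark (fst c)))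
     (Rd (fst (pass c)), word_tape (snd (pass c) @ emark (fst (pass c))))"
    using reaches_pass[of "fst c" "snd c"] passes_step by simp
  moreover have "reaches tmt (n * poly cost m) (Rd (fst (pass c)), word_tape (snd (pass c) @ emark (fst (pass c))))
     (Rd (fst c'), word_tape (snd c' @ emark (fst c')))"
    using passes_step.IH c by (auto simp: mem_Times_iff)
  ultimately have "reaches tmt (poly cost (length (snd c)) + n * poly cost m)
     (Rd (fst c), word_tape (snd c @ emark (fst c))) (Rd (fst c'), word_tape (snd c' @ emark (fst c')))"
    by (rule reaches_trans)
  then show ?case
    by (rule reaches_mono) (use poly_nat_mono[OF passes_step.hyps(2), of cost] in simp)
qed

text \<open>From here on head movements are out of sight: it is enough that the number of passes and
  the lengths of the intermediate words are polynomial.\<close>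

theorem polytime_program:
  assumes "\<Sigma> \<subseteq> \<Gamma>" and f: "f \<in> lists \<Sigma> \<rightarrow> lists \<Sigma>"
    and run: "\<And>w. w \<in> lists \<Sigma> \<Longrightarrow> \<exists>n\<le>poly p (length w). passes (poly r (length w)) n (q0, w) (h, f w)"
  shows "polytime \<Sigma> f"
proof (rule polytimeI[OF machine[OF assms(1)] f])
  fix w assume w: "w \<in> lists \<Sigma>"
  have w': "w \<in> lists \<Gamma>" using w assms(1) by (auto simp: in_lists_conv_set)
  from run[OF w] obtain n where n: "n \<le> poly p (length w)" "passes (poly r (length w)) n (q0, w) (h, f w)"
    by blast
  \<comment> \<open>The first marker is appended to the input by the same mechanism as any
    output.\<close>
  have "step tmt (Start, word_tape w) = (Ap q0 [endm], word_tape w)"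
    by (simp add: step_def tmt_def)
  with reaches_append[of w "[endm]" q0] reaches_step[of tmt "2 * (length w + 1) + 2" "(Start, word_tape w)"]
  have 1: "reaches tmt (2 * length w + 5) (Start, word_tape w) (Rd q0, word_tape (w @ emark q0))"
    using start(2) by (simp add: emark_def eval_nat_numeral)
  have 2: "reaches tmt (n * poly cost (poly r (length w))) (Rd q0, word_tape (w @ emark q0)) (Rd h, word_tape (f w))"
    using reaches_passes[OF n(2)] start(1) w' by (simp add: emark_def)
  show "reaches tmt (poly ([:5, 2:] + p * pcompose cost r) (length w)) (Start, word_tape w) (Rd h, word_tape (f w))"
    using reaches_trans[OF 1 2] by (rule reaches_mono) (use n(1) in \<open>simp add: poly_pcompose mult_le_mono\<close>)
qed

end

section \<open>Functions on a prefix or a suffix\<close>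

lemma polytime_hom:
  assumes fin: "finite \<Sigma>" and g: "\<And>a. a \<in> \<Sigma> \<Longrightarrow> g a \<in> lists \<Sigma>" and z: "z \<in> lists \<Sigma>"
  shows "polytime \<Sigma> (\<lambda>w. concat (map g w) @ z)"
proof -
  \<comment> \<open>A single pass: \<open>True\<close> is the reading state and \<open>False\<close>
    the halting state.\<close>
  interpret program UNIV \<Sigma> "\<lambda>_ a. (True, g a)" "\<lambda>_. (False, z)" True False
    by unfold_locales (use fin g z in auto)
  have tr: "trans True w = (True, concat (map g w))" for w
    by (induction w) auto
  show ?thesis
  proof (rule polytime_program[where p = 1 and r = "[:0, 1:]"])
    show "(\<lambda>w. concat (map g w) @ z) \<in> lists \<Sigma> \<rightarrow> lists \<Sigma>"
      using g z by (fastforce simp: in_lists_conv_set)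
    fix w
    have "passes (length w) (Suc 0) (True, w) (pass (True, w))"
      by (rule passes_step) (auto intro: passes_refl)
    then show "\<exists>n\<le>poly 1 (length w). passes (poly [:0, 1:] (length w)) n (True, w) (False, concat (map g w) @ z)"
      by (auto simp: pass_def tr)
  qed simp
qed

lemma polytime_const: "finite \<Sigma> \<Longrightarrow> z \<in> lists \<Sigma> \<Longrightarrow> polytime \<Sigma> (\<lambda>_. z)"
  using polytime_hom[of \<Sigma> "\<lambda>_. []" z] by (simp add: map_replicate_const)

lemma polytime_map: "finite \<Sigma> \<Longrightarrow> (\<And>a. a \<in> \<Sigma> \<Longrightarrow> h a \<in> \<Sigma>) \<Longrightarrow> polytime \<Sigma> (map h)"
  using polytime_hom[of \<Sigma> "\<lambda>a. [h a]" "[]"] by (simp add: concat_map_singleton[abs_def])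

datatype rev_state = Rev_Start | Rev_Take | Rev_Hold nat | Rev_Copy | Rev_Last | Rev_Stop

instance rev_state :: countable
  by countable_datatype

text \<open>The words have the form \<open>x @ e # y\<close> with a fresh letter \<open>e\<close>.
  Each pass takes the first letter off \<open>x\<close> and puts it directly behind
  \<open>e\<close>, so the letters arrive there in reverse order. Reversal carries results on
  prefixes over to suffixes.\<close>

lemma polytime_rev:
  assumes fin: "finite \<Sigma>"
  shows "polytime \<Sigma> rev"
proof -
  obtain e where e: "e \<notin> \<Sigma>" using ex_new_if_finite[OF infinite_UNIV_nat fin] by blast
  define \<delta> where "\<delta> = (\<lambda>q a. case q of
      Rev_Take \<Rightarrow> if a = e then (Rev_Last, []) else (Rev_Hold a, [])
    | Rev_Hold b \<Rightarrow> if a = e then (Rev_Copy, [e, b]) else (Rev_Hold b, [a])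
    | q \<Rightarrow> (q, [a]))"
  define \<epsilon> where "\<epsilon> = (\<lambda>q. case q of
      Rev_Start \<Rightarrow> (Rev_Take, [e]) | Rev_Copy \<Rightarrow> (Rev_Take, []) | _ \<Rightarrow> (Rev_Stop, []))"
  have step: "\<delta> Rev_Start a = (Rev_Start, [a])" "\<delta> Rev_Copy a = (Rev_Copy, [a])" "\<delta> Rev_Last a = (Rev_Last, [a])"
    "\<delta> Rev_Take a = (if a = e then (Rev_Last, []) else (Rev_Hold a, []))"
    "\<delta> (Rev_Hold b) a = (if a = e then (Rev_Copy, [e, b]) else (Rev_Hold b, [a]))" for a b
    by (simp_all add: \<delta>_def)
  have final: "\<epsilon> Rev_Start = (Rev_Take, [e])" "\<epsilon> Rev_Copy = (Rev_Take, [])" "\<epsilon> Rev_Last = (Rev_Stop, [])"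
    by (simp_all add: \<epsilon>_def)
  interpret program "{Rev_Start, Rev_Take, Rev_Copy, Rev_Last, Rev_Stop} \<union> Rev_Hold ` insert e \<Sigma>"
    "insert e \<Sigma>" \<delta> \<epsilon> Rev_Start Rev_Stop
    by unfold_locales (auto simp: fin \<delta>_def \<epsilon>_def)
  have copy: "trans q w = (q, w)" if "q \<in> {Rev_Start, Rev_Copy, Rev_Last}" for q w
    using that by (induction w) (auto simp: step)
  have hold: "trans (Rev_Hold b) (x @ e # y) = (Rev_Copy, x @ e # b # y)" if "x \<in> lists \<Sigma>" for b x y
    using that e by (induction x) (auto simp: step copy)
  have loop: "passes (length x + length y + 1) (Suc (length x)) (Rev_Take, x @ e # y) (Rev_Stop, rev x @ y)"
    if "x \<in> lists \<Sigma>" for x y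
    using that
  proof (induction x arbitrary: y)
    case Nil
    have "pass (Rev_Take, e # y) = (Rev_Stop, y)"
      by (simp add: pass_def step final copy)
    then show ?case by (auto intro!: passes_step simp: passes_refl)
  next
    case (Cons a x)
    have "pass (Rev_Take, a # x @ e # y) = (Rev_Take, x @ e # a # y)"
      using Cons e hold[of x a y] by (auto simp: pass_def step final)
    then show ?case
      using Cons.IH[of "a # y"] Cons.hyps passes_step[of "(Rev_Take, a # x @ e # y)"
        "length x + length y + 2" "Suc (length x)" "(Rev_Stop, rev x @ a # y)"]
      by simp
  qed
  show ?thesis
  proof (rule polytime_program[where p = "[:2, 1:]" and r = "[:1, 1:]"])
    show "rev \<in> lists \<Sigma> \<rightarrow> lists \<Sigma>" by auto
    fix w assume "w \<in> lists \<Sigma>"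
    from loop[OF this, of "[]"] have "passes (length w + 1) (Suc (Suc (length w))) (Rev_Start, w) (Rev_Stop, rev w)"
      using passes_step[of "(Rev_Start, w)" "length w + 1" "Suc (length w)" "(Rev_Stop, rev w)"]
      by (simp add: pass_def copy final)
    then show "\<exists>n\<le>poly [:2, 1:] (length w). passes (poly [:1, 1:] (length w)) n (Rev_Start, w) (Rev_Stop, rev w)"
      by (intro exI[of _ "Suc (Suc (length w))"]) simp
  qed auto
qed

section \<open>Simulating a machine beside the rest of the word\<close>

definition on_prefix :: "nat set \<Rightarrow> (word \<Rightarrow> word) \<Rightarrow> word \<Rightarrow> word" where
  "on_prefix \<Sigma> f w = f (takeWhile (\<lambda>a. a \<in> \<Sigma>) w) @ dropWhile (\<lambda>a. a \<in> \<Sigma>) w"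

definition on_suffix :: "nat set \<Rightarrow> (word \<Rightarrow> word) \<Rightarrow> word \<Rightarrow> word" where
  "on_suffix \<Sigma> f w = rev (on_prefix \<Sigma> (\<lambda>v. rev (f (rev v))) (rev w))"

datatype sim_state = Init_Start | Init_In | Init_Out | Scan "nat option" | Head "nat option" nat
  | Copy nat | Clean | Stop

instance sim_state :: countable
  by countable_datatype

text \<open>
  A configuration of the machine for \<open>f\<close> with state \<open>q\<close> is written as the word \<open>L q R # z\<close>, where
  \<open>z\<close> is the untouched rest of the input; one step of the machine is a transduction that delays its output by
  one symbol, so as to be able to move the head to the left. Numbers below \<open>N\<close> are symbols, \<open>N\<close> is
  the separator, \<open>N + 1\<close> the blank and \<open>N + 2 + q\<close> marks the head in state \<open>q\<close>.
\<close>

lemma polytime_on_prefix: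
  assumes fin: "finite \<Sigma>'" and sub: "\<Sigma> \<subseteq> \<Sigma>'" and f: "polytime \<Sigma> f"
  shows "polytime \<Sigma>' (on_prefix \<Sigma> f)"
proof -
  obtain S \<Gamma>0 and \<delta>0 :: "nat trans" and s h p where M: "machine \<Sigma> S \<Gamma>0 \<delta>0 s h"
    and closed: "\<And>q a. \<delta>0 q a \<in> S \<times> insert None (Some ` \<Gamma>0) \<times> UNIV \<or> q = h"
    and run: "\<And>w. w \<in> lists \<Sigma> \<Longrightarrow> reaches \<delta>0 (poly p (length w)) (s, word_tape w) (h, word_tape (f w))"
    using polytimeE[OF f] by metis
  have "finite (S \<union> \<Gamma>0 \<union> \<Sigma>')" using M fin by (simp add: machine_def)
  then obtain N where N: "S \<union> \<Gamma>0 \<union> \<Sigma>' \<subseteq> {..<N}" by (meson finite_nat_iff_bounded)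
  have absorb: "\<delta>0 h a = (h, a, Stay)" for a using M by (simp add: machine_def)
  have shS: "s \<in> S" "h \<in> S" using M by (auto simp: machine_def)
  have \<Sigma>N: "a < N" if "a \<in> \<Sigma>'" for a using N that by auto
  define A where "A = insert None (Some ` \<Gamma>0)"
  define e where "e = (\<lambda>x. case x of None \<Rightarrow> N + 1 | Some a \<Rightarrow> a)"
  define dec where "dec = (\<lambda>a. if a = N + 1 then None else Some a)"
  \<comment> \<open>Once \<open>h\<close> is reached no further step is simulated; the next pass is
    the final clean-up.\<close>
  define nx where "nx = (\<lambda>q. if q = h then Clean else Scan None)"
  define opt where "opt = (\<lambda>x. case x of None \<Rightarrow> [] | Some a \<Rightarrow> [a :: nat])"
  \<comment> \<open>\<open>Scan x\<close> withholds the last letter read until it is known whether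
    the head comes next. In \<open>Head x q\<close> the next letter is the scanned cell; the
    separator in its place means a blank, and is written again behind the new cell. A left move with
    nothing withheld creates a blank cell.\<close>
  define \<delta> where "\<delta> = (\<lambda>st a. case st of
      Init_Start \<Rightarrow> if a \<in> \<Sigma> then (Init_In, [N + 2 + s, a]) else (Init_Out, [N + 2 + s, N, a])
    | Init_In \<Rightarrow> if a \<in> \<Sigma> then (Init_In, [a]) else (Init_Out, [N, a])
    | Init_Out \<Rightarrow> (Init_Out, [a])
    | Scan x \<Rightarrow> if a < N + 2 then (Scan (Some a), opt x) else (Head x (a - (N + 2)), [])
    | Head x q \<Rightarrow> (case \<delta>0 q (if a = N then None else dec a) of (q', b, d) \<Rightarrow>
        (Copy q', (case d of Move_Right \<Rightarrow> opt x @ [e b, N + 2 + q']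
           | Stay \<Rightarrow> opt x @ [N + 2 + q', e b]
           | Move_Left \<Rightarrow> [N + 2 + q', case x of None \<Rightarrow> N + 1 | Some y \<Rightarrow> y, e b])
          @ (if a = N then [N] else [])))
    | Copy q \<Rightarrow> (Copy q, [a])
    | Clean \<Rightarrow> (Clean, if a < N then [a] else [])
    | Stop \<Rightarrow> (Stop, []))"
  define \<epsilon> where "\<epsilon> = (\<lambda>st. case st of
      Init_Start \<Rightarrow> (nx s, [N + 2 + s, N]) | Init_In \<Rightarrow> (nx s, [N]) | Init_Out \<Rightarrow> (nx s, [])
    | Copy q \<Rightarrow> (nx q, []) | _ \<Rightarrow> (Stop, []))"
  \<comment> \<open>The marks \<open>N + 2 + q\<close> with \<open>q < N\<close> are below
    \<open>2 * N + 2\<close>, which therefore bounds all symbols.\<close>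
  define X where "X = insert None (Some ` {..<2 * N + 2})"
  define P where "P = {Init_Start, Init_In, Init_Out, Clean, Stop} \<union> Scan ` X
     \<union> {Head x q | x q. x \<in> X \<and> q < N} \<union> Copy ` {..<N}"
  interpret program P "{..<2 * N + 2}" \<delta> \<epsilon> Init_Start Stop
  proof
    show "finite P" by (auto simp: P_def X_def intro!: finite_image_set2)
  next
    fix st a assume st: "st \<in> P" "st \<noteq> Stop" and a: "a \<in> {..<2 * N + 2}"
    have sN: "s < N" using N shS by auto
    show "\<delta> st a \<in> (P - {Stop}) \<times> lists {..<2 * N + 2}"
    proof (cases st)
      case (Head x q)
      obtain q' b d where d: "\<delta>0 q (if a = N then None else dec a) = (q', b, d)" by (metis prod.exhaust)
      have x: "opt x \<in> lists {..<2 * N + 2}" "(case x of None \<Rightarrow> N + 1 | Some y \<Rightarrow> y) < 2 * N + 2" and q: "q < N"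
        using st sN by (auto simp: P_def X_def Head opt_def)
      have "q' < N \<and> e b < 2 * N + 2"
      proof (cases "q = h")
        case True
        then show ?thesis using d a q by (auto simp: absorb e_def dec_def)
      next
        case False
        then show ?thesis using closed[of q "if a = N then None else dec a"] N by (auto simp: d e_def)
      qed
      then show ?thesis using x a
        by (auto simp: \<delta>_def Head d P_def split: move.splits)
    next
      case (Scan x)
      then show ?thesis using st a
        by (cases x) (auto simp: \<delta>_def P_def X_def opt_def)
    qed (use st a sN in \<open>auto simp: \<delta>_def P_def X_def\<close>)
  next
    fix st assume "st \<in> P" "st \<noteq> Stop"
    then show "\<epsilon> st \<in> P \<times> lists {..<2 * N + 2}"
      using N shS by (auto simp: \<epsilon>_def P_def X_def nx_def split: sim_state.splits)
  qed (auto simp: P_def)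
  have step: "\<delta> Init_Start a = (if a \<in> \<Sigma> then (Init_In, [N + 2 + s, a]) else (Init_Out, [N + 2 + s, N, a]))"
    "\<delta> Init_In a = (if a \<in> \<Sigma> then (Init_In, [a]) else (Init_Out, [N, a]))"
    "\<delta> Init_Out a = (Init_Out, [a])" "\<delta> (Copy q) a = (Copy q, [a])"
    "\<delta> Clean a = (Clean, if a < N then [a] else [])"
    "a < N + 2 \<Longrightarrow> \<delta> (Scan x) a = (Scan (Some a), opt x)"
    "\<delta> (Scan x) (Suc (Suc (N + q))) = (Head x q, [])"
    "\<delta> (Head x q) a = (case \<delta>0 q (if a = N then None else dec a) of (q', b, d) \<Rightarrow>
        (Copy q', (case d of Move_Right \<Rightarrow> opt x @ [e b, N + 2 + q']
           | Stay \<Rightarrow> opt x @ [N + 2 + q', e b]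
           | Move_Left \<Rightarrow> [N + 2 + q', case x of None \<Rightarrow> N + 1 | Some y \<Rightarrow> y, e b])
          @ (if a = N then [N] else [])))" for a x q
    by (simp_all add: \<delta>_def)
  have final: "\<epsilon> Init_Start = (nx s, [N + 2 + s, N])" "\<epsilon> Init_In = (nx s, [N])" "\<epsilon> Init_Out = (nx s, [])"
    "\<epsilon> (Copy q) = (nx q, [])" "\<epsilon> Clean = (Stop, [])" for q
    by (simp_all add: \<epsilon>_def)
  define cw where "cw = (\<lambda>q l r z. map e (rev l) @ [N + 2 + q] @ map e r @ [N] @ z)"
  have eA: "e x < N + 2" "e x \<noteq> N" "dec (e x) = x" if "x \<in> A" for x
    using that N by (auto simp: e_def A_def dec_def)
  have eNone: "e None = N + 1" and eSome: "e (Some a) = a" for a by (simp_all add: e_def)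
  have copy: "trans (Copy q) w = (Copy q, w)" for q w
    by (induction w) (auto simp: step)
  have scan: "trans (Scan x) (u @ b # v) = map_prod id ((@) (opt x @ u)) (trans (Scan (Some b)) v)"
    if "set u \<subseteq> {..<N + 2}" "b < N + 2" for x u b v
    using that
    by (induction u arbitrary: x) (auto simp: step opt_def map_prod_def case_prod_beta)
  \<comment> \<open>One pass performs one step on the half-tapes. With \<open>r\<close> empty the
    head reads the separator, in agreement with \<open>blank_nth\<close>.\<close>
  have sim: "pass (Scan None, cw q l r z) = (nx q', cw q' l' r' z)"
    if st: "zstep \<delta>0 (q, l, r) = (q', l', r')" and lr: "set l \<subseteq> A" "set r \<subseteq> A" for q l r q' l' r' z
  proof -
    obtain b d where d: "\<delta>0 q (blank_nth r 0) = (q', b, d)"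
      using st by (auto split: prod.splits move.splits)
    have head: "trans (Head x q) (map e r @ [N] @ z) = (Copy q', (case d of Move_Right \<Rightarrow> opt x @ [e b, N + 2 + q']
           | Stay \<Rightarrow> opt x @ [N + 2 + q', e b]
           | Move_Left \<Rightarrow> [N + 2 + q', case x of None \<Rightarrow> N + 1 | Some y \<Rightarrow> y, e b]) @ map e (tl r) @ [N] @ z)" for x
      using d lr(2) by (cases r) (auto simp: step copy eA)
    show ?thesis
    proof (cases l)
      case Nil
      then have "trans (Scan None) (cw q l r z) = trans (Head None q) (map e r @ [N] @ z)"
        by (simp add: cw_def step map_prod_def)
      then show ?thesis using st head[of None] d Nil
        by (auto simp: pass_def cw_def final opt_def eNone split: move.splits)
    next
      case (Cons y l1)
      have "set (map e (rev l1)) \<subseteq> {..<N + 2}" "e y < N + 2" using lr Cons eA by auto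
      then have "trans (Scan None) (cw q l r z)
          = map_prod id ((@) (map e (rev l1))) (trans (Head (Some (e y)) q) (map e r @ [N] @ z))"
        using scan[of "map e (rev l1)" "e y" None "(N + 2 + q) # map e r @ [N] @ z"]
        by (simp add: cw_def Cons) (simp add: step opt_def map_prod_def case_prod_beta)
      then show ?thesis using st head[of "Some (e y)"] d Cons
        by (auto simp: pass_def cw_def final opt_def split: move.splits)
    qed
  qed
  \<comment> \<open>The term \<open>2 * t\<close> reserves the two cells that each remaining step
    may add; the final 2 is for the head mark and the separator.\<close>
  have loop: "\<exists>n\<le>t. \<exists>l' r'. passes m n (nx q, cw q l r z) (Clean, cw h l' r' z) \<and> tape_of l' r' = T \<and>
      length (cw h l' r' z) \<le> m \<and> set l' \<subseteq> A \<and> set r' \<subseteq> A"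
    if "(step \<delta>0 ^^ t) (q, tape_of l r) = (h, T)" "set l \<subseteq> A" "set r \<subseteq> A"
      "length l + length r + 2 * t + length z + 2 \<le> m" for t q l r T z m
    using that
  proof (induction t arbitrary: q l r)
    case 0
    then show ?case by (intro exI[of _ 0] conjI exI[of _ l] exI[of _ r]) (auto intro: passes_refl simp: nx_def cw_def)
  next
    case (Suc t)
    show ?case
    proof (cases "q = h")
      case True
      have "step \<delta>0 (h, T) = (h, T)" for T by (simp add: step_def absorb)
      then have "(step \<delta>0 ^^ t) (h, T) = (h, T)" for t T by (induction t) auto
      from this[of "Suc t"] have "T = tape_of l r" using Suc.prems(1) True by (simp del: funpow.simps)
      then show ?thesis
        using Suc.prems True by (intro exI[of _ 0] conjI exI[of _ l] exI[of _ r]) (auto intro: passes_refl simp: nx_def cw_def)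
    next
      case False
      obtain q' l' r' where z: "zstep \<delta>0 (q, l, r) = (q', l', r')" by (metis prod.exhaust)
      have "(step \<delta>0 ^^ t) (q', tape_of l' r') = (h, T)"
        using Suc.prems(1) by (simp add: funpow_Suc_right step_zstep z del: funpow.simps zstep.simps)
      moreover have "set l' \<subseteq> A \<and> set r' \<subseteq> A"
      proof -
        obtain b d where d: "\<delta>0 q (blank_nth r 0) = (q', b, d)"
          using z by (auto split: prod.splits move.splits)
        have "b \<in> A" using closed[of q "blank_nth r 0"] False by (auto simp: d A_def)
        moreover have "blank_nth l 0 \<in> A" using Suc.prems by (cases l) (auto simp: A_def)
        moreover have "set (tl l) \<subseteq> A" "set (tl r) \<subseteq> A" using Suc.prems(2,3) by (cases l; cases r; auto)+
        ultimately show ?thesis using z Suc.prems by (auto simp: d split: move.splits)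
      qed
      moreover have "length l' + length r' + 2 * t + length z + 2 \<le> m"
        using zstep_length[of \<delta>0 "(q, l, r)"] Suc.prems(4) by (simp add: z del: zstep.simps)
      ultimately obtain n l'' r'' where IH: "n \<le> t" "passes m n (nx q', cw q' l' r' z) (Clean, cw h l'' r'' z)"
        "tape_of l'' r'' = T" "length (cw h l'' r'' z) \<le> m" "set l'' \<subseteq> A" "set r'' \<subseteq> A"
        using Suc.IH[of q' l' r'] by blast
      have "passes m (Suc n) (nx q, cw q l r z) (Clean, cw h l'' r'' z)"
      proof (rule passes_step)
        show "length (snd (nx q, cw q l r z)) \<le> m" using Suc.prems(4) by (simp add: cw_def)
        show "passes m n (pass (nx q, cw q l r z)) (Clean, cw h l'' r'' z)"
          using IH(2) sim[OF z Suc.prems(2,3)] False by (simp add: nx_def)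
      qed (simp add: nx_def)
      with IH show ?thesis by (intro exI[of _ "Suc n"] conjI exI[of _ l''] exI[of _ r'']) auto
    qed
  qed
  have out: "trans Init_Out w = (Init_Out, w)" for w
    by (induction w) (auto simp: step)
  have trans_in: "trans Init_In w = (if dropWhile (\<lambda>a. a \<in> \<Sigma>) w = [] then (Init_In, takeWhile (\<lambda>a. a \<in> \<Sigma>) w)
      else (Init_Out, takeWhile (\<lambda>a. a \<in> \<Sigma>) w @ N # dropWhile (\<lambda>a. a \<in> \<Sigma>) w))" for w
  proof (induction w)
    case (Cons a w)
    then show ?case by (cases "a \<in> \<Sigma>") (simp_all add: step out del: dropWhile_eq_Nil_conv)
  qed simp
  have init: "pass (Init_Start, w) = (nx s, cw s [] (map Some (takeWhile (\<lambda>a. a \<in> \<Sigma>) w)) (dropWhile (\<lambda>a. a \<in> \<Sigma>) w))" for w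
  proof -
    have eS: "map e (map Some v) = v" for v by (simp add: e_def o_def)
    show ?thesis
    proof (cases w)
      case (Cons a w1)
      show ?thesis
      proof (cases "a \<in> \<Sigma>")
        case True
        then show ?thesis unfolding Cons
          by (cases "dropWhile (\<lambda>a. a \<in> \<Sigma>) w1 = []")
            (simp_all add: pass_def cw_def step final trans_in eS eSome del: map_map dropWhile_eq_Nil_conv)
      next
        case False
        then show ?thesis unfolding Cons by (simp add: pass_def cw_def step final out)
      qed
    qed (simp add: pass_def cw_def final)
  qed
  \<comment> \<open>The letters proper are below \<open>N\<close>, so a single filter removes the
    head mark, the separator and all blanks.\<close>
  have clean: "pass (Clean, w) = (Stop, filter (\<lambda>a. a < N) w)" for w
  proof -
    have "trans Clean w = (Clean, filter (\<lambda>a. a < N) w)" by (induction w) (auto simp: step)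
    then show ?thesis by (simp add: pass_def final)
  qed
  have filt: "filter (\<lambda>a. a < N) (map e xs) = map the (filter (\<lambda>x. x \<noteq> None) xs)" if "set xs \<subseteq> A" for xs
    using that N by (induction xs) (auto simp: e_def A_def)
  \<comment> \<open>Two passes are added for setting up and for cleaning; the words grow by at most
    two cells per simulated step.\<close>
  show ?thesis
  proof (rule polytime_program[where p = "p + [:2:]" and r = "[:2:] * p + [:2, 1:]"])
    show "\<Sigma>' \<subseteq> {..<2 * N + 2}" using N by auto
    show "on_prefix \<Sigma> f \<in> lists \<Sigma>' \<rightarrow> lists \<Sigma>'"
    proof
      fix w assume w: "w \<in> lists \<Sigma>'"
      have "takeWhile (\<lambda>a. a \<in> \<Sigma>) w \<in> lists \<Sigma>" by (auto dest: set_takeWhileD)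
      from polytime_into[OF f this] have "f (takeWhile (\<lambda>a. a \<in> \<Sigma>) w) \<in> lists \<Sigma>'"
        using sub by (auto simp: in_lists_conv_set)
      then show "on_prefix \<Sigma> f w \<in> lists \<Sigma>'"
        using w by (auto simp: on_prefix_def in_lists_conv_set dest: set_dropWhileD)
    qed
  next
    fix w assume w: "w \<in> lists \<Sigma>'"
    define v where "v = takeWhile (\<lambda>a. a \<in> \<Sigma>) w"
    define z where "z = dropWhile (\<lambda>a. a \<in> \<Sigma>) w"
    define m where "m = length w + 2 * poly p (length w) + 2"
    have v: "v \<in> lists \<Sigma>" unfolding v_def by (auto dest: set_takeWhileD)
    have vz: "length v + length z = length w"
      unfolding v_def z_def by (metis length_append takeWhile_dropWhile_id)
    obtain t where t: "t \<le> poly p (length v)" "(step \<delta>0 ^^ t) (s, tape_of [] (map Some v)) = (h, word_tape (f v))"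
      using run[OF v] unfolding reaches_def word_tape_eq[of v] by blast
    have t': "t \<le> poly p (length w)" using t(1) poly_nat_mono[of "length v" "length w" p] vz by linarith
    have "set (map Some v) \<subseteq> A" using v M by (auto simp: A_def machine_def in_lists_conv_set)
    moreover have "length ([] :: nat option list) + length (map Some v) + 2 * t + length z + 2 \<le> m" using vz t' by (simp add: m_def)
    ultimately obtain n l' r' where n: "n \<le> t" "passes m n (nx s, cw s [] (map Some v) z) (Clean, cw h l' r' z)"
      "tape_of l' r' = word_tape (f v)" "length (cw h l' r' z) \<le> m" "set l' \<subseteq> A" "set r' \<subseteq> A"
      using loop[OF t(2), where z = z and m = m] by auto
    have "filter (\<lambda>a. a < N) z = z" unfolding filter_id_conv
      using w \<Sigma>N by (auto simp: z_def in_lists_conv_set dest!: set_dropWhileD)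
    moreover have "filter (\<lambda>a. a < N) (map e (rev l' @ r')) = f v"
      by (subst filt) (use n tape_of_eq_word_tapeD(1)[OF n(3)] in auto)
    ultimately have "filter (\<lambda>a. a < N) (cw h l' r' z) = f v @ z"
      by (simp add: cw_def)
    then have "passes m 1 (Clean, cw h l' r' z) (Stop, f v @ z)"
      using n(4) clean[of "cw h l' r' z"] by (auto intro!: passes_step simp: passes_refl)
    from passes_trans[OF n(2) this] have "passes m (Suc (n + 1)) (Init_Start, w) (Stop, f v @ z)"
      by (intro passes_step) (auto simp: init v_def z_def m_def)
    then show "\<exists>n\<le>poly (p + [:2:]) (length w). passes (poly ([:2:] * p + [:2, 1:]) (length w)) n (Init_Start, w) (Stop, on_prefix \<Sigma> f w)"
      using n(1) t' by (intro exI[of _ "Suc (n + 1)"]) (simp add: on_prefix_def v_def z_def m_def add_ac)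
  qed
qed

lemma polytime_on_suffix:
  assumes fin: "finite \<Sigma>'" and sub: "\<Sigma> \<subseteq> \<Sigma>'" and f: "polytime \<Sigma> f"
  shows "polytime \<Sigma>' (on_suffix \<Sigma> f)"
proof -
  have "polytime \<Sigma> (\<lambda>v. rev (f (rev v)))"
    by (intro polytime_comp[OF polytime_comp[OF polytime_rev f] polytime_rev] polytime_finite[OF f])
  then have "polytime \<Sigma>' (on_prefix \<Sigma> (\<lambda>v. rev (f (rev v))))"
    by (rule polytime_on_prefix[OF fin sub])
  then show ?thesis unfolding on_suffix_def[abs_def]
    by (intro polytime_comp[OF polytime_comp[OF polytime_rev] polytime_rev] fin)
qed

lemma on_prefix_append:
  assumes "u \<in> lists \<Sigma>" "v = [] \<or> hd v \<notin> \<Sigma>"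
  shows "on_prefix \<Sigma> f (u @ v) = f u @ v"
proof -
  have "takeWhile (\<lambda>a. a \<in> \<Sigma>) v = []" "dropWhile (\<lambda>a. a \<in> \<Sigma>) v = v"
    using assms(2) by (cases v; auto)+
  then show ?thesis using assms(1)
    by (simp add: on_prefix_def in_lists_conv_set takeWhile_append2 dropWhile_append2)
qed

lemma on_suffix_append:
  assumes "v \<in> lists \<Sigma>" "u = [] \<or> last u \<notin> \<Sigma>"
  shows "on_suffix \<Sigma> f (u @ v) = u @ f v"
  using on_prefix_append[of "rev v" \<Sigma> "rev u"] assms
  by (auto simp: on_suffix_def hd_rev in_lists_conv_set)

text \<open>Both alphabets share one tape: letters are translated back to \<open>\<Sigma>\<close>,
  \<open>f\<close> runs as \<open>on_prefix \<Sigma> f\<close>, which makes sense over the union of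
  the alphabets, and the result is translated again. Restricting the inputs then removes the
  auxiliary letters.\<close>

lemma polytime_rename:
  assumes f: "polytime \<Sigma> f" and inj: "inj_on \<xi> \<Sigma>"
  obtains f' where "polytime (\<xi> ` \<Sigma>) f'" "\<And>w. w \<in> lists \<Sigma> \<Longrightarrow> f' (map \<xi> w) = map \<xi> (f w)"
proof -
  define \<Sigma>' where "\<Sigma>' = \<Sigma> \<union> \<xi> ` \<Sigma>"
  define \<eta> where "\<eta> = (\<lambda>a. if a \<in> \<xi> ` \<Sigma> then inv_into \<Sigma> \<xi> a else a)"
  define \<xi>' where "\<xi>' = (\<lambda>a. if a \<in> \<Sigma> then \<xi> a else a)"
  have fin: "finite \<Sigma>'" using polytime_finite[OF f] by (simp add: \<Sigma>'_def)
  define f' where "f' = (\<lambda>w. map \<xi>' (on_prefix \<Sigma> f (map \<eta> w)))"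
  have "polytime \<Sigma>' (map \<eta>)"
    by (rule polytime_map[OF fin]) (auto simp: \<eta>_def \<Sigma>'_def inv_into_into)
  from polytime_comp[OF this] have "polytime \<Sigma>' (\<lambda>w. on_prefix \<Sigma> f (map \<eta> w))"
    using polytime_on_prefix[OF fin _ f] by (simp add: \<Sigma>'_def)
  moreover have "polytime \<Sigma>' (map \<xi>')"
    by (rule polytime_map[OF fin]) (auto simp: \<xi>'_def \<Sigma>'_def)
  ultimately have p: "polytime \<Sigma>' f'"
    unfolding f'_def by (rule polytime_comp)
  have eq: "f' (map \<xi> w) = map \<xi> (f w)" if w: "w \<in> lists \<Sigma>" for w
  proof -
    have "map \<eta> (map \<xi> w) = w"
      using w inj by (induction w) (auto simp: \<eta>_def)
    moreover have "on_prefix \<Sigma> f w = f w"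
      using on_prefix_append[OF w, of "[]" f] by simp
    moreover have "map \<xi>' (f w) = map \<xi> (f w)"
      using polytime_into[OF f w] by (auto simp: \<xi>'_def in_lists_conv_set)
    ultimately show ?thesis by (simp add: f'_def)
  qed
  have "f' \<in> lists (\<xi> ` \<Sigma>) \<rightarrow> lists (\<xi> ` \<Sigma>)"
  proof
    fix w assume "w \<in> lists (\<xi> ` \<Sigma>)"
    then obtain v where v: "v \<in> lists \<Sigma>" "w = map \<xi> v" by (metis imageE lists_image)
    then show "f' w \<in> lists (\<xi> ` \<Sigma>)"
      using eq polytime_into[OF f v(1)] by (auto simp: lists_image)
  qed
  then have "polytime (\<xi> ` \<Sigma>) f'"
    by (rule polytime_restrict[OF p, rotated]) (auto simp: \<Sigma>'_def)
  with eq that show ?thesis by blast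
qed

section \<open>Presentations of groups, direct products and finite extensions\<close>

text \<open>Stated for a single element: the elements with this property are closed under
  multiplication, so the choice of semigroup generators does not matter.\<close>

definition right_mult :: "('g, 'm) monoid_scheme \<Rightarrow> nat set \<Rightarrow> word set \<Rightarrow> (word \<Rightarrow> 'g) \<Rightarrow> 'g \<Rightarrow> bool" where
  "right_mult G \<Sigma> L \<psi> g \<longleftrightarrow>
     (\<exists>f. polytime \<Sigma> f \<and> f \<in> L \<rightarrow> L \<and> (\<forall>w\<in>L. \<psi> (f w) = \<psi> w \<otimes>\<^bsub>G\<^esub> g))"

definition bounded_increase :: "('g, 'm) monoid_scheme \<Rightarrow> ('g \<Rightarrow> real) \<Rightarrow> 'g \<Rightarrow> bool" where
  "bounded_increase G \<rho> g \<longleftrightarrow> (\<exists>K. \<forall>x\<in>carrier G. \<rho> (x \<otimes>\<^bsub>G\<^esub> g) \<le> \<rho> x + K)"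

text \<open>
  The flag \<open>b\<close> switches the quasigeodesic condition on. It is expressed by an upper bound \<open>\<rho>\<close> for
  the length of normal forms that every right multiplication increases by at most a constant, which
  needs neither a generating set nor inverses.
\<close>

definition presents :: "bool \<Rightarrow> ('g, 'm) monoid_scheme \<Rightarrow> nat set \<Rightarrow> word set \<Rightarrow> (word \<Rightarrow> 'g) \<Rightarrow> ('g \<Rightarrow> real) \<Rightarrow> bool" where
  "presents b G \<Sigma> L \<psi> \<rho> \<longleftrightarrow>
     finite \<Sigma> \<and> L \<subseteq> lists \<Sigma> \<and> bij_betw \<psi> L (carrier G) \<and> (\<forall>g\<in>carrier G. right_mult G \<Sigma> L \<psi> g) \<and>
     (b \<longrightarrow> (\<forall>w\<in>L. real (length w) \<le> \<rho> (\<psi> w)) \<and> (\<forall>g\<in>carrier G. bounded_increase G \<rho> g))"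

definition presentable :: "word set set \<Rightarrow> bool \<Rightarrow> ('g, 'm) monoid_scheme \<Rightarrow> bool" where
  "presentable \<C> b G \<longleftrightarrow> group G \<and> (\<exists>S. finite S \<and> semigroup_generators G S) \<and>
     (\<exists>\<Sigma> L \<psi> \<rho>. L \<in> \<C> \<and> presents b G \<Sigma> L \<psi> \<rho>)"

section \<open>Reduction to generators\<close>

context group
begin

lemma gprod_closed: "set ss \<subseteq> carrier G \<Longrightarrow> gprod G ss \<in> carrier G"
  by (induction ss) (auto simp: gprod_def)

lemma gprod_Cons: "gprod G (s # ss) = s \<otimes> gprod G ss"
  by (simp add: gprod_def)

lemma gprod_append:
  "set ss \<subseteq> carrier G \<Longrightarrow> set ts \<subseteq> carrier G \<Longrightarrow> gprod G (ss @ ts) = gprod G ss \<otimes> gprod G ts"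
proof (induction ss)
  case Nil
  then show ?case using gprod_closed[of ts] by (simp add: gprod_def)
next
  case (Cons s ss)
  then show ?case by (simp add: gprod_Cons m_assoc gprod_closed)
qed

lemma semigroup_generators_induct [consumes 2, case_names generator mult]:
  assumes S: "semigroup_generators G S" and g: "g \<in> carrier G"
    and gen: "\<And>s. s \<in> S \<Longrightarrow> s \<in> carrier G \<Longrightarrow> P s"
    and mult: "\<And>g h. g \<in> carrier G \<Longrightarrow> h \<in> carrier G \<Longrightarrow> P g \<Longrightarrow> P h \<Longrightarrow> P (g \<otimes> h)"
  shows "P g"
proof -
  have SG: "S \<subseteq> carrier G" using S by (simp add: semigroup_generators_def)
  obtain ss where ss: "ss \<noteq> []" "set ss \<subseteq> S" "g = gprod G ss"
    using S g unfolding semigroup_generators_def by blast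
  from ss(1,2) have "P (gprod G ss)"
  proof (induction ss rule: list_nonempty_induct)
    case (single s)
    then have "s \<in> carrier G" using SG by auto
    then show ?case using gen[of s] single by (simp add: gprod_def)
  next
    case (cons s ss)
    then have "s \<in> carrier G" "set ss \<subseteq> carrier G" "P s" using SG gen[of s] by auto
    then show ?case using cons mult[of s "gprod G ss"] by (simp add: gprod_Cons gprod_closed)
  qed
  with ss show ?thesis by simp
qed

lemma semigroup_generatorsI:
  assumes "S \<subseteq> carrier G"
    and "\<And>g. g \<in> carrier G \<Longrightarrow> \<exists>ss. ss \<noteq> [] \<and> set ss \<subseteq> S \<and> g = gprod G ss"
  shows "semigroup_generators G S"
  using assms by (simp add: semigroup_generators_def)

lemma right_mult_mult:
  assumes g: "g \<in> carrier G" "h \<in> carrier G" and L: "\<psi> \<in> L \<rightarrow> carrier G"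
    and "right_mult G \<Sigma> L \<psi> g" "right_mult G \<Sigma> L \<psi> h"
  shows "right_mult G \<Sigma> L \<psi> (g \<otimes> h)"
proof -
  obtain f1 where f1: "polytime \<Sigma> f1" "f1 \<in> L \<rightarrow> L" "\<And>w. w \<in> L \<Longrightarrow> \<psi> (f1 w) = \<psi> w \<otimes> g"
    using assms(4) unfolding right_mult_def by blast
  obtain f2 where f2: "polytime \<Sigma> f2" "f2 \<in> L \<rightarrow> L" "\<And>w. w \<in> L \<Longrightarrow> \<psi> (f2 w) = \<psi> w \<otimes> h"
    using assms(5) unfolding right_mult_def by blast
  have "\<psi> (f2 (f1 w)) = \<psi> w \<otimes> (g \<otimes> h)" if "w \<in> L" for w
  proof -
    have "f1 w \<in> L" "\<psi> w \<in> carrier G" using that f1 L by auto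
    then show ?thesis using f1(3)[OF that] f2(3)[of "f1 w"] g by (simp add: m_assoc)
  qed
  moreover have "(\<lambda>w. f2 (f1 w)) \<in> L \<rightarrow> L" using f1(2) f2(2) by auto
  ultimately show ?thesis unfolding right_mult_def using polytime_comp[OF f1(1) f2(1)] by blast
qed

lemma bounded_increase_mult:
  assumes g: "g \<in> carrier G" "h \<in> carrier G" and "bounded_increase G \<rho> g" "bounded_increase G \<rho> h"
  shows "bounded_increase G \<rho> (g \<otimes> h)"
proof -
  obtain K1 where K1: "\<And>x. x \<in> carrier G \<Longrightarrow> \<rho> (x \<otimes> g) \<le> \<rho> x + K1"
    using assms(3) unfolding bounded_increase_def by blast
  obtain K2 where K2: "\<And>x. x \<in> carrier G \<Longrightarrow> \<rho> (x \<otimes> h) \<le> \<rho> x + K2"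
    using assms(4) unfolding bounded_increase_def by blast
  have "\<rho> (x \<otimes> (g \<otimes> h)) \<le> \<rho> x + (K1 + K2)" if "x \<in> carrier G" for x
    using K1[OF that] K2[of "x \<otimes> g"] that g by (simp add: m_assoc)
  then show ?thesis unfolding bounded_increase_def by blast
qed

text \<open>Polynomial-time functions compose and bounded increases add up, so both conditions pass
  from the generators to all elements.\<close>

lemma presentsI:
  assumes S: "semigroup_generators G S" and "finite \<Sigma>" "L \<subseteq> lists \<Sigma>" and bij: "bij_betw \<psi> L (carrier G)"
    and rm: "\<And>s. s \<in> S \<Longrightarrow> right_mult G \<Sigma> L \<psi> s"
    and len: "\<And>w. b \<Longrightarrow> w \<in> L \<Longrightarrow> real (length w) \<le> \<rho> (\<psi> w)"
    and incr: "\<And>s. b \<Longrightarrow> s \<in> S \<Longrightarrow> bounded_increase G \<rho> s"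
  shows "presents b G \<Sigma> L \<psi> \<rho>"
proof -
  have "\<psi> \<in> L \<rightarrow> carrier G" using bij by (auto simp: bij_betw_def)
  note L = this
  have "right_mult G \<Sigma> L \<psi> g" if "g \<in> carrier G" for g
    using S that by (induction rule: semigroup_generators_induct) (blast intro: rm right_mult_mult[OF _ _ L])+
  moreover have "bounded_increase G \<rho> g" if b "g \<in> carrier G" for g
    using S that(2) by (induction rule: semigroup_generators_induct) (auto intro: incr[OF that(1)] bounded_increase_mult)
  ultimately show ?thesis using assms(2-4) len by (auto simp: presents_def)
qed

section \<open>Word length and quasigeodesic normal forms\<close>

lemma generate_word:
  assumes "A \<subseteq> carrier G" "g \<in> generate G A"
  shows "\<exists>as. set as \<subseteq> A \<union> m_inv G ` A \<and> gprod G as = g"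
  using assms(2)
proof (induction rule: generate.induct)
  case one
  show ?case by (rule exI[of _ "[]"]) (simp add: gprod_def)
next
  case (incl a)
  then show ?case using assms(1) by (intro exI[of _ "[a]"]) (auto simp: gprod_def)
next
  case (inv a)
  then show ?case using assms(1) by (intro exI[of _ "[inv a]"]) (auto simp: gprod_def)
next
  case (eng g h)
  then obtain as bs where ab: "set as \<subseteq> A \<union> m_inv G ` A" "gprod G as = g"
    "set bs \<subseteq> A \<union> m_inv G ` A" "gprod G bs = h" by blast
  moreover have "A \<union> m_inv G ` A \<subseteq> carrier G" using assms(1) by auto
  ultimately have "gprod G (as @ bs) = g \<otimes> h" using gprod_append[of as bs] by (metis subset_trans)
  with ab show ?case by (intro exI[of _ "as @ bs"]) simp
qed

lemma word_length_le: "set as \<subseteq> A \<union> m_inv G ` A \<Longrightarrow> word_length G A (gprod G as) \<le> length as"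
  unfolding word_length_def by (rule Least_le) blast

lemma word_length_ex:
  assumes "A \<subseteq> carrier G" "generate G A = carrier G" "g \<in> carrier G"
  shows "\<exists>as. set as \<subseteq> A \<union> m_inv G ` A \<and> length as = word_length G A g \<and> gprod G as = g"
  unfolding word_length_def by (rule LeastI_ex) (use generate_word[OF assms(1)] assms(2,3) in blast)

lemma word_length_mult_le:
  assumes A: "A \<subseteq> carrier G" "generate G A = carrier G" and "g \<in> carrier G" "h \<in> carrier G"
  shows "word_length G A (g \<otimes> h) \<le> word_length G A g + word_length G A h"
proof -
  from word_length_ex[OF A] assms obtain as bs where
    ab: "set as \<subseteq> A \<union> m_inv G ` A" "length as = word_length G A g" "gprod G as = g"
      "set bs \<subseteq> A \<union> m_inv G ` A" "length bs = word_length G A h" "gprod G bs = h" by metis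
  moreover have "A \<union> m_inv G ` A \<subseteq> carrier G" using assms(1) by auto
  ultimately have "gprod G (as @ bs) = g \<otimes> h" using gprod_append[of as bs] by (metis subset_trans)
  then show ?thesis using ab word_length_le[of "as @ bs" A] by simp
qed

text \<open>Word length is subadditive, so a multiple of its successor can serve as
  \<open>\<rho>\<close>. Conversely, \<open>\<rho>\<close> grows at most linearly along a word over
  finitely many generators and their inverses; the inverses are covered because bounded increase is
  asked of all elements.\<close>

lemma quasigeodesic_iff:
  assumes S: "finite S" "semigroup_generators G S" and L: "\<psi> \<in> L \<rightarrow> carrier G"
  shows "quasigeodesic G L \<psi> \<longleftrightarrow>
    (\<exists>\<rho>. (\<forall>w\<in>L. real (length w) \<le> \<rho> (\<psi> w)) \<and> (\<forall>g\<in>carrier G. bounded_increase G \<rho> g))"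
proof
  assume "quasigeodesic G L \<psi>"
  then obtain A C where A: "finite A" "A \<subseteq> carrier G" "generate G A = carrier G"
    and C: "\<And>w. w \<in> L \<Longrightarrow> real (length w) \<le> C * (real (word_length G A (\<psi> w)) + 1)"
    unfolding quasigeodesic_def by blast
  \<comment> \<open>\<open>C\<close> may be negative; with \<open>max C 0\<close> the bound is
    monotone in the word length.\<close>
  define \<rho> where "\<rho> = (\<lambda>g. max C 0 * (real (word_length G A g) + 1))"
  have "real (length w) \<le> \<rho> (\<psi> w)" if "w \<in> L" for w
  proof -
    have "C * (real (word_length G A (\<psi> w)) + 1) \<le> \<rho> (\<psi> w)"
      unfolding \<rho>_def by (rule mult_right_mono) auto
    with C[OF that] show ?thesis by simp
  qed
  moreover have "bounded_increase G \<rho> g" if g: "g \<in> carrier G" for g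
    unfolding bounded_increase_def
  proof (intro exI ballI)
    fix x assume "x \<in> carrier G"
    then have "real (word_length G A (x \<otimes> g)) \<le> real (word_length G A x) + real (word_length G A g)"
      using word_length_mult_le[OF A(2,3) _ g, of x] by linarith
    then have "\<rho> (x \<otimes> g) \<le> max C 0 * (real (word_length G A x) + real (word_length G A g) + 1)"
      unfolding \<rho>_def by (intro mult_left_mono) auto
    also have "\<dots> = \<rho> x + max C 0 * real (word_length G A g)"
      by (simp add: \<rho>_def algebra_simps)
    finally show "\<rho> (x \<otimes> g) \<le> \<rho> x + max C 0 * real (word_length G A g)" .
  qed
  ultimately show "\<exists>\<rho>. (\<forall>w\<in>L. real (length w) \<le> \<rho> (\<psi> w)) \<and> (\<forall>g\<in>carrier G. bounded_increase G \<rho> g)"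
    by blast
next
  assume "\<exists>\<rho>. (\<forall>w\<in>L. real (length w) \<le> \<rho> (\<psi> w)) \<and> (\<forall>g\<in>carrier G. bounded_increase G \<rho> g)"
  then obtain \<rho> where len: "\<And>w. w \<in> L \<Longrightarrow> real (length w) \<le> \<rho> (\<psi> w)"
    and incr: "\<And>g. g \<in> carrier G \<Longrightarrow> bounded_increase G \<rho> g" by blast
  have SG: "S \<subseteq> carrier G" using S(2) by (simp add: semigroup_generators_def)
  define B where "B = S \<union> m_inv G ` S"
  have BG: "B \<subseteq> carrier G" and finB: "finite B" using SG S(1) by (auto simp: B_def)
  have gen: "generate G S = carrier G"
  proof (rule equalityI)
    show "carrier G \<subseteq> generate G S"
    proof
      fix g assume "g \<in> carrier G"
      with S(2) show "g \<in> generate G S"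
        by (induction rule: semigroup_generators_induct) (auto intro: generate.incl generate.eng)
    qed
  qed (rule generate_incl[OF SG])
  have "\<forall>a\<in>B. \<exists>K. \<forall>x\<in>carrier G. \<rho> (x \<otimes> a) \<le> \<rho> x + K"
    using incr BG unfolding bounded_increase_def by blast
  then obtain K where K: "\<And>a x. a \<in> B \<Longrightarrow> x \<in> carrier G \<Longrightarrow> \<rho> (x \<otimes> a) \<le> \<rho> x + K a" by metis
  \<comment> \<open>A common increment for all letters; the absolute values let the sum dominate
    each summand.\<close>
  define M where "M = (\<Sum>a\<in>B. \<bar>K a\<bar>)"
  have M: "\<rho> (x \<otimes> a) \<le> \<rho> x + M" if "a \<in> B" "x \<in> carrier G" for a x
  proof -
    have "\<bar>K a\<bar> \<le> M" unfolding M_def using finB that by (intro member_le_sum) auto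
    with K[OF that] show ?thesis by linarith
  qed
  have len_word: "\<rho> (gprod G as) \<le> \<rho> \<one> + M * real (length as)" if "set as \<subseteq> B" for as
    using that
  proof (induction as rule: rev_induct)
    case (snoc a as)
    have "set as \<subseteq> carrier G" "a \<in> carrier G" using snoc BG by auto
    then have "\<rho> (gprod G (as @ [a])) = \<rho> (gprod G as \<otimes> a)" "gprod G as \<in> carrier G"
      using gprod_append[of as "[a]"] by (simp_all add: gprod_def[of _ "[a]"] gprod_closed)
    then show ?case using M[of a "gprod G as"] snoc by (simp add: algebra_simps)
  qed (simp add: gprod_def)
  show "quasigeodesic G L \<psi>"
    unfolding quasigeodesic_def
  proof (intro exI conjI ballI)
    fix w assume w: "w \<in> L"
    then have "\<psi> w \<in> carrier G" using L by auto
    then obtain as where as: "set as \<subseteq> B" "length as = word_length G S (\<psi> w)" "gprod G as = \<psi> w"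
      using word_length_ex[OF SG gen] unfolding B_def by blast
    define n where "n = real (word_length G S (\<psi> w))"
    have "real (length w) \<le> \<rho> \<one> + M * n" using len[OF w] len_word[OF as(1)] as by (simp add: n_def)
    \<comment> \<open>One constant dominates both the initial value \<open>\<rho> \<one>\<close> and
      the slope \<open>M\<close>.\<close>
    also have "\<dots> \<le> max (\<rho> \<one>) M + max (\<rho> \<one>) M * n"
      by (intro add_mono mult_right_mono) (auto simp: n_def)
    finally show "real (length w) \<le> max (\<rho> \<one>) M * (real (word_length G S (\<psi> w)) + 1)"
      by (simp add: n_def algebra_simps)
  qed (use S SG gen in auto)
qed

end

section \<open>Cayley representations as presentations\<close>

lemma cayley_rep_presents:
  assumes G: "group G" and S: "semigroup_generators G S" and rep: "cayley_rep \<C> G S L \<psi>"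
  obtains \<Sigma> where "L \<in> \<C>" "presents False G \<Sigma> L \<psi> undefined"
proof -
  from rep obtain \<Sigma> f where "L \<in> \<C>" "bij_betw \<psi> L (carrier G)" "finite \<Sigma>" "L \<subseteq> lists \<Sigma>"
    "\<forall>s\<in>S. polytime \<Sigma> (f s) \<and> f s \<in> L \<rightarrow> L \<and> (\<forall>w\<in>L. \<psi> (f s w) = \<psi> w \<otimes>\<^bsub>G\<^esub> s)"
    unfolding cayley_rep_def by blast
  note f = this
  have "right_mult G \<Sigma> L \<psi> s" if "s \<in> S" for s
    unfolding right_mult_def using bspec[OF f(5) that] by blast
  then have "presents False G \<Sigma> L \<psi> undefined"
    using f(2-4) by (intro group.presentsI[OF G S]) simp_all
  then show ?thesis using that f(1) by blast
qed

lemma presents_cayley_rep: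
  assumes S: "semigroup_generators G S" and "L \<in> \<C>" and P: "presents b G \<Sigma> L \<psi> \<rho>"
  shows "cayley_rep \<C> G S L \<psi>"
proof -
  have "\<forall>s\<in>S. \<exists>f. polytime \<Sigma> f \<and> f \<in> L \<rightarrow> L \<and> (\<forall>w\<in>L. \<psi> (f w) = \<psi> w \<otimes>\<^bsub>G\<^esub> s)"
    using S P unfolding semigroup_generators_def presents_def right_mult_def by blast
  then show ?thesis using assms(2) P unfolding cayley_rep_def presents_def by metis
qed

lemma cayley_polytime_iff: "cayley_polytime \<C> G \<longleftrightarrow> presentable \<C> False G"
proof
  assume "cayley_polytime \<C> G"
  then obtain S L \<psi> where G: "group G" and S: "finite S" "semigroup_generators G S" and rep: "cayley_rep \<C> G S L \<psi>"
    unfolding cayley_polytime_def by blast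
  from cayley_rep_presents[OF G S(2) rep] obtain \<Sigma> where "L \<in> \<C>" "presents False G \<Sigma> L \<psi> undefined" .
  with G S show "presentable \<C> False G" unfolding presentable_def by blast
next
  assume "presentable \<C> False G"
  then obtain S \<Sigma> L \<psi> \<rho> where "group G" and S: "finite S" "semigroup_generators G S"
    and L: "L \<in> \<C>" "presents False G \<Sigma> L \<psi> \<rho>" unfolding presentable_def by blast
  with presents_cayley_rep[OF S(2) L] show "cayley_polytime \<C> G"
    unfolding cayley_polytime_def by blast
qed

lemma cayley_polytime_qg_iff: "cayley_polytime_qg \<C> G \<longleftrightarrow> presentable \<C> True G"
proof
  assume "cayley_polytime_qg \<C> G"
  then obtain S L \<psi> where G: "group G" and S: "finite S" "semigroup_generators G S"
    and rep: "cayley_rep \<C> G S L \<psi>" and qg: "quasigeodesic G L \<psi>"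
    unfolding cayley_polytime_qg_def by blast
  from cayley_rep_presents[OF G S(2) rep] obtain \<Sigma> where L: "L \<in> \<C>" and P: "presents False G \<Sigma> L \<psi> undefined" .
  then have "\<psi> \<in> L \<rightarrow> carrier G" by (auto simp: presents_def bij_betw_def)
  with group.quasigeodesic_iff[OF G S] qg obtain \<rho> where "\<forall>w\<in>L. real (length w) \<le> \<rho> (\<psi> w)"
    "\<forall>g\<in>carrier G. bounded_increase G \<rho> g" by blast
  with P have "presents True G \<Sigma> L \<psi> \<rho>" by (simp add: presents_def)
  with G S L show "presentable \<C> True G" unfolding presentable_def by blast
next
  assume "presentable \<C> True G"
  then obtain S \<Sigma> L \<psi> \<rho> where G: "group G" and S: "finite S" "semigroup_generators G S"
    and L: "L \<in> \<C>" and P: "presents True G \<Sigma> L \<psi> \<rho>" unfolding presentable_def by blast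
  have "\<psi> \<in> L \<rightarrow> carrier G" using P by (auto simp: presents_def bij_betw_def)
  with group.quasigeodesic_iff[OF G S] P have "quasigeodesic G L \<psi>" by (auto simp: presents_def)
  with presents_cayley_rep[OF S(2) L P] G S show "cayley_polytime_qg \<C> G"
    unfolding cayley_polytime_qg_def by blast
qed

section \<open>Making alphabets disjoint\<close>

lemma presents_rename:
  assumes P: "presents b G \<Sigma> L \<psi> \<rho>" and inj: "inj_on \<xi> \<Sigma>"
  shows "presents b G (\<xi> ` \<Sigma>) (map \<xi> ` L) (\<lambda>w. \<psi> (map (inv_into \<Sigma> \<xi>) w)) \<rho>"
proof -
  have L: "L \<subseteq> lists \<Sigma>" and fin: "finite \<Sigma>" and bij: "bij_betw \<psi> L (carrier G)"
    and rm: "\<And>g. g \<in> carrier G \<Longrightarrow> right_mult G \<Sigma> L \<psi> g"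
    using P by (auto simp: presents_def)
  have inv: "map (inv_into \<Sigma> \<xi>) (map \<xi> w) = w" if "w \<in> L" for w
    using that L inj by (auto simp: in_lists_conv_set subset_eq intro!: map_idI)
  have "bij_betw (map (inv_into \<Sigma> \<xi>)) (map \<xi> ` L) L"
    by (rule bij_betw_byWitness[where f' = "map \<xi>"]) (use inv in \<open>auto simp del: map_map\<close>)
  from bij_betw_trans[OF this bij] have bij': "bij_betw (\<lambda>w. \<psi> (map (inv_into \<Sigma> \<xi>) w)) (map \<xi> ` L) (carrier G)"
    by (simp add: comp_def)
  have "right_mult G (\<xi> ` \<Sigma>) (map \<xi> ` L) (\<lambda>w. \<psi> (map (inv_into \<Sigma> \<xi>) w)) g" if g: "g \<in> carrier G" for g
  proof -
    obtain f where f: "polytime \<Sigma> f" "f \<in> L \<rightarrow> L" "\<And>w. w \<in> L \<Longrightarrow> \<psi> (f w) = \<psi> w \<otimes>\<^bsub>G\<^esub> g"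
      using rm[OF g] unfolding right_mult_def by blast
    obtain f' where f': "polytime (\<xi> ` \<Sigma>) f'" "\<And>w. w \<in> lists \<Sigma> \<Longrightarrow> f' (map \<xi> w) = map \<xi> (f w)"
      using polytime_rename[OF f(1) inj] by blast
    have "f' (map \<xi> w) \<in> map \<xi> ` L" if "w \<in> L" for w
      using f(2) f'(2)[of w] L that by auto
    then have "f' \<in> map \<xi> ` L \<rightarrow> map \<xi> ` L" by auto
    moreover have "\<psi> (map (inv_into \<Sigma> \<xi>) (f' (map \<xi> w))) = \<psi> (map (inv_into \<Sigma> \<xi>) (map \<xi> w)) \<otimes>\<^bsub>G\<^esub> g"
      if "w \<in> L" for w
    proof -
      have "w \<in> lists \<Sigma>" "f w \<in> L" using that f(2) L by auto
      then show ?thesis using inv[OF that] inv[of "f w"] f(3)[OF that] f'(2)[of w] by simp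
    qed
    ultimately show ?thesis unfolding right_mult_def using f'(1) by blast
  qed
  moreover have "map \<xi> ` L \<subseteq> lists (\<xi> ` \<Sigma>)" using L by (auto simp: lists_image)
  moreover have "\<forall>w\<in>map \<xi> ` L. real (length w) \<le> \<rho> (\<psi> (map (inv_into \<Sigma> \<xi>) w))" if b
    using P that inv by (auto simp: presents_def simp del: map_map)
  ultimately show ?thesis using P fin bij' by (simp add: presents_def)
qed

text \<open>The letters are shifted beyond \<open>F\<close>; invariance of the class under renaming
  keeps the shifted language in it.\<close>

lemma presentable_disjoint:
  assumes C: "language_class \<C>" and P: "presentable \<C> b G" and F: "finite F"
  obtains \<Sigma> L \<psi> \<rho> where "\<Sigma> \<inter> F = {}" "L \<in> \<C>" "presents b G \<Sigma> L \<psi> \<rho>"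
proof -
  obtain \<Sigma> L \<psi> \<rho> where L: "L \<in> \<C>" and pres: "presents b G \<Sigma> L \<psi> \<rho>"
    using P unfolding presentable_def by blast
  obtain N where N: "F \<subseteq> {..<N}" using F by (meson finite_nat_iff_bounded)
  define \<xi> where "\<xi> = (\<lambda>a. N + a)"
  have inj: "inj_on \<xi> \<Sigma>" by (simp add: \<xi>_def)
  have "finite \<Sigma>" "L \<subseteq> lists \<Sigma>" using pres by (auto simp: presents_def)
  moreover have "\<forall>\<Sigma> \<Sigma>' \<xi> L. finite \<Sigma> \<and> finite \<Sigma>' \<and> bij_betw \<xi> \<Sigma> \<Sigma>' \<and> L \<subseteq> lists \<Sigma> \<and> L \<in> \<C> \<longrightarrow> map \<xi> ` L \<in> \<C>"
    using C unfolding language_class_def by (rule conjunct2[OF conjunct2])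
  ultimately have "map \<xi> ` L \<in> \<C>"
    using L inj_on_imp_bij_betw[OF inj] by (metis finite_imageI)
  moreover have "\<xi> ` \<Sigma> \<inter> F = {}" using N by (auto simp: \<xi>_def)
  ultimately show ?thesis using that presents_rename[OF pres inj] by blast
qed

section \<open>Direct products\<close>

lemma presentable_direct_product:
  fixes G :: "('a, 'm) monoid_scheme" and H :: "('b, 'n) monoid_scheme"
  assumes C: "language_class \<C>" and G: "presentable \<C> b G" and H: "presentable \<C> b H"
    and conc: "\<And>\<Sigma>\<^sub>1 \<Sigma>\<^sub>2 L\<^sub>1 L\<^sub>2. finite \<Sigma>\<^sub>1 \<Longrightarrow> finite \<Sigma>\<^sub>2 \<Longrightarrow> \<Sigma>\<^sub>1 \<inter> \<Sigma>\<^sub>2 = {} \<Longrightarrow>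
      L\<^sub>1 \<subseteq> lists \<Sigma>\<^sub>1 \<Longrightarrow> L\<^sub>1 \<in> \<C> \<Longrightarrow> L\<^sub>2 \<subseteq> lists \<Sigma>\<^sub>2 \<Longrightarrow> L\<^sub>2 \<in> \<C> \<Longrightarrow> conc L\<^sub>1 L\<^sub>2 \<in> \<C>"
  shows "presentable \<C> b (G \<times>\<times> H)"
proof -
  interpret G: group G using G by (simp add: presentable_def)
  interpret H: group H using H by (simp add: presentable_def)
  interpret GH: group "G \<times>\<times> H" by (rule DirProd_group) unfold_locales
  obtain S T where S: "finite S" "semigroup_generators G S" and T: "finite T" "semigroup_generators H T"
    using G H unfolding presentable_def by blast
  obtain \<Sigma>1 L1 \<psi>1 \<rho>1 where L1: "L1 \<in> \<C>" and P1: "presents b G \<Sigma>1 L1 \<psi>1 \<rho>1"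
    using G unfolding presentable_def by blast
  then have fin1: "finite \<Sigma>1" by (simp add: presents_def)
  obtain \<Sigma>2 L2 \<psi>2 \<rho>2 where disj: "\<Sigma>2 \<inter> \<Sigma>1 = {}" and L2: "L2 \<in> \<C>" and P2: "presents b H \<Sigma>2 L2 \<psi>2 \<rho>2"
    using presentable_disjoint[OF C H fin1] .
  have fin2: "finite \<Sigma>2" and sub: "L1 \<subseteq> lists \<Sigma>1" "L2 \<subseteq> lists \<Sigma>2"
    and bij: "bij_betw \<psi>1 L1 (carrier G)" "bij_betw \<psi>2 L2 (carrier H)"
    using P1 P2 by (auto simp: presents_def)
  define L where "L = conc L1 L2"
  have LC: "L \<in> \<C>" unfolding L_def using fin1 fin2 disj sub L1 L2 by (intro conc[of \<Sigma>1 \<Sigma>2]) auto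
  \<comment> \<open>The alphabets are disjoint, so the first letter outside \<open>\<Sigma>1\<close>
    is where the second normal form begins.\<close>
  define \<psi> where "\<psi> = (\<lambda>w. (\<psi>1 (takeWhile (\<lambda>a. a \<in> \<Sigma>1) w), \<psi>2 (dropWhile (\<lambda>a. a \<in> \<Sigma>1) w)))"
  have hd2: "v = [] \<or> hd v \<notin> \<Sigma>1" if "v \<in> L2" for v
    using subsetD[OF sub(2) that] disj by (cases v) auto
  have last1: "u = [] \<or> last u \<notin> \<Sigma>2" if "u \<in> L1" for u
    using subsetD[OF sub(1) that] disj last_in_set[of u] by (auto simp: in_lists_conv_set)
  have psi: "\<psi> (u @ v) = (\<psi>1 u, \<psi>2 v)" if "u \<in> L1" "v \<in> L2" for u v
  proof -
    have "u \<in> lists \<Sigma>1" "takeWhile (\<lambda>a. a \<in> \<Sigma>1) v = []" "dropWhile (\<lambda>a. a \<in> \<Sigma>1) v = v"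
      using that sub hd2[OF that(2)] by (auto simp: takeWhile_eq_Nil_iff dropWhile_eq_self_iff)
    then show ?thesis
      by (simp add: \<psi>_def takeWhile_append2 dropWhile_append2 in_lists_conv_set)
  qed
  have inL: "w \<in> L \<longleftrightarrow> (\<exists>u\<in>L1. \<exists>v\<in>L2. w = u @ v)" for w
    by (auto simp: L_def conc_def)
  have inLI: "u @ v \<in> L" if "u \<in> L1" "v \<in> L2" for u v
    using that by (auto simp: inL)
  have "inj_on \<psi> L"
  proof (rule inj_onI)
    fix w w' assume w: "w \<in> L" "w' \<in> L" "\<psi> w = \<psi> w'"
    then obtain u v u' v' where u: "u \<in> L1" "u' \<in> L1" "v \<in> L2" "v' \<in> L2" "w = u @ v" "w' = u' @ v'"
      by (auto simp: inL)
    then have "\<psi>1 u = \<psi>1 u'" "\<psi>2 v = \<psi>2 v'" using w(3) by (simp_all add: psi)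
    then have "u = u'" "v = v'" using u bij bij_betw_imp_inj_on inj_onD by metis+
    then show "w = w'" using u by simp
  qed
  moreover have "\<psi> ` L = carrier (G \<times>\<times> H)"
  proof -
    have "\<psi> ` L = (\<lambda>(u, v). \<psi> (u @ v)) ` (L1 \<times> L2)" by (force simp: inL)
    also have "\<dots> = (\<lambda>(u, v). (\<psi>1 u, \<psi>2 v)) ` (L1 \<times> L2)" using psi by (intro image_cong) auto
    also have "\<dots> = \<psi>1 ` L1 \<times> \<psi>2 ` L2" by auto
    finally show ?thesis using bij by (simp add: bij_betw_def DirProd_def)
  qed
  ultimately have bij': "bij_betw \<psi> L (carrier (G \<times>\<times> H))" by (simp add: bij_betw_def)
  \<comment> \<open>Each of these generators moves one coordinate only, hence acts on the prefix
    alone or on the suffix alone.\<close>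
  define U where "U = (\<lambda>s. (s, \<one>\<^bsub>H\<^esub>)) ` S \<union> (\<lambda>t. (\<one>\<^bsub>G\<^esub>, t)) ` T"
  have SG: "S \<subseteq> carrier G" and TH: "T \<subseteq> carrier H"
    using S(2) T(2) by (auto simp: semigroup_generators_def)
  have gens: "semigroup_generators (G \<times>\<times> H) U"
  proof (rule GH.semigroup_generatorsI)
    show "U \<subseteq> carrier (G \<times>\<times> H)" using SG TH by (auto simp: U_def DirProd_def)
    fix g assume "g \<in> carrier (G \<times>\<times> H)"
    then obtain x y where g: "g = (x, y)" "x \<in> carrier G" "y \<in> carrier H" by (auto simp: DirProd_def)
    obtain ss ts where ss: "ss \<noteq> []" "set ss \<subseteq> S" "x = gprod G ss" and ts: "set ts \<subseteq> T" "y = gprod H ts"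
      using S(2) T(2) g unfolding semigroup_generators_def by blast
    have 1: "gprod (G \<times>\<times> H) (map (\<lambda>s. (s, \<one>\<^bsub>H\<^esub>)) ss) = (gprod G ss, \<one>\<^bsub>H\<^esub>)"
      by (induction ss) (auto simp: gprod_def DirProd_def)
    have 2: "gprod (G \<times>\<times> H) (map (\<lambda>t. (\<one>\<^bsub>G\<^esub>, t)) ts) = (\<one>\<^bsub>G\<^esub>, gprod H ts)"
      by (induction ts) (auto simp: gprod_def DirProd_def)
    have "gprod (G \<times>\<times> H) (map (\<lambda>s. (s, \<one>\<^bsub>H\<^esub>)) ss @ map (\<lambda>t. (\<one>\<^bsub>G\<^esub>, t)) ts) = g"
      by (subst GH.gprod_append)
        (use ss ts SG TH g in \<open>auto simp: 1 2 subset_eq\<close>)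
    then show "\<exists>ss. ss \<noteq> [] \<and> set ss \<subseteq> U \<and> g = gprod (G \<times>\<times> H) ss"
      using ss ts by (intro exI[of _ "map (\<lambda>s. (s, \<one>\<^bsub>H\<^esub>)) ss @ map (\<lambda>t. (\<one>\<^bsub>G\<^esub>, t)) ts"]) (auto simp: U_def)
  qed
  have rm1: "right_mult (G \<times>\<times> H) (\<Sigma>1 \<union> \<Sigma>2) L \<psi> (g, \<one>\<^bsub>H\<^esub>)" if g: "g \<in> carrier G" for g
  proof -
    obtain f where f: "polytime \<Sigma>1 f" "f \<in> L1 \<rightarrow> L1" "\<And>w. w \<in> L1 \<Longrightarrow> \<psi>1 (f w) = \<psi>1 w \<otimes>\<^bsub>G\<^esub> g"
      using P1 g unfolding presents_def right_mult_def by blast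
    have "on_prefix \<Sigma>1 f w \<in> L \<and> \<psi> (on_prefix \<Sigma>1 f w) = \<psi> w \<otimes>\<^bsub>G \<times>\<times> H\<^esub> (g, \<one>\<^bsub>H\<^esub>)" if wL: "w \<in> L" for w
    proof -
      from wL obtain u v where w: "u \<in> L1" "v \<in> L2" "w = u @ v" by (auto simp: inL)
      have "on_prefix \<Sigma>1 f (u @ v) = f u @ v"
        using w sub hd2 by (intro on_prefix_append) auto
      moreover have "f u \<in> L1" using f(2) w by auto
      moreover have "\<psi>1 u \<in> carrier G" "\<psi>2 v \<in> carrier H" using bij w by (auto simp: bij_betw_def)
      ultimately show ?thesis using w by (simp add: inLI psi f(3))
    qed
    then show ?thesis
      unfolding right_mult_def using polytime_on_prefix[OF _ _ f(1), of "\<Sigma>1 \<union> \<Sigma>2"] fin1 fin2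
      by (intro exI[of _ "on_prefix \<Sigma>1 f"]) auto
  qed
  have rm2: "right_mult (G \<times>\<times> H) (\<Sigma>1 \<union> \<Sigma>2) L \<psi> (\<one>\<^bsub>G\<^esub>, h)" if h: "h \<in> carrier H" for h
  proof -
    obtain f where f: "polytime \<Sigma>2 f" "f \<in> L2 \<rightarrow> L2" "\<And>w. w \<in> L2 \<Longrightarrow> \<psi>2 (f w) = \<psi>2 w \<otimes>\<^bsub>H\<^esub> h"
      using P2 h unfolding presents_def right_mult_def by blast
    have "on_suffix \<Sigma>2 f w \<in> L \<and> \<psi> (on_suffix \<Sigma>2 f w) = \<psi> w \<otimes>\<^bsub>G \<times>\<times> H\<^esub> (\<one>\<^bsub>G\<^esub>, h)" if wL: "w \<in> L" for w
    proof -
      from wL obtain u v where w: "u \<in> L1" "v \<in> L2" "w = u @ v" by (auto simp: inL)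
      have "on_suffix \<Sigma>2 f (u @ v) = u @ f v"
        using w sub last1 by (intro on_suffix_append) auto
      moreover have "f v \<in> L2" using f(2) w by auto
      moreover have "\<psi>1 u \<in> carrier G" "\<psi>2 v \<in> carrier H" using bij w by (auto simp: bij_betw_def)
      ultimately show ?thesis using w by (simp add: inLI psi f(3))
    qed
    then show ?thesis
      unfolding right_mult_def using polytime_on_suffix[OF _ _ f(1), of "\<Sigma>1 \<union> \<Sigma>2"] fin1 fin2
      by (intro exI[of _ "on_suffix \<Sigma>2 f"]) auto
  qed
  \<comment> \<open>Lengths add under concatenation, and so do the bounds of the factors.\<close>
  have "presents b (G \<times>\<times> H) (\<Sigma>1 \<union> \<Sigma>2) L \<psi> (\<lambda>(x, y). \<rho>1 x + \<rho>2 y)"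
  proof (rule GH.presentsI[OF gens])
    show "finite (\<Sigma>1 \<union> \<Sigma>2)" using fin1 fin2 by simp
    show "L \<subseteq> lists (\<Sigma>1 \<union> \<Sigma>2)"
      by (auto simp: inL in_lists_conv_set dest!: subsetD[OF sub(1)] subsetD[OF sub(2)])
    show "right_mult (G \<times>\<times> H) (\<Sigma>1 \<union> \<Sigma>2) L \<psi> s" if "s \<in> U" for s
      using that rm1 rm2 SG TH by (auto simp: U_def)
  next
    fix w assume b "w \<in> L"
    moreover from \<open>b\<close> have "\<And>u. u \<in> L1 \<Longrightarrow> real (length u) \<le> \<rho>1 (\<psi>1 u)" "\<And>v. v \<in> L2 \<Longrightarrow> real (length v) \<le> \<rho>2 (\<psi>2 v)"
      using P1 P2 by (auto simp: presents_def)
    ultimately show "real (length w) \<le> (case \<psi> w of (x, y) \<Rightarrow> \<rho>1 x + \<rho>2 y)"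
      by (fastforce simp: inL psi intro: add_mono)
  next
    fix s assume b: b and s: "s \<in> U"
    then have s': "fst s \<in> carrier G" "snd s \<in> carrier H" using SG TH by (auto simp: U_def)
    then obtain K1 K2 where "\<And>x. x \<in> carrier G \<Longrightarrow> \<rho>1 (x \<otimes>\<^bsub>G\<^esub> fst s) \<le> \<rho>1 x + K1"
      "\<And>y. y \<in> carrier H \<Longrightarrow> \<rho>2 (y \<otimes>\<^bsub>H\<^esub> snd s) \<le> \<rho>2 y + K2"
      using b P1 P2 unfolding presents_def bounded_increase_def by meson
    then show "bounded_increase (G \<times>\<times> H) (\<lambda>(x, y). \<rho>1 x + \<rho>2 y) s"
      unfolding bounded_increase_def
      by (intro exI[of _ "K1 + K2"]) (fastforce simp: DirProd_def case_prod_beta)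
  qed (rule bij')
  moreover have "finite U" using S(1) T(1) by (simp add: U_def)
  ultimately show ?thesis unfolding presentable_def using GH.group_axioms gens LC by blast
qed

section \<open>Finite extensions\<close>

lemma presentable_finite_extension:
  fixes G :: "('g, 'm) monoid_scheme" (structure)
  assumes G: "group G" and H: "subgroup H G" and fin: "finite (rcosets\<^bsub>G\<^esub> H)"
    and P: "presentable \<C> b (G\<lparr>carrier := H\<rparr>)"
    and conc: "\<And>\<Sigma> \<Sigma>\<^sub>0 L L\<^sub>0. finite \<Sigma> \<Longrightarrow> finite \<Sigma>\<^sub>0 \<Longrightarrow> \<Sigma> \<inter> \<Sigma>\<^sub>0 = {} \<Longrightarrow> L \<subseteq> lists \<Sigma> \<Longrightarrow> L \<in> \<C> \<Longrightarrow>
      L\<^sub>0 \<subseteq> lists \<Sigma>\<^sub>0 \<Longrightarrow> finite L\<^sub>0 \<Longrightarrow> conc L L\<^sub>0 \<in> \<C>"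
  shows "presentable \<C> b G"
proof -
  interpret group G by fact
  have HG: "H \<subseteq> carrier G" using H by (rule subgroup.subset)
  obtain S where S: "finite S" "semigroup_generators (G\<lparr>carrier := H\<rparr>) S"
    using P unfolding presentable_def by blast
  obtain \<Sigma> L \<psi> \<rho> where LC: "L \<in> \<C>" and pres: "presents b (G\<lparr>carrier := H\<rparr>) \<Sigma> L \<psi> \<rho>"
    using P unfolding presentable_def by blast
  have fin\<Sigma>: "finite \<Sigma>" and sub: "L \<subseteq> lists \<Sigma>" and bij: "bij_betw \<psi> L H"
    using pres by (auto simp: presents_def)
  have SH: "S \<subseteq> H" and Sgen: "\<exists>ss. ss \<noteq> [] \<and> set ss \<subseteq> S \<and> h = gprod G ss" if "h \<in> H" for h
    using S(2) that by (auto simp: semigroup_generators_def gprod_def)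
  obtain n :: nat and e where e: "bij_betw e {..<n} (rcosets H)"
    using ex_bij_betw_nat_finite[OF fin] by (auto simp: atLeast0LessThan)
  have "\<exists>x. x \<in> carrier G \<and> e j = H #> x" if "j < n" for j
    using bij_betwE[OF e, rule_format, of j] that by (auto simp: RCOSETS_def)
  then obtain r where r: "\<And>j. j < n \<Longrightarrow> r j \<in> carrier G" "\<And>j. j < n \<Longrightarrow> e j = H #> r j" by metis
  have ex: "\<exists>j h. j < n \<and> h \<in> H \<and> g = h \<otimes> r j" if "g \<in> carrier G" for g
  proof -
    have "H #> g \<in> rcosets H" using that HG by (rule rcosetsI[rotated])
    then have "H #> g \<in> e ` {..<n}" using bij_betw_imp_surj_on[OF e] by simp
    then obtain j where "j < n" "e j = H #> g" by (metis imageE lessThan_iff)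
    then have "j < n" "g \<in> H #> r j" using rcos_self[OF that H] r(2)[of j] by simp_all
    then show ?thesis using \<open>j < n\<close> by (auto simp: r_coset_def)
  qed
  have uniq: "h = h' \<and> j = j'"
    if "j < n" "j' < n" "h \<in> H" "h' \<in> H" "h \<otimes> r j = h' \<otimes> r j'" for h h' j j'
  proof -
    have "h \<otimes> r j \<in> H #> r j" "h' \<otimes> r j' \<in> H #> r j'" using that(3,4) by (auto simp: r_coset_def)
    with that(5) have "h \<otimes> r j \<in> H #> r j" "h \<otimes> r j \<in> H #> r j'" by simp_all
    then have "H #> r j = H #> r j'"
      using repr_independence[of _ H "r j"] repr_independence[of _ H "r j'"] H r that by metis
    then have "j = j'" using r(2) that inj_onD[OF bij_betw_imp_inj_on[OF e], of j j'] by simp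
    then show ?thesis using that r HG by (auto dest: right_cancel[THEN iffD1, rotated 3])
  qed
  \<comment> \<open>Multiplication by \<open>g\<close> permutes the cosets and produces a correction
    in \<open>H\<close> that depends only on \<open>j\<close> and \<open>g\<close>. For fixed
    \<open>g\<close> there are finitely many corrections, each handled by a machine for
    \<open>H\<close>.\<close>
  have "\<forall>j g. \<exists>h k. j < n \<and> g \<in> carrier G \<longrightarrow> k < n \<and> h \<in> H \<and> r j \<otimes> g = h \<otimes> r k"
    using ex r by (meson m_closed)
  then obtain \<eta> \<kappa> where \<kappa>: "\<And>j g. j < n \<Longrightarrow> g \<in> carrier G \<Longrightarrow> \<kappa> j g < n \<and> \<eta> j g \<in> H \<and> r j \<otimes> g = \<eta> j g \<otimes> r (\<kappa> j g)"
    by metis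
  have mult: "h \<otimes> r j \<otimes> g = (h \<otimes> \<eta> j g) \<otimes> r (\<kappa> j g)" if "j < n" "g \<in> carrier G" "h \<in> H" for h j g
  proof -
    have "h \<otimes> r j \<otimes> g = h \<otimes> (\<eta> j g \<otimes> r (\<kappa> j g))"
      using that \<kappa>[of j g] HG r by (auto simp: m_assoc)
    also have "\<dots> = (h \<otimes> \<eta> j g) \<otimes> r (\<kappa> j g)"
      using that \<kappa>[of j g] HG r by (subst m_assoc) auto
    finally show ?thesis .
  qed
  have Hmult: "h \<otimes> h' \<in> H" if "h \<in> H" "h' \<in> H" for h h' using H that by (rule subgroup.m_closed)
  obtain N where N: "\<Sigma> \<subseteq> {..<N}" using fin\<Sigma> by (meson finite_nat_iff_bounded)
  \<comment> \<open>The letter \<open>N + j\<close> stands for the representative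
    \<open>r j\<close>; the shift by \<open>N\<close> makes it new.\<close>
  define \<Sigma>0 where "\<Sigma>0 = (\<lambda>j. N + j) ` {..<n}"
  define L0 where "L0 = (\<lambda>j. [N + j]) ` {..<n}"
  define L' where "L' = conc L L0"
  define \<psi>' where "\<psi>' = (\<lambda>w. \<psi> (butlast w) \<otimes> r (last w - N))"
  have inL: "w \<in> L' \<longleftrightarrow> (\<exists>u\<in>L. \<exists>j<n. w = u @ [N + j])" for w
    by (auto simp: L'_def L0_def conc_def)
  have disj: "\<Sigma> \<inter> \<Sigma>0 = {}" using N by (auto simp: \<Sigma>0_def)
  have L'C: "L' \<in> \<C>"
    unfolding L'_def by (rule conc[of \<Sigma> \<Sigma>0]) (use fin\<Sigma> disj sub LC in \<open>auto simp: \<Sigma>0_def L0_def\<close>)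
  have psi: "\<psi>' (u @ [N + j]) = \<psi> u \<otimes> r j" for u j
    by (simp add: \<psi>'_def)
  have psiH: "\<psi> u \<in> H" if "u \<in> L" for u using bij that by (auto simp: bij_betw_def)
  have "inj_on \<psi>' L'"
  proof (rule inj_onI)
    fix w w' assume w: "w \<in> L'" "w' \<in> L'" "\<psi>' w = \<psi>' w'"
    then obtain u j u' j' where u: "u \<in> L" "j < n" "w = u @ [N + j]" "u' \<in> L" "j' < n" "w' = u' @ [N + j']"
      by (auto simp: inL)
    then have "\<psi> u = \<psi> u' \<and> j = j'" using w(3) by (intro uniq) (auto simp: psi psiH)
    then show "w = w'" using u inj_onD[OF bij_betw_imp_inj_on[OF bij], of u u'] by simp
  qed
  moreover have "\<psi>' ` L' = carrier G"
  proof (intro equalityI subsetI)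
    fix g assume "g \<in> carrier G"
    then obtain j h where j: "j < n" "h \<in> H" "g = h \<otimes> r j" using ex by blast
    then obtain u where "u \<in> L" "h = \<psi> u" using bij by (auto simp: bij_betw_def)
    then have "g = \<psi>' (u @ [N + j])" "u @ [N + j] \<in> L'" using j by (auto simp: psi inL)
    then show "g \<in> \<psi>' ` L'" by blast
  qed (use subsetD[OF HG psiH] r in \<open>auto simp: inL psi\<close>)
  ultimately have bij': "bij_betw \<psi>' L' (carrier G)" by (simp add: bij_betw_def)
  have rm: "right_mult G (\<Sigma> \<union> \<Sigma>0) L' \<psi>' g" if g: "g \<in> carrier G" for g
  proof -
    have "\<forall>h. \<exists>f. h \<in> H \<longrightarrow> polytime \<Sigma> f \<and> f \<in> L \<rightarrow> L \<and> (\<forall>w\<in>L. \<psi> (f w) = \<psi> w \<otimes> h)"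
      using pres unfolding presents_def right_mult_def by auto
    then obtain F where F: "\<And>h. h \<in> H \<Longrightarrow> polytime \<Sigma> (F h)" "\<And>h w. h \<in> H \<Longrightarrow> w \<in> L \<Longrightarrow> F h w \<in> L"
      "\<And>h w. h \<in> H \<Longrightarrow> w \<in> L \<Longrightarrow> \<psi> (F h w) = \<psi> w \<otimes> h" by (metis Pi_mem)
    \<comment> \<open>The automaton state is the last letter read, hence in the end the coset
      letter, which selects the correction. The substitution acts on the whole word, but on a normal
      form the letter \<open>a\<close> occurs only at the end.\<close>
    define f where "f = (\<lambda>q w. case q of
       None \<Rightarrow> w | Some a \<Rightarrow> if a \<in> \<Sigma>0 then map (\<lambda>x. if x = a then N + \<kappa> (a - N) g else x)
         (on_prefix \<Sigma> (F (\<eta> (a - N) g)) w) else w)"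
    define f' where "f' = (\<lambda>w. f (foldl (\<lambda>_. Some) None w) w)"
    have fin': "finite (\<Sigma> \<union> \<Sigma>0)" using fin\<Sigma> by (simp add: \<Sigma>0_def)
    have pf: "polytime (\<Sigma> \<union> \<Sigma>0) (f q)" for q
    proof (cases "\<exists>j<n. q = Some (N + j)")
      case True
      then obtain j where j: "j < n" "q = Some (N + j)" by blast
      have "polytime (\<Sigma> \<union> \<Sigma>0) (on_prefix \<Sigma> (F (\<eta> j g)))"
        using \<kappa>[OF j(1) g] by (intro polytime_on_prefix fin' F) auto
      moreover have "polytime (\<Sigma> \<union> \<Sigma>0) (map (\<lambda>x. if x = N + j then N + \<kappa> j g else x))"
        using \<kappa>[OF j(1) g] by (intro polytime_map fin') (auto simp: \<Sigma>0_def)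
      ultimately have "polytime (\<Sigma> \<union> \<Sigma>0) (\<lambda>w. map (\<lambda>x. if x = N + j then N + \<kappa> j g else x) (on_prefix \<Sigma> (F (\<eta> j g)) w))"
        by (rule polytime_comp)
      then show ?thesis using j by (simp add: f_def \<Sigma>0_def cong del: if_weak_cong)
    next
      case False
      then have "f q w = w" for w by (cases q) (auto simp: f_def \<Sigma>0_def)
      then have "f q = (\<lambda>w. w)" by blast
      then show ?thesis using polytime_id[OF fin'] by simp
    qed
    have "polytime (\<Sigma> \<union> \<Sigma>0) f'" unfolding f'_def
      by (rule polytime_branch[where Q = "insert None (Some ` (\<Sigma> \<union> \<Sigma>0))"])
        (use fin' polytime_id[OF fin'] pf in auto)
    moreover have "f' (u @ [N + j]) = F (\<eta> j g) u @ [N + \<kappa> j g]" if "u \<in> L" "j < n" for u j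
    proof -
      have "on_prefix \<Sigma> (F (\<eta> j g)) (u @ [N + j]) = F (\<eta> j g) u @ [N + j]"
        using that sub N by (intro on_prefix_append) auto
      moreover have "F (\<eta> j g) u \<in> lists \<Sigma>" using F(2)[of "\<eta> j g" u] \<kappa>[OF that(2) g] that sub by auto
      then have "map (\<lambda>x. if x = N + j then N + \<kappa> j g else x) (F (\<eta> j g) u) = F (\<eta> j g) u"
        using N by (intro map_idI) (auto simp: in_lists_conv_set)
      ultimately show ?thesis using that by (simp add: f'_def f_def \<Sigma>0_def cong del: if_weak_cong)
    qed
    moreover have "F (\<eta> j g) u \<in> L" "\<kappa> j g < n" "\<psi> (F (\<eta> j g) u) \<otimes> r (\<kappa> j g) = \<psi> u \<otimes> r j \<otimes> g"
      if "u \<in> L" "j < n" for u j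
      using F(2,3)[of "\<eta> j g" u] \<kappa>[OF that(2) g] that mult[OF that(2) g psiH[OF that(1)]] by auto
    ultimately show ?thesis unfolding right_mult_def by (intro exI[of _ f']) (auto simp: inL psi)
  qed
  \<comment> \<open>The added 1 pays for the coset letter.\<close>
  define \<rho>' where "\<rho>' = (\<lambda>g. \<rho> (THE h. \<exists>j<n. h \<in> H \<and> g = h \<otimes> r j) + 1)"
  have rho: "\<rho>' (h \<otimes> r j) = \<rho> h + 1" if "h \<in> H" "j < n" for h j
    unfolding \<rho>'_def using that uniq by (subst the_equality[of _ h]) auto
  have incr: "bounded_increase G \<rho>' g" if b and g: "g \<in> carrier G" for g
  proof -
    have "\<forall>j. \<exists>K. j < n \<longrightarrow> (\<forall>h\<in>H. \<rho> (h \<otimes> \<eta> j g) \<le> \<rho> h + K)"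
      using pres \<kappa>[OF _ g] \<open>b\<close> unfolding presents_def bounded_increase_def by auto
    then obtain K where K: "\<And>j h. j < n \<Longrightarrow> h \<in> H \<Longrightarrow> \<rho> (h \<otimes> \<eta> j g) \<le> \<rho> h + K j" by metis
    \<comment> \<open>The increment \<open>K j\<close> depends on the coset of \<open>x\<close>; the
      sum over the finitely many cosets does not.\<close>
    have "\<rho>' (x \<otimes> g) \<le> \<rho>' x + (\<Sum>j<n. \<bar>K j\<bar>)" if x: "x \<in> carrier G" for x
    proof -
      obtain j h where j: "j < n" "h \<in> H" "x = h \<otimes> r j" using ex[OF x] by blast
      have "\<bar>K j\<bar> \<le> (\<Sum>j<n. \<bar>K j\<bar>)" using j by (intro member_le_sum) auto
      then show ?thesis
        using K[OF j(1,2)] \<kappa>[OF j(1) g] mult[OF j(1) g j(2)] j by (simp add: rho Hmult)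
    qed
    then show ?thesis unfolding bounded_increase_def by blast
  qed
  have gens: "semigroup_generators G (S \<union> r ` {..<n})"
  proof (rule semigroup_generatorsI)
    have "\<one> \<in> H" using H by (rule subgroup.one_closed)
    then show "S \<union> r ` {..<n} \<subseteq> carrier G" using SH[of \<one>] HG r by auto
    fix g assume "g \<in> carrier G"
    then obtain j h where j: "j < n" "h \<in> H" "g = h \<otimes> r j" using ex by blast
    obtain ss where ss: "ss \<noteq> []" "set ss \<subseteq> S" "h = gprod G ss" using Sgen[OF j(2)] by blast
    then have "gprod G (ss @ [r j]) = g"
      using gprod_append[of ss "[r j]"] SH[OF j(2)] HG j r by (auto simp: gprod_def[of _ "[r j]"])
    then show "\<exists>ss. ss \<noteq> [] \<and> set ss \<subseteq> S \<union> r ` {..<n} \<and> g = gprod G ss"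
      using ss j by (intro exI[of _ "ss @ [r j]"]) auto
  qed
  have "presents b G (\<Sigma> \<union> \<Sigma>0) L' \<psi>' \<rho>'"
  proof (rule presentsI[OF gens _ _ bij'])
    show "L' \<subseteq> lists (\<Sigma> \<union> \<Sigma>0)"
      by (auto simp: inL \<Sigma>0_def in_lists_conv_set dest!: subsetD[OF sub])
    show "right_mult G (\<Sigma> \<union> \<Sigma>0) L' \<psi>' s" "b \<Longrightarrow> bounded_increase G \<rho>' s" if "s \<in> S \<union> r ` {..<n}" for s
      using rm incr gens that by (auto simp: semigroup_generators_def)
    fix w assume b: b and "w \<in> L'"
    then obtain u j where u: "u \<in> L" "j < n" "w = u @ [N + j]" by (auto simp: inL)
    then have "real (length u) \<le> \<rho> (\<psi> u)" using pres b by (simp add: presents_def)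
    then show "real (length w) \<le> \<rho>' (\<psi>' w)" using u by (simp add: psi rho psiH)
  qed (use fin\<Sigma> in \<open>simp add: \<Sigma>0_def\<close>)
  moreover have "finite (S \<union> r ` {..<n})" using S(1) by simp
  ultimately show ?thesis unfolding presentable_def using group_axioms gens L'C by blast
qed

section \<open>Free products\<close>

text \<open>Left translation commutes with right multiplication, so the functions on words stay the
  same; only values and bounds are translated, by \<open>c\<close> or its inverse.\<close>

lemma presents_one_left:
  assumes G: "group G" and P: "presents b G \<Sigma> L \<psi> \<rho>" and e: "[] \<in> L"
  obtains \<psi>' \<rho>' where "presents b G \<Sigma> L \<psi>' \<rho>'" "\<psi>' [] = \<one>\<^bsub>G\<^esub>"
proof -
  interpret group G by fact
  define c where "c = \<psi> []"
  have bij: "bij_betw \<psi> L (carrier G)" using P by (simp add: presents_def)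
  then have psi: "\<psi> w \<in> carrier G" if "w \<in> L" for w using that by (auto simp: bij_betw_def)
  have c: "c \<in> carrier G" using psi[OF e] by (simp add: c_def)
  define \<psi>' where "\<psi>' = (\<lambda>w. inv\<^bsub>G\<^esub> c \<otimes>\<^bsub>G\<^esub> \<psi> w)"
  define \<rho>' where "\<rho>' = (\<lambda>x. \<rho> (c \<otimes>\<^bsub>G\<^esub> x))"
  have "bij_betw (\<lambda>x. inv\<^bsub>G\<^esub> c \<otimes>\<^bsub>G\<^esub> x) (carrier G) (carrier G)"
    by (rule bij_betw_byWitness[where f' = "\<lambda>x. c \<otimes>\<^bsub>G\<^esub> x"]) (use c in \<open>auto simp: m_assoc[symmetric]\<close>)
  from bij_betw_trans[OF bij this] have "bij_betw \<psi>' L (carrier G)" by (simp add: \<psi>'_def comp_def)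
  moreover have "right_mult G \<Sigma> L \<psi>' g" if g: "g \<in> carrier G" for g
  proof -
    obtain f where f: "polytime \<Sigma> f" "f \<in> L \<rightarrow> L" "\<And>w. w \<in> L \<Longrightarrow> \<psi> (f w) = \<psi> w \<otimes>\<^bsub>G\<^esub> g"
      using P g unfolding presents_def right_mult_def by blast
    have "\<psi>' (f w) = \<psi>' w \<otimes>\<^bsub>G\<^esub> g" if "w \<in> L" for w
      using f(3)[OF that] psi[OF that] c g by (simp add: \<psi>'_def m_assoc)
    with f show ?thesis unfolding right_mult_def by blast
  qed
  moreover have "bounded_increase G \<rho>' g" if b and g: "g \<in> carrier G" for g
  proof -
    obtain K where "\<And>x. x \<in> carrier G \<Longrightarrow> \<rho> (x \<otimes>\<^bsub>G\<^esub> g) \<le> \<rho> x + K"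
      using P g \<open>b\<close> unfolding presents_def bounded_increase_def by blast
    then have "\<rho>' (x \<otimes>\<^bsub>G\<^esub> g) \<le> \<rho>' x + K" if "x \<in> carrier G" for x
      using that c g by (simp add: \<rho>'_def m_assoc[symmetric])
    then show ?thesis unfolding bounded_increase_def by blast
  qed
  moreover have "real (length w) \<le> \<rho>' (\<psi>' w)" if b "w \<in> L" for w
  proof -
    have "\<rho>' (\<psi>' w) = \<rho> (\<psi> w)" using psi[OF that(2)] c by (simp add: \<rho>'_def \<psi>'_def m_assoc[symmetric])
    then show ?thesis using P that by (simp add: presents_def)
  qed
  ultimately have "presents b G \<Sigma> L \<psi>' \<rho>'" using P by (simp add: presents_def)
  moreover have "\<psi>' [] = \<one>\<^bsub>G\<^esub>" using c by (simp add: \<psi>'_def c_def[symmetric])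
  ultimately show ?thesis using that by blast
qed

text \<open>The functions on words are conjugated by the transposition of \<open>[]\<close> and
  \<open>w0\<close>. The bound survives because the exchange only shortens normal forms.\<close>

lemma presents_exchange_Nil:
  assumes P: "presents b G \<Sigma> L \<psi> \<rho>" and e: "[] \<notin> L" and w0: "w0 \<in> L"
  obtains \<psi>' where "presents b G \<Sigma> ((L - {w0}) \<union> {[]}) \<psi>' \<rho>"
proof -
  define \<sigma> where "\<sigma> = (\<lambda>w. if w \<in> {[], w0} then (if w = w0 then [] else w0) else w)"
  define L' where "L' = (L - {w0}) \<union> {[]}"
  have fin: "finite \<Sigma>" and sub: "L \<subseteq> lists \<Sigma>" and bij: "bij_betw \<psi> L (carrier G)"
    using P by (auto simp: presents_def)
  have ss: "\<sigma> (\<sigma> w) = w" for w by (simp add: \<sigma>_def)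
  have in1: "\<sigma> w \<in> L" if "w \<in> L'" for w using that w0 e by (auto simp: \<sigma>_def L'_def)
  have in2: "\<sigma> w \<in> L'" if "w \<in> L" for w using that w0 e by (auto simp: \<sigma>_def L'_def)
  have ps: "polytime \<Sigma> \<sigma>"
    unfolding \<sigma>_def
    by (rule polytime_cases[where f = "\<lambda>w _. if w = w0 then [] else w0"])
      (use fin w0 sub in \<open>auto intro: polytime_const polytime_id\<close>)
  have "bij_betw \<sigma> L' L"
    by (rule bij_betw_byWitness[where f' = \<sigma>]) (use ss in1 in2 in auto)
  from bij_betw_trans[OF this bij] have "bij_betw (\<lambda>w. \<psi> (\<sigma> w)) L' (carrier G)" by (simp add: comp_def)
  moreover have "right_mult G \<Sigma> L' (\<lambda>w. \<psi> (\<sigma> w)) g" if g: "g \<in> carrier G" for g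
  proof -
    obtain f where f: "polytime \<Sigma> f" "f \<in> L \<rightarrow> L" "\<And>w. w \<in> L \<Longrightarrow> \<psi> (f w) = \<psi> w \<otimes>\<^bsub>G\<^esub> g"
      using P g unfolding presents_def right_mult_def by blast
    have "polytime \<Sigma> (\<lambda>w. \<sigma> (f (\<sigma> w)))"
      by (rule polytime_comp[OF polytime_comp[OF ps f(1)] ps])
    moreover have "(\<lambda>w. \<sigma> (f (\<sigma> w))) \<in> L' \<rightarrow> L'" using in1 in2 f(2) by auto
    ultimately show ?thesis unfolding right_mult_def using f(3) in1 ss by (intro exI conjI) auto
  qed
  moreover have "real (length w) \<le> \<rho> (\<psi> (\<sigma> w))" if b "w \<in> L'" for w
  proof -
    have "real (length (\<sigma> w)) \<le> \<rho> (\<psi> (\<sigma> w))" using P that in1 by (simp add: presents_def)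
    moreover have "length w \<le> length (\<sigma> w)" using that(2) by (auto simp: \<sigma>_def L'_def)
    ultimately show ?thesis by linarith
  qed
  moreover have "L' \<subseteq> lists \<Sigma>" using sub by (auto simp: L'_def)
  ultimately have "presents b G \<Sigma> L' (\<lambda>w. \<psi> (\<sigma> w)) \<rho>" using P by (simp add: presents_def)
  then show ?thesis using that by (simp add: L'_def)
qed

text \<open>Afterwards the nonempty words represent exactly the nontrivial elements, as the blocks
  of an alternating word must. The language is nonempty because the group is, so there is a word to
  exchange.\<close>

lemma presents_normalise:
  assumes C: "\<forall>L w. L \<in> \<C> \<and> L \<noteq> {} \<and> [] \<notin> L \<and> w \<in> L \<longrightarrow> (L - {w}) \<union> {[]} \<in> \<C>"
    and G: "group G" and L: "L \<in> \<C>" and P: "presents b G \<Sigma> L \<psi> \<rho>"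
  obtains L' \<psi>' \<rho>' where "L' \<in> \<C>" "presents b G \<Sigma> L' \<psi>' \<rho>'" "[] \<in> L'" "\<psi>' [] = \<one>\<^bsub>G\<^esub>"
proof (cases "[] \<in> L")
  case True
  then show ?thesis using presents_one_left[OF G P] L that by metis
next
  case False
  have "\<psi> ` L = carrier G" using P by (auto simp: presents_def bij_betw_def)
  then obtain w where w: "w \<in> L" using group.is_monoid[OF G] monoid.one_closed by blast
  obtain \<psi>1 where "presents b G \<Sigma> ((L - {w}) \<union> {[]}) \<psi>1 \<rho>"
    using presents_exchange_Nil[OF P False w] by blast
  moreover have "(L - {w}) \<union> {[]} \<in> \<C>" using C L False w by blast
  ultimately show ?thesis using presents_one_left[OF G] that by (metis UnI2 singletonI)
qed

text \<open>The last clause is a default for letters from different factors; with it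
  \<open>isl_mul\<close> and \<open>mul_closed\<close> hold without a condition on the
  sides.\<close>

fun letter_mult :: "('a, 'm) monoid_scheme \<Rightarrow> ('b, 'n) monoid_scheme \<Rightarrow> 'a + 'b \<Rightarrow> 'a + 'b \<Rightarrow> 'a + 'b" where
  "letter_mult G H (Inl a) (Inl b) = Inl (a \<otimes>\<^bsub>G\<^esub> b)"
| "letter_mult G H (Inr a) (Inr b) = Inr (a \<otimes>\<^bsub>H\<^esub> b)"
| "letter_mult G H x _ = x"

fun trivial_letter :: "('a, 'm) monoid_scheme \<Rightarrow> ('b, 'n) monoid_scheme \<Rightarrow> 'a + 'b \<Rightarrow> bool" where
  "trivial_letter G H (Inl a) \<longleftrightarrow> a = \<one>\<^bsub>G\<^esub>"
| "trivial_letter G H (Inr a) \<longleftrightarrow> a = \<one>\<^bsub>H\<^esub>"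

section \<open>Van der Waerden's action on reduced words\<close>

locale two_groups = G: group G + H: group H
  for G :: "('a, 'm) monoid_scheme" and H :: "('b, 'n) monoid_scheme"
begin

abbreviation letters :: "('a + 'b) set" where "letters \<equiv> carrier G <+> carrier H"
abbreviation mul :: "'a + 'b \<Rightarrow> 'a + 'b \<Rightarrow> 'a + 'b" where "mul \<equiv> letter_mult G H"
abbreviation triv :: "'a + 'b \<Rightarrow> bool" where "triv \<equiv> trivial_letter G H"
abbreviation cls :: "('a + 'b) list \<Rightarrow> ('a + 'b) list set" where "cls w \<equiv> fp_rel G H `` {w}"

lemma isl_mul [simp]: "isl (mul x y) = isl x"
  by (cases "(G, H, x, y)" rule: letter_mult.cases) auto

lemma mul_closed [simp]: "x \<in> letters \<Longrightarrow> y \<in> letters \<Longrightarrow> mul x y \<in> letters"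
  by (cases x; cases y) auto

lemma mul_assoc: "x \<in> letters \<Longrightarrow> y \<in> letters \<Longrightarrow> z \<in> letters \<Longrightarrow> isl x = isl y \<Longrightarrow> isl y = isl z \<Longrightarrow>
    mul (mul x y) z = mul x (mul y z)"
  by (cases x; cases y; cases z) (auto simp: G.m_assoc H.m_assoc)

lemma mul_triv: "x \<in> letters \<Longrightarrow> triv y \<Longrightarrow> isl x = isl y \<Longrightarrow> mul x y = x \<and> mul y x = x"
  by (cases x; cases y) auto

text \<open>A right inverse and a left inverse of the same letter coincide.\<close>

lemma triv_cancel: "x \<in> letters \<Longrightarrow> y \<in> letters \<Longrightarrow> z \<in> letters \<Longrightarrow> isl x = isl y \<Longrightarrow> isl y = isl z \<Longrightarrow>
    triv (mul z x) \<Longrightarrow> triv (mul x y) \<Longrightarrow> y = z"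
  by (cases x; cases y; cases z) (auto simp: G.inv_equality H.inv_equality dest: G.inv_equality[OF _ _ _] G.inv_unique H.inv_unique)

text \<open>Reduced words are stored last letter first, so that right multiplication acts on the head.\<close>

fun reduced :: "('a + 'b) list \<Rightarrow> bool" where
  "reduced [] \<longleftrightarrow> True"
| "reduced (x # r) \<longleftrightarrow> x \<in> letters \<and> \<not> triv x \<and> reduced r \<and> (r = [] \<or> isl (hd r) \<noteq> isl x)"

definition push :: "'a + 'b \<Rightarrow> ('a + 'b) list \<Rightarrow> ('a + 'b) list" where
  "push x r = (if triv x then r else case r of [] \<Rightarrow> [x]
     | y # r' \<Rightarrow> if isl y \<noteq> isl x then x # r else if triv (mul y x) then r' else mul y x # r')"

lemma reduced_letters: "reduced r \<Longrightarrow> r \<in> lists letters"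
  by (induction r) auto

lemma rev_lists: "rev w \<in> lists A \<longleftrightarrow> w \<in> lists A"
  by (simp add: in_lists_conv_set)

lemma reduced_push: "x \<in> letters \<Longrightarrow> reduced r \<Longrightarrow> reduced (push x r)"
  by (cases r) (auto simp: push_def)

text \<open>The action respects multiplication inside a factor. If \<open>x\<close> cancels the head
  \<open>z\<close>, the letter below, if any, belongs to the other factor, so \<open>y\<close> is
  put on as a new letter; this agrees with multiplying \<open>z\<close> by the product of
  \<open>x\<close> and \<open>y\<close>.\<close>

lemma push_mul:
  assumes xy: "x \<in> letters" "y \<in> letters" "isl x = isl y" and r: "reduced r"
  shows "push y (push x r) = push (mul x y) r"
proof (cases "triv x \<or> triv y")
  case True
  then show ?thesis
  proof
    assume x: "triv x"
    then have "mul x y = y" using mul_triv[of y x] xy by simp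
    with x show ?thesis by (simp add: push_def)
  next
    assume y: "triv y"
    then have "mul x y = x" using mul_triv[of x y] xy by simp
    with y show ?thesis by (simp add: push_def)
  qed
next
  case False
  show ?thesis
  proof (cases "r = [] \<or> isl (hd r) \<noteq> isl x")
    case True
    then show ?thesis using False xy by (cases r) (auto simp: push_def)
  next
    case F: False
    then obtain z r' where z: "r = z # r'" "isl z = isl x" by (cases r) auto
    with r have zl: "z \<in> letters" "\<not> triv z" "r' = [] \<or> isl (hd r') \<noteq> isl x" by auto
    have assoc: "mul (mul z x) y = mul z (mul x y)" using xy z zl by (intro mul_assoc) auto
    show ?thesis
    proof (cases "triv (mul z x)")
      case True
      show ?thesis
      proof (cases "triv (mul x y)")
        case T2: True
        \<comment> \<open>Both letters are inverse to \<open>x\<close>: after \<open>x\<close> has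
          cancelled \<open>z\<close>, pushing \<open>y\<close> restores the stack.\<close>
        have "y = z" by (rule triv_cancel[of x]) (use xy z zl True T2 in auto)
        then show ?thesis using True T2 False z zl xy by (cases r') (auto simp: push_def)
      next
        case F2: False
        have "mul z (mul x y) = y" using assoc mul_triv[of y "mul z x"] True xy z by simp
        then show ?thesis using True F2 False z zl xy by (cases r') (auto simp: push_def)
      qed
    next
      case F3: False
      show ?thesis
      proof (cases "triv (mul x y)")
        case T2: True
        have "mul z (mul x y) = z" using mul_triv[of z "mul x y"] T2 xy z zl by simp
        then show ?thesis using F3 T2 False z zl xy assoc by (auto simp: push_def)
      next
        case F2: False
        then show ?thesis using F3 False z zl xy assoc by (auto simp: push_def)
      qed
    qed
  qed
qed

lemma reduced_fold_push: "w \<in> lists letters \<Longrightarrow> reduced r \<Longrightarrow> reduced (fold push w r)"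
  by (induction w arbitrary: r) (auto intro: reduced_push)

text \<open>The two sides of every defining relation act alike, so the result on the empty stack is
  an invariant of the class. The stack must be arbitrary because in a concatenation the second word
  acts on the result of the first.\<close>

lemma fold_push_fp_equiv:
  assumes "fp_equiv G H u v" "reduced r"
  shows "fold push u r = fold push v r"
  using assms
proof (induction arbitrary: r)
  case (append u v u' v')
  have "u \<in> lists letters" using fp_equiv_words[OF G.group_axioms H.group_axioms append.hyps(1)] by blast
  then have "reduced (fold push u r)" using append.prems by (rule reduced_fold_push)
  then show ?case using append by simp
next
  case (mult_left a b)
  then show ?case using push_mul[of "Inl a" "Inl b" r] by auto
next
  case (mult_right a b)
  then show ?case using push_mul[of "Inr a" "Inr b" r] by auto
qed (auto simp: push_def)

lemma fp_equiv_triv: "triv x \<Longrightarrow> fp_equiv G H [x] []"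
  by (cases x) (auto intro: fp_equiv.intros)

lemma fp_equiv_mul: "x \<in> letters \<Longrightarrow> y \<in> letters \<Longrightarrow> isl x = isl y \<Longrightarrow> fp_equiv G H [x, y] [mul x y]"
  by (cases x; cases y) (auto intro: fp_equiv.intros)

lemma fp_equiv_push:
  assumes x: "x \<in> letters" and r: "r \<in> lists letters"
  shows "fp_equiv G H (rev r @ [x]) (rev (push x r))"
proof -
  have rr: "fp_equiv G H (rev r) (rev r)" if "r \<in> lists letters" for r
    using that by (intro fp_equiv.refl) (simp add: rev_lists)
  consider "triv x" | "\<not> triv x" "r = [] \<or> isl (hd r) \<noteq> isl x" | y r' where "\<not> triv x" "r = y # r'" "isl y = isl x"
    by (cases r) auto
  then show ?thesis
  proof cases
    case 1
    then show ?thesis using fp_equiv.append[OF rr[OF r] fp_equiv_triv] by (simp add: push_def)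
  next
    case 2
    then have "push x r = x # r" by (cases r) (auto simp: push_def)
    moreover have "rev r @ [x] \<in> lists letters" using x r by (simp add: rev_lists)
    ultimately show ?thesis by (simp add: fp_equiv.refl)
  next
    case 3
    have m: "fp_equiv G H [y, x] [mul y x]" using x r 3 by (intro fp_equiv_mul) auto
    have r': "r' \<in> lists letters" using r 3 by auto
    show ?thesis
    proof (cases "triv (mul y x)")
      case True
      have "fp_equiv G H (rev r' @ [y, x]) (rev r' @ [])"
        by (rule fp_equiv.append[OF rr[OF r'] fp_equiv.trans[OF m fp_equiv_triv[OF True]]])
      then show ?thesis using 3 True by (simp add: push_def)
    next
      case False
      then show ?thesis using 3 fp_equiv.append[OF rr[OF r'] m] by (simp add: push_def)
    qed
  qed
qed

text \<open>Pushing letters never leaves the class of the word, so every class contains a reduced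
  word.\<close>

lemma fp_equiv_fold_push:
  "w \<in> lists letters \<Longrightarrow> reduced r \<Longrightarrow> fp_equiv G H (rev r @ w) (rev (fold push w r))"
proof (induction w arbitrary: r)
  case Nil
  then show ?case using reduced_letters[of r] by (simp add: fp_equiv.refl rev_lists)
next
  case (Cons x w)
  have "fp_equiv G H ((rev r @ [x]) @ w) (rev (push x r) @ w)"
    using Cons reduced_letters[of r] by (intro fp_equiv.append fp_equiv_push fp_equiv.refl) simp_all
  moreover have "fp_equiv G H (rev (push x r) @ w) (rev (fold push w (push x r)))"
    using Cons reduced_push by auto
  ultimately show ?case using fp_equiv.trans by fastforce
qed

lemma fold_push_rev: "reduced r \<Longrightarrow> fold push (rev r) [] = r"
  by (induction r) (auto simp: push_def split: list.splits)

lemma cls_eq_iff: "u \<in> lists letters \<Longrightarrow> v \<in> lists letters \<Longrightarrow> cls u = cls v \<longleftrightarrow> fp_equiv G H u v"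
  using eq_equiv_class_iff[OF equiv_fp_rel[OF G.group_axioms H.group_axioms], of u v]
  by (simp add: fp_rel_def)

text \<open>The normal form theorem for free products: the action on the empty stack separates
  reduced words, and reduction reaches every class.\<close>

lemma bij_betw_cls: "bij_betw (\<lambda>r. cls (rev r)) {r. reduced r} (carrier (free_product G H))"
proof (rule bij_betw_imageI)
  show "inj_on (\<lambda>r. cls (rev r)) {r. reduced r}"
  proof (rule inj_onI)
    fix r r' assume r: "r \<in> {r. reduced r}" "r' \<in> {r. reduced r}" "cls (rev r) = cls (rev r')"
    then have "fp_equiv G H (rev r) (rev r')"
      using cls_eq_iff[of "rev r" "rev r'"] reduced_letters[of r] reduced_letters[of r'] by (simp add: rev_lists)
    from fold_push_fp_equiv[OF this, of "[]"] r show "r = r'" by (simp add: fold_push_rev)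
  qed
  show "(\<lambda>r. cls (rev r)) ` {r. reduced r} = carrier (free_product G H)"
  proof (intro equalityI subsetI)
    fix X assume "X \<in> carrier (free_product G H)"
    then obtain w where w: "w \<in> lists letters" "X = cls w"
      by (auto simp: free_product_def elim!: quotientE)
    have "fp_equiv G H w (rev (fold push w []))" using fp_equiv_fold_push[OF w(1), of "[]"] by simp
    moreover have red: "reduced (fold push w [])" using reduced_fold_push[OF w(1), of "[]"] by simp
    ultimately have "X = cls (rev (fold push w []))"
      using w cls_eq_iff[of w "rev (fold push w [])"] reduced_letters[OF red] by (simp add: rev_lists)
    with red show "X \<in> (\<lambda>r. cls (rev r)) ` {r. reduced r}" by blast
  next
    fix X assume "X \<in> (\<lambda>r. cls (rev r)) ` {r. reduced r}"
    then obtain r where "reduced r" "X = cls (rev r)" by blast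
    with reduced_letters[of r] show "X \<in> carrier (free_product G H)"
      by (simp add: free_product_def rev_lists quotientI)
  qed
qed

lemma cls_mult: "u \<in> lists letters \<Longrightarrow> v \<in> lists letters \<Longrightarrow> cls u \<otimes>\<^bsub>free_product G H\<^esub> cls v = cls (u @ v)"
  by (rule free_product_mult[OF G.group_axioms H.group_axioms])

lemma cls_push:
  assumes "x \<in> letters" "reduced r"
  shows "cls (rev r) \<otimes>\<^bsub>free_product G H\<^esub> cls [x] = cls (rev (push x r))"
proof -
  have r: "rev r \<in> lists letters" using reduced_letters[OF assms(2)] by (simp add: rev_lists)
  have "rev (push x r) \<in> lists letters" using reduced_letters[OF reduced_push[OF assms]] by (simp add: rev_lists)
  then have "cls (rev r @ [x]) = cls (rev (push x r))"
    using cls_eq_iff[of "rev r @ [x]" "rev (push x r)"] fp_equiv_push[OF assms(1), of r] r assms by (simp add: rev_lists)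
  then show ?thesis using cls_mult[OF r, of "[x]"] assms by simp
qed

lemma free_product_generators:
  assumes S: "semigroup_generators G S" and T: "semigroup_generators H T"
  shows "semigroup_generators (free_product G H) ((\<lambda>x. cls [x]) ` (S <+> T))"
proof -
  interpret F: group "free_product G H" by (rule group_free_product) unfold_locales
  define U where "U = (\<lambda>x. cls [x]) ` (S <+> T)"
  have ST: "S <+> T \<subseteq> letters" using S T by (auto simp: semigroup_generators_def)
  have clsI: "cls w \<in> carrier (free_product G H)" if "w \<in> lists letters" for w
    using that by (simp add: free_product_def quotientI)
  have UF: "U \<subseteq> carrier (free_product G H)" using ST by (auto simp: U_def intro!: clsI)
  define gen where "gen = (\<lambda>X. \<exists>ss. ss \<noteq> [] \<and> set ss \<subseteq> U \<and> X = gprod (free_product G H) ss)"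
  have gen_mult: "gen (X \<otimes>\<^bsub>free_product G H\<^esub> Y)" if "gen X" "gen Y" for X Y
  proof -
    from that(1) obtain ss where ss: "ss \<noteq> []" "set ss \<subseteq> U" "X = gprod (free_product G H) ss"
      unfolding gen_def by blast
    from that(2) obtain ts where ts: "set ts \<subseteq> U" "Y = gprod (free_product G H) ts"
      unfolding gen_def by blast
    have "gprod (free_product G H) (ss @ ts) = X \<otimes>\<^bsub>free_product G H\<^esub> Y"
      using F.gprod_append[OF subset_trans[OF ss(2) UF] subset_trans[OF ts(1) UF]] ss(3) ts(2) by simp
    with ss ts show ?thesis unfolding gen_def by (intro exI[of _ "ss @ ts"]) simp
  qed
  have gen_U: "gen X" if "X \<in> U" for X
    unfolding gen_def using that UF by (intro exI[of _ "[X]"]) (auto simp: gprod_def)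
  have gen_Inl: "gen (cls [Inl g])" if "g \<in> carrier G" for g
    using S that
  proof (induction rule: G.semigroup_generators_induct)
    case (generator s)
    then show ?case by (intro gen_U) (auto simp: U_def)
  next
    case (mult g h)
    have "cls [Inl g] \<otimes>\<^bsub>free_product G H\<^esub> cls [Inl h] = cls [Inl (g \<otimes>\<^bsub>G\<^esub> h)]"
      using mult cls_mult[of "[Inl g]" "[Inl h]"] cls_eq_iff[of "[Inl g, Inl h]" "[Inl (g \<otimes>\<^bsub>G\<^esub> h)]"]
        fp_equiv.mult_left[of g G h H] by auto
    then show ?case using gen_mult mult by metis
  qed
  have gen_Inr: "gen (cls [Inr g])" if "g \<in> carrier H" for g
    using T that
  proof (induction rule: H.semigroup_generators_induct)
    case (generator s)
    then show ?case by (intro gen_U) (auto simp: U_def)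
  next
    case (mult g h)
    have "cls [Inr g] \<otimes>\<^bsub>free_product G H\<^esub> cls [Inr h] = cls [Inr (g \<otimes>\<^bsub>H\<^esub> h)]"
      using mult cls_mult[of "[Inr g]" "[Inr h]"] cls_eq_iff[of "[Inr g, Inr h]" "[Inr (g \<otimes>\<^bsub>H\<^esub> h)]"]
        fp_equiv.mult_right[of g H h G] by auto
    then show ?case using gen_mult mult by metis
  qed
  have gen_cls: "gen (cls w)" if "w \<in> lists letters" for w
    using that
  proof (induction w)
    case Nil
    \<comment> \<open>Products of generators are nonempty by definition, so the empty word is
      replaced by the identity letter of \<open>G\<close>, which is such a product.\<close>
    have "cls [Inl \<one>\<^bsub>G\<^esub>] = cls []"
      by (subst cls_eq_iff) (auto intro: fp_equiv.one_left)
    then show ?case using gen_Inl[of "\<one>\<^bsub>G\<^esub>"] by simp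
  next
    case (Cons x w)
    have "gen (cls [x])" using Cons gen_Inl gen_Inr by auto
    moreover have "cls [x] \<otimes>\<^bsub>free_product G H\<^esub> cls w = cls (x # w)"
      using cls_mult[of "[x]" w] Cons by simp
    ultimately show ?case using gen_mult[OF _ Cons.IH] by metis
  qed
  show ?thesis
    unfolding U_def[symmetric]
  proof (rule F.semigroup_generatorsI[OF UF])
    fix X assume "X \<in> carrier (free_product G H)"
    then obtain w where "w \<in> lists letters" "X = cls w"
      by (auto simp: free_product_def elim!: quotientE)
    then show "\<exists>ss. ss \<noteq> [] \<and> set ss \<subseteq> U \<and> X = gprod (free_product G H) ss"
      using gen_cls unfolding gen_def by blast
  qed
qed

end

section \<open>Encoding of reduced words\<close>

locale disjoint_presentations = two_groups G H
  for G :: "('a, 'm) monoid_scheme" and H :: "('b, 'n) monoid_scheme" +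
  fixes b :: bool and \<Sigma>1 \<Sigma>2 L1 L2 \<psi>1 \<psi>2 \<rho>1 \<rho>2
  assumes P1: "presents b G \<Sigma>1 L1 \<psi>1 \<rho>1" and P2: "presents b H \<Sigma>2 L2 \<psi>2 \<rho>2"
    and disj: "\<Sigma>1 \<inter> \<Sigma>2 = {}"
    and Nil: "[] \<in> L1" "[] \<in> L2" and one: "\<psi>1 [] = \<one>\<^bsub>G\<^esub>" "\<psi>2 [] = \<one>\<^bsub>H\<^esub>"
begin

text \<open>Indexed by the value of \<open>isl\<close>, so that one argument serves both
  factors.\<close>

definition \<Sigma> :: "bool \<Rightarrow> nat set" where "\<Sigma> s = (if s then \<Sigma>1 else \<Sigma>2)"
definition L :: "bool \<Rightarrow> word set" where "L s = (if s then L1 else L2)"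
definition \<rho> :: "'a + 'b \<Rightarrow> real" where "\<rho> x = (case x of Inl a \<Rightarrow> \<rho>1 a | Inr a \<Rightarrow> \<rho>2 a)"
definition \<theta> :: "'a + 'b \<Rightarrow> word" where
  "\<theta> x = (case x of Inl a \<Rightarrow> inv_into L1 \<psi>1 a | Inr a \<Rightarrow> inv_into L2 \<psi>2 a)"

abbreviation side :: "bool \<Rightarrow> ('a + 'b) set" where "side s \<equiv> {x \<in> letters. isl x = s}"

lemma L_lists: "L s \<subseteq> lists (\<Sigma> s)"
  using P1 P2 by (auto simp: L_def \<Sigma>_def presents_def)

lemma bij_betw_theta: "bij_betw \<theta> (side s) (L s)"
proof (cases s)
  case True
  have "bij_betw (inv_into L1 \<psi>1) (carrier G) L1"
    using P1 by (intro bij_betw_inv_into) (simp add: presents_def)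
  moreover have "bij_betw projl (side True) (carrier G)"
    by (rule bij_betw_byWitness[where f' = Inl]) auto
  ultimately have "bij_betw (inv_into L1 \<psi>1 \<circ> projl) (side True) L1" by (rule bij_betw_trans[rotated])
  moreover have "bij_betw \<theta> (side True) L1 \<longleftrightarrow> bij_betw (inv_into L1 \<psi>1 \<circ> projl) (side True) L1"
    by (rule bij_betw_cong) (auto simp: \<theta>_def)
  ultimately show ?thesis using True by (simp add: L_def)
next
  case False
  have "bij_betw (inv_into L2 \<psi>2) (carrier H) L2"
    using P2 by (intro bij_betw_inv_into) (simp add: presents_def)
  moreover have "bij_betw projr (side False) (carrier H)"
    by (rule bij_betw_byWitness[where f' = Inr]) auto
  ultimately have "bij_betw (inv_into L2 \<psi>2 \<circ> projr) (side False) L2" by (rule bij_betw_trans[rotated])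
  moreover have "bij_betw \<theta> (side False) L2 \<longleftrightarrow> bij_betw (inv_into L2 \<psi>2 \<circ> projr) (side False) L2"
    by (rule bij_betw_cong) (auto simp: \<theta>_def)
  ultimately show ?thesis using False by (simp add: L_def)
qed

lemma theta_triv: "triv x \<Longrightarrow> \<theta> x = []"
  using inv_into_f_f[of \<psi>1 L1 "[]"] inv_into_f_f[of \<psi>2 L2 "[]"] P1 P2 Nil one
  by (cases x) (auto simp: \<theta>_def presents_def bij_betw_def)

lemma theta_in: "x \<in> letters \<Longrightarrow> \<theta> x \<in> L (isl x)"
  using bij_betwE[OF bij_betw_theta] by blast

lemma theta_Nil_iff: "x \<in> letters \<Longrightarrow> \<theta> x = [] \<longleftrightarrow> triv x"
proof
  assume x: "x \<in> letters" "\<theta> x = []"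
  define e where "e = (if isl x then Inl \<one>\<^bsub>G\<^esub> else Inr \<one>\<^bsub>H\<^esub>)"
  have "triv e" "e \<in> side (isl x)" by (auto simp: e_def)
  then have "x = e" using x theta_triv[of e]
    by (intro inj_onD[OF bij_betw_imp_inj_on[OF bij_betw_theta[of "isl x"]]]) auto
  with \<open>triv e\<close> show "triv x" by simp
qed (rule theta_triv)

definition enc :: "('a + 'b) list \<Rightarrow> word" where "enc r = concat (map \<theta> (rev r))"

lemma enc_Nil [simp]: "enc [] = []" and enc_Cons [simp]: "enc (x # r) = enc r @ \<theta> x"
  by (simp_all add: enc_def)

lemma theta_lists: "x \<in> letters \<Longrightarrow> \<theta> x \<in> lists (\<Sigma> (isl x))"
  using theta_in L_lists by blast

lemma enc_lists: "r \<in> lists letters \<Longrightarrow> enc r \<in> lists (\<Sigma>1 \<union> \<Sigma>2)"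
proof (induction r)
  case (Cons x r)
  then show ?case using theta_lists[of x] by (auto simp: \<Sigma>_def in_lists_conv_set split: if_splits)
qed simp

lemma disj_sides: "\<Sigma> s \<inter> \<Sigma> (\<not> s) = {}"
  using disj by (auto simp: \<Sigma>_def)

lemma enc_last: "reduced r \<Longrightarrow> r \<noteq> [] \<Longrightarrow> enc r \<noteq> [] \<and> last (enc r) \<in> \<Sigma> (isl (hd r))"
  using theta_lists[of "hd r"] theta_Nil_iff[of "hd r"]
  by (cases r) (auto simp: in_lists_conv_set)

lemma enc_last_notin: "reduced r \<Longrightarrow> r = [] \<or> isl (hd r) \<noteq> s \<Longrightarrow> enc r = [] \<or> last (enc r) \<notin> \<Sigma> s"
  using enc_last[of r] disj_sides[of s] by (cases "r = []") auto

lemma on_suffix_enc: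
  assumes "reduced r" "r = [] \<or> isl (hd r) \<noteq> s" "v \<in> lists (\<Sigma> s)"
  shows "on_suffix (\<Sigma> s) f (enc r @ v) = enc r @ f v"
  using assms by (intro on_suffix_append enc_last_notin) auto

text \<open>The last symbol of an encoding reveals the factor of the last block, and that block is
  the maximal suffix over the alphabet of this factor. Blocks can thus be stripped off one after
  another.\<close>

lemma enc_inj: "reduced r \<Longrightarrow> reduced r' \<Longrightarrow> enc r = enc r' \<Longrightarrow> r = r'"
proof (induction r arbitrary: r')
  case Nil
  then show ?case using enc_last[of r'] by auto
next
  case (Cons x r)
  from Cons.prems have ne: "r' \<noteq> []" using enc_last[of "x # r"] by auto
  then obtain y r1 where r': "r' = y # r1" by (cases r') auto
  have "isl y = isl x"
    using enc_last[OF Cons.prems(1)] enc_last[OF Cons.prems(2) ne] Cons.prems(3) disj_sides[of "isl x"] r'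
    by (cases "isl y = isl x") auto
  note y = this
  have x: "x \<in> letters" "reduced r" "r = [] \<or> isl (hd r) \<noteq> isl x"
    and y': "y \<in> letters" "reduced r1" "r1 = [] \<or> isl (hd r1) \<noteq> isl x"
    using Cons.prems r' y by auto
  have eq: "enc r @ \<theta> x = enc r1 @ \<theta> y" using Cons.prems(3) r' by simp
  \<comment> \<open>With the constant function \<open>[]\<close>, \<open>on_suffix\<close> deletes
    exactly the last block.\<close>
  have "on_suffix (\<Sigma> (isl x)) (\<lambda>_. []) (enc r @ \<theta> x) = enc r"
    using on_suffix_enc[OF x(2,3) theta_lists[OF x(1)]] by simp
  moreover have "on_suffix (\<Sigma> (isl x)) (\<lambda>_. []) (enc r1 @ \<theta> y) = enc r1"
    using on_suffix_enc[OF y'(2,3), of "\<theta> y"] theta_lists[OF y'(1)] y by simp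
  ultimately have "enc r = enc r1" using eq by simp
  moreover from this have "\<theta> x = \<theta> y" using eq by simp
  then have "x = y" using x y' y
    by (intro inj_onD[OF bij_betw_imp_inj_on[OF bij_betw_theta[of "isl x"]]]) auto
  ultimately show ?case using Cons.IH[OF x(2) y'(2)] r' by simp
qed

section \<open>The alternating language\<close>

definition blocks :: "bool \<Rightarrow> word set" where "blocks s = L s - {[]}"
definition runs :: "bool \<Rightarrow> word set" where "runs s = kstar (conc (blocks s) (blocks (\<not> s)))"

lemma alternating_eq: "alternating L1 L2 = (\<Union>s. runs s \<union> conc (runs s) (blocks s))"
proof -
  have "[] \<in> runs s" for s by (auto simp: runs_def kstar_def intro: exI[of _ "[]"])
  from this[of True] this[of False] show ?thesis
    by (auto simp: alternating_def Let_def runs_def blocks_def L_def UNIV_bool)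
qed

lemma runs_snoc: "w \<in> runs s \<Longrightarrow> u \<in> blocks s \<Longrightarrow> v \<in> blocks (\<not> s) \<Longrightarrow> w @ u @ v \<in> runs s"
proof -
  assume "w \<in> runs s" and uv: "u \<in> blocks s" "v \<in> blocks (\<not> s)"
  then obtain ws where ws: "w = concat ws" "set ws \<subseteq> conc (blocks s) (blocks (\<not> s))"
    by (auto simp: runs_def kstar_def)
  have "u @ v \<in> conc (blocks s) (blocks (\<not> s))" using uv by (auto simp: conc_def)
  then show ?thesis unfolding runs_def kstar_def using ws by (intro CollectI exI[of _ "ws @ [u @ v]"]) simp
qed

lemma theta_blocks: "x \<in> letters \<Longrightarrow> \<not> triv x \<Longrightarrow> \<theta> x \<in> blocks (isl x)"
  using theta_in theta_Nil_iff by (simp add: blocks_def)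

text \<open>In both languages the last block, if any, is on side \<open>\<not> s\<close>; they
  differ in the parity of the number of blocks. Appending a block changes the parity and the side,
  which is why \<open>s\<close> varies in the induction.\<close>

lemma enc_in_runs:
  "reduced r \<Longrightarrow> r = [] \<or> isl (hd r) \<noteq> s \<Longrightarrow> enc r \<in> runs s \<union> conc (runs (\<not> s)) (blocks (\<not> s))"
proof (induction r arbitrary: s)
  case Nil
  have "[] \<in> runs s" by (auto simp: runs_def kstar_def intro: exI[of _ "[]"])
  then show ?case by simp
next
  case (Cons x r)
  then have x: "isl x = (\<not> s)" "\<theta> x \<in> blocks (\<not> s)" using theta_blocks[of x] by auto
  have "enc r \<in> runs (\<not> s) \<union> conc (runs s) (blocks s)"
    using Cons.IH[of "\<not> s"] Cons.prems x by auto
  then show ?case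
  proof
    assume "enc r \<in> runs (\<not> s)"
    then show ?thesis using x by (auto simp: conc_def)
  next
    assume "enc r \<in> conc (runs s) (blocks s)"
    then show ?thesis using x runs_snoc[of _ s] by (auto simp: conc_def)
  qed
qed

lemma block_ex:
  assumes "u \<in> blocks s"
  obtains x where "x \<in> letters" "isl x = s" "\<not> triv x" "\<theta> x = u"
proof -
  have "u \<in> \<theta> ` side s" using assms bij_betw_imp_surj_on[OF bij_betw_theta[of s]] by (simp add: blocks_def)
  then obtain x where "x \<in> side s" "\<theta> x = u" by blast
  moreover have "\<not> triv x" using theta_triv[of x] assms \<open>\<theta> x = u\<close> by (auto simp: blocks_def)
  ultimately show ?thesis using that by blast
qed

lemma enc_snoc_block:
  assumes "reduced r" "r = [] \<or> isl (hd r) \<noteq> s" "u \<in> blocks s"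
  obtains x where "reduced (x # r)" "isl x = s" "enc (x # r) = enc r @ u"
proof -
  obtain x where "x \<in> letters" "isl x = s" "\<not> triv x" "\<theta> x = u" using block_ex[OF assms(3)] .
  with assms that[of x] show ?thesis by auto
qed

lemma runs_enc:
  assumes "w \<in> runs s"
  shows "\<exists>r. reduced r \<and> (r = [] \<or> isl (hd r) \<noteq> s) \<and> enc r = w"
proof -
  obtain ws where w: "w = concat ws" and "set ws \<subseteq> conc (blocks s) (blocks (\<not> s))"
    using assms by (auto simp: runs_def kstar_def)
  from this(2) have "\<exists>r. reduced r \<and> (r = [] \<or> isl (hd r) \<noteq> s) \<and> enc r = concat ws"
  proof (induction ws rule: rev_induct)
    case Nil
    show ?case by (rule exI[of _ "[]"]) simp
  next
    case (snoc y ws)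
    then obtain r where r: "reduced r" "r = [] \<or> isl (hd r) \<noteq> s" "enc r = concat ws" by auto
    obtain u v where uv: "u \<in> blocks s" "v \<in> blocks (\<not> s)" "y = u @ v"
      using snoc.prems by (auto simp: conc_def)
    obtain x where x: "reduced (x # r)" "isl x = s" "enc (x # r) = enc r @ u"
      using enc_snoc_block[OF r(1,2) uv(1)] .
    obtain z where "reduced (z # x # r)" "isl z = (\<not> s)" "enc (z # x # r) = enc (x # r) @ v"
      using enc_snoc_block[OF x(1) _ uv(2)] x(2) by auto
    then show ?case using x r uv by (intro exI[of _ "z # x # r"]) auto
  qed
  with w show ?thesis by simp
qed

lemma enc_image: "enc ` {r. reduced r} = alternating L1 L2"
proof (intro equalityI subsetI)
  fix w assume "w \<in> enc ` {r. reduced r}"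
  then obtain r where r: "reduced r" "w = enc r" by blast
  have "w \<in> runs (\<not> isl (hd r)) \<union> conc (runs (isl (hd r))) (blocks (isl (hd r)))"
    using enc_in_runs[OF r(1), of "\<not> isl (hd r)"] r by simp
  then show "w \<in> alternating L1 L2" unfolding alternating_eq by blast
next
  fix w assume "w \<in> alternating L1 L2"
  then obtain s where "w \<in> runs s \<or> w \<in> conc (runs s) (blocks s)" unfolding alternating_eq by blast
  then show "w \<in> enc ` {r. reduced r}"
  proof
    assume "w \<in> runs s"
    then show ?thesis using runs_enc by blast
  next
    assume "w \<in> conc (runs s) (blocks s)"
    then obtain v u where vu: "v \<in> runs s" "u \<in> blocks s" "w = v @ u" by (auto simp: conc_def)
    from runs_enc[OF vu(1)] obtain r where r: "reduced r" "r = [] \<or> isl (hd r) \<noteq> s" "enc r = v" by blast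
    from enc_snoc_block[OF r(1,2) vu(2)] r(3) vu(3) show ?thesis by (metis image_eqI mem_Collect_eq)
  qed
qed

lemma bij_betw_enc: "bij_betw enc {r. reduced r} (alternating L1 L2)"
  unfolding bij_betw_def using enc_inj enc_image by (auto simp: inj_on_def)

section \<open>Right multiplication by a letter\<close>

lemma letter_function:
  assumes x: "x \<in> letters"
  obtains f where "polytime (\<Sigma> (isl x)) f" "\<And>y. y \<in> side (isl x) \<Longrightarrow> f (\<theta> y) = \<theta> (mul y x)"
proof -
  have "\<exists>f. polytime (\<Sigma> (isl x)) f \<and> (\<forall>y\<in>side (isl x). f (\<theta> y) = \<theta> (mul y x))"
  proof (cases x)
    case (Inl a)
    then have a: "a \<in> carrier G" using x by auto
    have bij: "bij_betw \<psi>1 L1 (carrier G)" using P1 by (simp add: presents_def)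
    obtain f where f: "polytime \<Sigma>1 f" "f \<in> L1 \<rightarrow> L1" "\<And>w. w \<in> L1 \<Longrightarrow> \<psi>1 (f w) = \<psi>1 w \<otimes>\<^bsub>G\<^esub> a"
      using P1 a unfolding presents_def right_mult_def by blast
    have "f (inv_into L1 \<psi>1 c) = inv_into L1 \<psi>1 (c \<otimes>\<^bsub>G\<^esub> a)" if "c \<in> carrier G" for c
    proof -
      have c: "inv_into L1 \<psi>1 c \<in> L1" "\<psi>1 (inv_into L1 \<psi>1 c) = c"
        using that bij by (auto simp: bij_betw_def inv_into_into f_inv_into_f)
      then have "f (inv_into L1 \<psi>1 c) \<in> L1" "\<psi>1 (f (inv_into L1 \<psi>1 c)) = c \<otimes>\<^bsub>G\<^esub> a" using f by auto
      then show ?thesis using inv_into_f_f[OF bij_betw_imp_inj_on[OF bij]] by metis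
    qed
    then show ?thesis using f(1) Inl by (intro exI[of _ f]) (auto simp: \<Sigma>_def \<theta>_def)
  next
    case (Inr a)
    then have a: "a \<in> carrier H" using x by auto
    have bij: "bij_betw \<psi>2 L2 (carrier H)" using P2 by (simp add: presents_def)
    obtain f where f: "polytime \<Sigma>2 f" "f \<in> L2 \<rightarrow> L2" "\<And>w. w \<in> L2 \<Longrightarrow> \<psi>2 (f w) = \<psi>2 w \<otimes>\<^bsub>H\<^esub> a"
      using P2 a unfolding presents_def right_mult_def by blast
    have "f (inv_into L2 \<psi>2 c) = inv_into L2 \<psi>2 (c \<otimes>\<^bsub>H\<^esub> a)" if "c \<in> carrier H" for c
    proof -
      have c: "inv_into L2 \<psi>2 c \<in> L2" "\<psi>2 (inv_into L2 \<psi>2 c) = c"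
        using that bij by (auto simp: bij_betw_def inv_into_into f_inv_into_f)
      then have "f (inv_into L2 \<psi>2 c) \<in> L2" "\<psi>2 (f (inv_into L2 \<psi>2 c)) = c \<otimes>\<^bsub>H\<^esub> a" using f by auto
      then show ?thesis using inv_into_f_f[OF bij_betw_imp_inj_on[OF bij]] by metis
    qed
    then show ?thesis using f(1) Inr by (intro exI[of _ f]) (auto simp: \<Sigma>_def \<theta>_def isl_def)
  qed
  then show ?thesis using that by blast
qed

text \<open>The empty suffix covers the exceptional cases of \<open>push\<close>: it encodes the
  identity of the factor, so \<open>f\<close> can create a block from it, and a product that becomes
  trivial is encoded by it, so the block vanishes.\<close>

lemma on_suffix_push:
  assumes x: "x \<in> letters" and f: "\<And>y. y \<in> side (isl x) \<Longrightarrow> f (\<theta> y) = \<theta> (mul y x)" and r: "reduced r"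
  shows "on_suffix (\<Sigma> (isl x)) f (enc r) = enc (push x r)"
proof (cases "r = [] \<or> isl (hd r) \<noteq> isl x")
  case True
  \<comment> \<open>Here the suffix is empty and is read as the identity letter \<open>e\<close> on
    the side of \<open>x\<close>.\<close>
  define e where "e = (if isl x then Inl \<one>\<^bsub>G\<^esub> else Inr \<one>\<^bsub>H\<^esub>)"
  have "triv e" "e \<in> side (isl x)" by (auto simp: e_def)
  then have "f [] = \<theta> x" using f[of e] theta_triv[of e] mul_triv[of x e] x by simp
  then have "on_suffix (\<Sigma> (isl x)) f (enc r) = enc r @ \<theta> x"
    using on_suffix_enc[OF r True, of "[]"] by simp
  moreover have "push x r = (if triv x then r else x # r)" using True by (cases r) (auto simp: push_def)
  ultimately show ?thesis using theta_triv[of x] by simp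
next
  case False
  then obtain y r' where y: "r = y # r'" "isl y = isl x" by (cases r) auto
  with r have r': "y \<in> letters" "\<not> triv y" "reduced r'" "r' = [] \<or> isl (hd r') \<noteq> isl x" by auto
  have "on_suffix (\<Sigma> (isl x)) f (enc r) = enc r' @ f (\<theta> y)"
    using on_suffix_enc[OF r'(3,4), of "\<theta> y"] theta_lists[OF r'(1)] y by simp
  also have "f (\<theta> y) = \<theta> (mul y x)" using f[of y] r' y by simp
  also have "enc r' @ \<theta> (mul y x) = enc (push x r)"
  proof (cases "triv x")
    case True
    then have "mul y x = y" using mul_triv[of y x] r' y by simp
    with True y show ?thesis by (simp add: push_def)
  next
    case False
    then show ?thesis using y theta_triv[of "mul y x"] by (simp add: push_def)
  qed
  finally show ?thesis .
qed

definition \<psi> :: "word \<Rightarrow> ('a + 'b) list set" where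
  "\<psi> w = cls (rev (inv_into {r. reduced r} enc w))"

definition \<rho>' :: "('a + 'b) list set \<Rightarrow> real" where
  "\<rho>' X = sum_list (map \<rho> (inv_into {r. reduced r} (\<lambda>r. cls (rev r)) X))"

lemma psi_enc: "reduced r \<Longrightarrow> \<psi> (enc r) = cls (rev r)"
  unfolding \<psi>_def using inv_into_f_f[OF bij_betw_imp_inj_on[OF bij_betw_enc], of r] by simp

lemma rho'_cls: "reduced r \<Longrightarrow> \<rho>' (cls (rev r)) = sum_list (map \<rho> r)"
  unfolding \<rho>'_def using inv_into_f_f[OF bij_betw_imp_inj_on[OF bij_betw_cls], of r] by simp

lemma bij_betw_psi: "bij_betw \<psi> (alternating L1 L2) (carrier (free_product G H))"
  using bij_betw_trans[OF bij_betw_inv_into[OF bij_betw_enc] bij_betw_cls]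
  by (simp add: \<psi>_def[abs_def] comp_def)

lemma right_mult_letter:
  assumes x: "x \<in> letters"
  shows "right_mult (free_product G H) (\<Sigma>1 \<union> \<Sigma>2) (alternating L1 L2) \<psi> (cls [x])"
proof -
  obtain f where f: "polytime (\<Sigma> (isl x)) f" "\<And>y. y \<in> side (isl x) \<Longrightarrow> f (\<theta> y) = \<theta> (mul y x)"
    using letter_function[OF x] by blast
  have "polytime (\<Sigma>1 \<union> \<Sigma>2) (on_suffix (\<Sigma> (isl x)) f)"
    by (rule polytime_on_suffix[OF _ _ f(1)]) (use P1 P2 in \<open>auto simp: \<Sigma>_def presents_def\<close>)
  moreover have "on_suffix (\<Sigma> (isl x)) f w \<in> alternating L1 L2
      \<and> \<psi> (on_suffix (\<Sigma> (isl x)) f w) = \<psi> w \<otimes>\<^bsub>free_product G H\<^esub> cls [x]"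
    if w: "w \<in> alternating L1 L2" for w
  proof -
    obtain r where r: "reduced r" "w = enc r" using w enc_image by blast
    have "on_suffix (\<Sigma> (isl x)) f w = enc (push x r)" using on_suffix_push[OF x f(2) r(1)] r(2) by simp
    moreover have "reduced (push x r)" by (rule reduced_push[OF x r(1)])
    ultimately show ?thesis using enc_image cls_push[OF x r(1)] r by (auto simp: psi_enc)
  qed
  ultimately show ?thesis unfolding right_mult_def by (intro exI[of _ "on_suffix (\<Sigma> (isl x)) f"]) auto
qed

section \<open>Length bounds in the free product\<close>

lemma theta_length: "b \<Longrightarrow> x \<in> letters \<Longrightarrow> real (length (\<theta> x)) \<le> \<rho> x"
proof (cases x)
  case (Inl a)
  assume b "x \<in> letters"
  then have "inv_into L1 \<psi>1 a \<in> L1" "\<psi>1 (inv_into L1 \<psi>1 a) = a"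
    using Inl P1 by (auto simp: presents_def bij_betw_def inv_into_into f_inv_into_f)
  moreover have "\<And>w. w \<in> L1 \<Longrightarrow> real (length w) \<le> \<rho>1 (\<psi>1 w)" using P1 \<open>b\<close> by (simp add: presents_def)
  ultimately show ?thesis using Inl by (fastforce simp: \<theta>_def \<rho>_def)
next
  case (Inr a)
  assume b "x \<in> letters"
  then have "inv_into L2 \<psi>2 a \<in> L2" "\<psi>2 (inv_into L2 \<psi>2 a) = a"
    using Inr P2 by (auto simp: presents_def bij_betw_def inv_into_into f_inv_into_f)
  moreover have "\<And>w. w \<in> L2 \<Longrightarrow> real (length w) \<le> \<rho>2 (\<psi>2 w)" using P2 \<open>b\<close> by (simp add: presents_def)
  ultimately show ?thesis using Inr by (fastforce simp: \<theta>_def \<rho>_def)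
qed

lemma enc_length: "b \<Longrightarrow> r \<in> lists letters \<Longrightarrow> real (length (enc r)) \<le> sum_list (map \<rho> r)"
proof (induction r)
  case (Cons x r)
  then show ?case using theta_length[of x] by simp
qed simp

lemma rho_mul:
  assumes b and x: "x \<in> letters"
  obtains K where "\<And>y. y \<in> side (isl x) \<Longrightarrow> \<rho> (mul y x) \<le> \<rho> y + K"
proof (cases x)
  case (Inl a)
  with x have "a \<in> carrier G" by auto
  then obtain K where "\<And>c. c \<in> carrier G \<Longrightarrow> \<rho>1 (c \<otimes>\<^bsub>G\<^esub> a) \<le> \<rho>1 c + K"
    using P1 assms unfolding presents_def bounded_increase_def by blast
  then have "\<rho> (mul y x) \<le> \<rho> y + K" if "y \<in> side (isl x)" for y
    using that Inl by (cases y) (auto simp: \<rho>_def)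
  then show ?thesis by (rule that)
next
  case (Inr a)
  with x have "a \<in> carrier H" by auto
  then obtain K where "\<And>c. c \<in> carrier H \<Longrightarrow> \<rho>2 (c \<otimes>\<^bsub>H\<^esub> a) \<le> \<rho>2 c + K"
    using P2 assms unfolding presents_def bounded_increase_def by blast
  then have "\<rho> (mul y x) \<le> \<rho> y + K" if "y \<in> side (isl x)" for y
    using that Inr by (cases y) (auto simp: \<rho>_def)
  then show ?thesis by (rule that)
qed

lemma bounded_increase_letter:
  assumes b and x: "x \<in> letters"
  shows "bounded_increase (free_product G H) \<rho>' (cls [x])"
proof -
  obtain K where K: "\<And>y. y \<in> side (isl x) \<Longrightarrow> \<rho> (mul y x) \<le> \<rho> y + K"
    using rho_mul[OF assms] by blast
  \<comment> \<open>Bounds of lengths are nonnegative. This covers cancellation, where the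
    contribution of the head is lost from the sum.\<close>
  have pos: "0 \<le> \<rho> y" if "y \<in> letters" for y using theta_length[OF \<open>b\<close> that] by linarith
  \<comment> \<open>At most the head changes: \<open>x\<close> is added, or the head is multiplied
    by \<open>x\<close>, or it is deleted. The constant covers each case.\<close>
  have push: "sum_list (map \<rho> (push x r)) \<le> sum_list (map \<rho> r) + (\<bar>K\<bar> + \<rho> x)" if r: "reduced r" for r
  proof (cases r)
    case Nil
    then show ?thesis using pos[OF x] by (auto simp: push_def)
  next
    case (Cons y r')
    then have "y \<in> letters" using r by simp
    then show ?thesis using Cons pos[OF x] pos[of y] K[of y] by (auto simp: push_def)
  qed
  have "\<rho>' (X \<otimes>\<^bsub>free_product G H\<^esub> cls [x]) \<le> \<rho>' X + (\<bar>K\<bar> + \<rho> x)"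
    if X: "X \<in> carrier (free_product G H)" for X
  proof -
    from X have "X \<in> (\<lambda>r. cls (rev r)) ` {r. reduced r}" using bij_betw_imp_surj_on[OF bij_betw_cls] by simp
    then obtain r where r: "reduced r" "X = cls (rev r)" by blast
    then show ?thesis using cls_push[OF x r(1)] reduced_push[OF x r(1)] push[OF r(1)] by (simp add: rho'_cls)
  qed
  then show ?thesis unfolding bounded_increase_def by blast
qed

lemma presents_free_product:
  assumes S: "semigroup_generators G S" and T: "semigroup_generators H T"
  shows "presents b (free_product G H) (\<Sigma>1 \<union> \<Sigma>2) (alternating L1 L2) \<psi> \<rho>'"
proof -
  interpret F: group "free_product G H" by (rule group_free_product) unfold_locales
  have ST: "S <+> T \<subseteq> letters" using S T by (auto simp: semigroup_generators_def)
  show ?thesis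
  proof (rule F.presentsI[OF free_product_generators[OF S T] _ _ bij_betw_psi])
    show "finite (\<Sigma>1 \<union> \<Sigma>2)" using P1 P2 by (simp add: presents_def)
    show "alternating L1 L2 \<subseteq> lists (\<Sigma>1 \<union> \<Sigma>2)"
    proof
      fix w assume "w \<in> alternating L1 L2"
      then obtain r where "reduced r" "w = enc r" using enc_image by blast
      then show "w \<in> lists (\<Sigma>1 \<union> \<Sigma>2)" using enc_lists[OF reduced_letters] by simp
    qed
    fix X assume X: "X \<in> (\<lambda>x. cls [x]) ` (S <+> T)"
    then show "right_mult (free_product G H) (\<Sigma>1 \<union> \<Sigma>2) (alternating L1 L2) \<psi> X"
      using ST right_mult_letter by blast
    show "bounded_increase (free_product G H) \<rho>' X" if b
      using ST X bounded_increase_letter[OF that] by blast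
  next
    fix w assume b: b and "w \<in> alternating L1 L2"
    then obtain r where r: "reduced r" "w = enc r" using enc_image by blast
    then show "real (length w) \<le> \<rho>' (\<psi> w)"
      using enc_length[OF b reduced_letters[OF r(1)]] by (simp add: psi_enc rho'_cls)
  qed
qed

end

lemma presentable_free_product:
  fixes G :: "('a, 'm) monoid_scheme" and H :: "('b, 'n) monoid_scheme"
  assumes C: "language_class \<C>" and G: "presentable \<C> b G" and H: "presentable \<C> b H"
    and exch: "\<forall>L w. L \<in> \<C> \<and> L \<noteq> {} \<and> [] \<notin> L \<and> w \<in> L \<longrightarrow> (L - {w}) \<union> {[]} \<in> \<C>"
    and alt: "\<And>\<Sigma>\<^sub>1 \<Sigma>\<^sub>2 L\<^sub>1 L\<^sub>2. finite \<Sigma>\<^sub>1 \<Longrightarrow> finite \<Sigma>\<^sub>2 \<Longrightarrow> \<Sigma>\<^sub>1 \<inter> \<Sigma>\<^sub>2 = {} \<Longrightarrow>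
      L\<^sub>1 \<subseteq> lists \<Sigma>\<^sub>1 \<Longrightarrow> L\<^sub>1 \<in> \<C> \<Longrightarrow> [] \<in> L\<^sub>1 \<Longrightarrow> L\<^sub>2 \<subseteq> lists \<Sigma>\<^sub>2 \<Longrightarrow> L\<^sub>2 \<in> \<C> \<Longrightarrow> [] \<in> L\<^sub>2 \<Longrightarrow> alternating L\<^sub>1 L\<^sub>2 \<in> \<C>"
  shows "presentable \<C> b (free_product G H)"
proof -
  interpret G: group G using G by (simp add: presentable_def)
  interpret H: group H using H by (simp add: presentable_def)
  interpret two_groups G H by unfold_locales
  obtain S T where S: "finite S" "semigroup_generators G S" and T: "finite T" "semigroup_generators H T"
    using G H unfolding presentable_def by blast
  obtain \<Sigma>1 L0 \<psi>0 \<rho>0 where L0: "L0 \<in> \<C>" "presents b G \<Sigma>1 L0 \<psi>0 \<rho>0"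
    using G unfolding presentable_def by blast
  obtain L1 \<psi>1 \<rho>1 where L1: "L1 \<in> \<C>" "[] \<in> L1" "\<psi>1 [] = \<one>\<^bsub>G\<^esub>" and P1: "presents b G \<Sigma>1 L1 \<psi>1 \<rho>1"
    using presents_normalise[OF exch G.group_axioms L0] by metis
  have fin1: "finite \<Sigma>1" and sub1: "L1 \<subseteq> lists \<Sigma>1" using P1 by (auto simp: presents_def)
  \<comment> \<open>Normalising preserves the alphabet, so disjointness can be arranged before
    it.\<close>
  obtain \<Sigma>2 L0' \<psi>0' \<rho>0' where disj: "\<Sigma>2 \<inter> \<Sigma>1 = {}" and L0': "L0' \<in> \<C>" "presents b H \<Sigma>2 L0' \<psi>0' \<rho>0'"
    using presentable_disjoint[OF C H fin1] .
  obtain L2 \<psi>2 \<rho>2 where L2: "L2 \<in> \<C>" "[] \<in> L2" "\<psi>2 [] = \<one>\<^bsub>H\<^esub>" and P2: "presents b H \<Sigma>2 L2 \<psi>2 \<rho>2"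
    using presents_normalise[OF exch H.group_axioms L0'] by metis
  have fin2: "finite \<Sigma>2" and sub2: "L2 \<subseteq> lists \<Sigma>2" using P2 by (auto simp: presents_def)
  interpret disjoint_presentations G H b \<Sigma>1 \<Sigma>2 L1 L2 \<psi>1 \<psi>2 \<rho>1 \<rho>2
    by unfold_locales (use P1 P2 disj L1 L2 in auto)
  have "alternating L1 L2 \<in> \<C>"
    using fin1 fin2 disj sub1 sub2 L1 L2 by (intro alt[of \<Sigma>1 \<Sigma>2]) auto
  moreover have "finite ((\<lambda>x. cls [x]) ` (S <+> T))" using S(1) T(1) by simp
  ultimately show ?thesis
    unfolding presentable_def
    using group_free_product[OF G.group_axioms H.group_axioms] free_product_generators[OF S(2) T(2)]
      presents_free_product[OF S(2) T(2)] by blast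
qed

theorem theorem12:
  fixes \<C> :: "word set set"
  assumes "language_class \<C>"
  shows
    "((\<forall>\<Sigma> \<Sigma>\<^sub>0 L L\<^sub>0. finite \<Sigma> \<and> finite \<Sigma>\<^sub>0 \<and> \<Sigma> \<inter> \<Sigma>\<^sub>0 = {} \<and> L \<subseteq> lists \<Sigma> \<and> L \<in> \<C> \<and>
          L\<^sub>0 \<subseteq> lists \<Sigma>\<^sub>0 \<and> finite L\<^sub>0 \<longrightarrow> conc L L\<^sub>0 \<in> \<C>)
      \<longrightarrow> (\<forall>(G :: ('g, 'm) monoid_scheme) H.
             group G \<and> subgroup H G \<and> finite (rcosets\<^bsub>G\<^esub> H) \<longrightarrow>
             (cayley_polytime \<C> (G\<lparr>carrier := H\<rparr>) \<longrightarrow> cayley_polytime \<C> G) \<and>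
             (cayley_polytime_qg \<C> (G\<lparr>carrier := H\<rparr>) \<longrightarrow> cayley_polytime_qg \<C> G)))
     \<and>
     ((\<forall>\<Sigma>\<^sub>1 \<Sigma>\<^sub>2 L\<^sub>1 L\<^sub>2. finite \<Sigma>\<^sub>1 \<and> finite \<Sigma>\<^sub>2 \<and> \<Sigma>\<^sub>1 \<inter> \<Sigma>\<^sub>2 = {} \<and>
          L\<^sub>1 \<subseteq> lists \<Sigma>\<^sub>1 \<and> L\<^sub>1 \<in> \<C> \<and> L\<^sub>2 \<subseteq> lists \<Sigma>\<^sub>2 \<and> L\<^sub>2 \<in> \<C> \<longrightarrow> conc L\<^sub>1 L\<^sub>2 \<in> \<C>)
      \<longrightarrow> (\<forall>(G\<^sub>1 :: ('a, 'm1) monoid_scheme) (G\<^sub>2 :: ('b, 'm2) monoid_scheme).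
             (cayley_polytime \<C> G\<^sub>1 \<and> cayley_polytime \<C> G\<^sub>2 \<longrightarrow>
                cayley_polytime \<C> (G\<^sub>1 \<times>\<times> G\<^sub>2)) \<and>
             (cayley_polytime_qg \<C> G\<^sub>1 \<and> cayley_polytime_qg \<C> G\<^sub>2 \<longrightarrow>
                cayley_polytime_qg \<C> (G\<^sub>1 \<times>\<times> G\<^sub>2))))
     \<and>
     ((\<forall>L w. L \<in> \<C> \<and> L \<noteq> {} \<and> [] \<notin> L \<and> w \<in> L \<longrightarrow> (L - {w}) \<union> {[]} \<in> \<C>) \<and>
      (\<forall>\<Sigma>\<^sub>1 \<Sigma>\<^sub>2 L\<^sub>1 L\<^sub>2. finite \<Sigma>\<^sub>1 \<and> finite \<Sigma>\<^sub>2 \<and> \<Sigma>\<^sub>1 \<inter> \<Sigma>\<^sub>2 = {} \<and>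
          L\<^sub>1 \<subseteq> lists \<Sigma>\<^sub>1 \<and> L\<^sub>1 \<in> \<C> \<and> [] \<in> L\<^sub>1 \<and> L\<^sub>2 \<subseteq> lists \<Sigma>\<^sub>2 \<and> L\<^sub>2 \<in> \<C> \<and> [] \<in> L\<^sub>2
          \<longrightarrow> alternating L\<^sub>1 L\<^sub>2 \<in> \<C>)
      \<longrightarrow> (\<forall>(G\<^sub>1 :: ('a, 'm1) monoid_scheme) (G\<^sub>2 :: ('b, 'm2) monoid_scheme).
             (cayley_polytime \<C> G\<^sub>1 \<and> cayley_polytime \<C> G\<^sub>2 \<longrightarrow>
                cayley_polytime \<C> (free_product G\<^sub>1 G\<^sub>2)) \<and>
             (cayley_polytime_qg \<C> G\<^sub>1 \<and> cayley_polytime_qg \<C> G\<^sub>2 \<longrightarrow>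
                cayley_polytime_qg \<C> (free_product G\<^sub>1 G\<^sub>2))))"
proof (intro conjI impI allI)
  fix G :: "('g, 'm) monoid_scheme" and H
  assume conc: "\<forall>\<Sigma> \<Sigma>\<^sub>0 L L\<^sub>0. finite \<Sigma> \<and> finite \<Sigma>\<^sub>0 \<and> \<Sigma> \<inter> \<Sigma>\<^sub>0 = {} \<and> L \<subseteq> lists \<Sigma> \<and> L \<in> \<C> \<and>
      L\<^sub>0 \<subseteq> lists \<Sigma>\<^sub>0 \<and> finite L\<^sub>0 \<longrightarrow> conc L L\<^sub>0 \<in> \<C>"
    and G: "group G \<and> subgroup H G \<and> finite (rcosets\<^bsub>G\<^esub> H)"
  \<comment> \<open>With \<open>b\<close> arbitrary, the plain and the quasigeodesic closure are two
    instances of one fact.\<close>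
  have *: "presentable \<C> b G" if "presentable \<C> b (G\<lparr>carrier := H\<rparr>)" for b
    by (rule presentable_finite_extension[of G H]) (use that conc G in auto)
  show "cayley_polytime \<C> G" if "cayley_polytime \<C> (G\<lparr>carrier := H\<rparr>)"
    using * that by (simp add: cayley_polytime_iff)
  show "cayley_polytime_qg \<C> G" if "cayley_polytime_qg \<C> (G\<lparr>carrier := H\<rparr>)"
    using * that by (simp add: cayley_polytime_qg_iff)
next
  fix G1 :: "('a, 'm1) monoid_scheme" and G2 :: "('b, 'm2) monoid_scheme"
  assume conc: "\<forall>\<Sigma>\<^sub>1 \<Sigma>\<^sub>2 L\<^sub>1 L\<^sub>2. finite \<Sigma>\<^sub>1 \<and> finite \<Sigma>\<^sub>2 \<and> \<Sigma>\<^sub>1 \<inter> \<Sigma>\<^sub>2 = {} \<and>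
      L\<^sub>1 \<subseteq> lists \<Sigma>\<^sub>1 \<and> L\<^sub>1 \<in> \<C> \<and> L\<^sub>2 \<subseteq> lists \<Sigma>\<^sub>2 \<and> L\<^sub>2 \<in> \<C> \<longrightarrow> conc L\<^sub>1 L\<^sub>2 \<in> \<C>"
  have *: "presentable \<C> b (G1 \<times>\<times> G2)" if "presentable \<C> b G1" "presentable \<C> b G2" for b
    by (rule presentable_direct_product[OF assms that]) (use conc in auto)
  show "cayley_polytime \<C> (G1 \<times>\<times> G2)" if "cayley_polytime \<C> G1 \<and> cayley_polytime \<C> G2"
    using * that by (simp add: cayley_polytime_iff)
  show "cayley_polytime_qg \<C> (G1 \<times>\<times> G2)" if "cayley_polytime_qg \<C> G1 \<and> cayley_polytime_qg \<C> G2"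
    using * that by (simp add: cayley_polytime_qg_iff)
next
  fix G1 :: "('a, 'm1) monoid_scheme" and G2 :: "('b, 'm2) monoid_scheme"
  assume alt: "(\<forall>L w. L \<in> \<C> \<and> L \<noteq> {} \<and> [] \<notin> L \<and> w \<in> L \<longrightarrow> (L - {w}) \<union> {[]} \<in> \<C>) \<and>
      (\<forall>\<Sigma>\<^sub>1 \<Sigma>\<^sub>2 L\<^sub>1 L\<^sub>2. finite \<Sigma>\<^sub>1 \<and> finite \<Sigma>\<^sub>2 \<and> \<Sigma>\<^sub>1 \<inter> \<Sigma>\<^sub>2 = {} \<and>
          L\<^sub>1 \<subseteq> lists \<Sigma>\<^sub>1 \<and> L\<^sub>1 \<in> \<C> \<and> [] \<in> L\<^sub>1 \<and> L\<^sub>2 \<subseteq> lists \<Sigma>\<^sub>2 \<and> L\<^sub>2 \<in> \<C> \<and> [] \<in> L\<^sub>2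
          \<longrightarrow> alternating L\<^sub>1 L\<^sub>2 \<in> \<C>)"
  have *: "presentable \<C> b (free_product G1 G2)" if "presentable \<C> b G1" "presentable \<C> b G2" for b
    by (rule presentable_free_product[OF assms that]) (use alt in blast)+
  show "cayley_polytime \<C> (free_product G1 G2)" if "cayley_polytime \<C> G1 \<and> cayley_polytime \<C> G2"
    using * that by (simp add: cayley_polytime_iff)
  show "cayley_polytime_qg \<C> (free_product G1 G2)" if "cayley_polytime_qg \<C> G1 \<and> cayley_polytime_qg \<C> G2"
    using * that by (simp add: cayley_polytime_qg_iff)
qed

end
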